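(* For every real $0<\varepsilon<1$ there exists $d_0\in\mathbb{N}$ such that the following holds for all integers $d\ge d_0$ and all $n\in\mathbb{N}$. Let $G$ be an $n$-vertex $d$-degenerate $C_4$-free graph. Then $$\chi_f(G)\le (1+\varepsilon)\frac{d}{\log d}.$$ Moreover, there is a $\mathrm{poly}(n,d)$-time randomized algorithm that, with high probability, outputs a $\left((1-\varepsilon)\frac{\log d}{d},\,q\right)$-coloring of $G$ with $q=\Theta_\varepsilon\left(d\,\frac{\log n}{\log d}\right)$.
   Context: Graphs are finite and simple; $\log$ is the natural logarithm. An $n$-vertex graph $G$ is $d$-degenerate if there is an ordering $(v_1,\dots,v_n)$ of $V(G)$ such that for each $i\in\{1,\dots,n\}$ the vertex $v_i$ has at most $d$ neighbors in the induced subgraph $G[\{v_1,\dots,v_i\}]$. $C_4$-free means that $G$ contains no cycle of length $4$ as a (not necessarily induced) subgraph; triangles are allowed. Let $\mathcal{I}(G)$ be the collection of all independent sets of $G$. The fractional chromatic number $\chi_f(G)$ is the minimum of $\sum_{I\in\mathcal{I}(G)}x_I$ over all $(x_I)_{I\in\mathcal{I}(G)}$ with $x_I\ge 0$ for all $I$ and $\sum_{I\in\mathcal{I}(G):\, v\in I}x_I\ge 1$ for every $v\in V(G)$. For $\alpha\in[0,1]$ and $q\in\mathbb{N}$, an $(\alpha,q)$-coloring of $G$ is a collection of $q$ independent sets of $G$ (repetitions allowed) such that each vertex of $G$ lies in at least $\alpha q$ of them. "With high probability" means with probability $1-o(1)$ as $n\to\infty$. The notation $\Theta_\varepsilon$ means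 that the implied constants may depend only on $\varepsilon$; the algorithm takes $G$ as input, with $\varepsilon$ fixed. *)

theory Defs
  imports "HOL-Probability.Probability_Mass_Function"
begin

section \<open>Graphs\<close>

definition simple_graph :: "'a set \<Rightarrow> 'a set set \<Rightarrow> bool" where
  "simple_graph V E \<longleftrightarrow> finite V \<and> (\<forall>e\<in>E. e \<subseteq> V \<and> card e = 2)"

definition degenerate :: "nat \<Rightarrow> 'a set \<Rightarrow> 'a set set \<Rightarrow> bool" where
  "degenerate d V E \<longleftrightarrow>
     (\<exists>vs. distinct vs \<and> set vs = V \<and>
        (\<forall>i<length vs. card {u \<in> set (take (Suc i) vs). {u, vs ! i} \<in> E} \<le> d))"

definition C4_free :: "'a set \<Rightarrow> 'a set set \<Rightarrow> bool" where
  "C4_free V E \<longleftrightarrow>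
     \<not> (\<exists>w\<in>V. \<exists>x\<in>V. \<exists>y\<in>V. \<exists>z\<in>V. distinct [w, x, y, z] \<and>
          {w, x} \<in> E \<and> {x, y} \<in> E \<and> {y, z} \<in> E \<and> {z, w} \<in> E)"

definition indep_sets :: "'a set \<Rightarrow> 'a set set \<Rightarrow> 'a set set" where
  "indep_sets V E = {I. I \<subseteq> V \<and> (\<forall>u\<in>I. \<forall>v\<in>I. {u, v} \<notin> E)}"

definition fractional_cover :: "'a set \<Rightarrow> 'a set set \<Rightarrow> ('a set \<Rightarrow> real) \<Rightarrow> bool" where
  "fractional_cover V E x \<longleftrightarrow>
     (\<forall>I\<in>indep_sets V E. 0 \<le> x I) \<and>
     (\<forall>v\<in>V. (\<Sum>I | I \<in> indep_sets V E \<and> v \<in> I. x I) \<ge> 1)"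

text \<open>For a finite simple graph this infimum is a minimum: the set of values is nonempty and
  bounded below by 0, and the linear program may be restricted to the compact set of
  weights in the interval from 0 to 1.\<close>

definition fractional_chromatic_number :: "'a set \<Rightarrow> 'a set set \<Rightarrow> real" where
  "fractional_chromatic_number V E =
     Inf {\<Sum>I\<in>indep_sets V E. x I | x. fractional_cover V E x}"

text \<open>A collection with repetitions is represented by a list.\<close>

definition is_coloring :: "'a set \<Rightarrow> 'a set set \<Rightarrow> real \<Rightarrow> nat \<Rightarrow> 'a set list \<Rightarrow> bool" where
  "is_coloring V E \<alpha> q Is \<longleftrightarrow>
     length Is = q \<and> set Is \<subseteq> indep_sets V E \<and>
     (\<forall>v\<in>V. real (length (filter (\<lambda>I. v \<in> I) Is)) \<ge> \<alpha> * real q)"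


section \<open>Randomized algorithms\<close>

text \<open>
  The machine model is a random access machine with fair coin flips, programmed in a structured
  while-language. The memory consists of named one-dimensional arrays of natural numbers
  (a scalar variable is cell 0 of its array); a program mentions only finitely many names.
  The arithmetic is addition and truncated subtraction only. In particular there is no
  multiplication, so that one step lengthens the binary representations of the stored numbers by
  at most a constant depending on the program. Hence counting every step as one unit of time
  is polynomially equivalent to running time on probabilistic Turing machines.
\<close>

type_synonym store = "string \<Rightarrow> nat \<Rightarrow> nat"

datatype aexp = N nat | Cell string aexp | Plus aexp aexp | Minus aexp aexp

datatype bexp = Less aexp aexp | Not bexp | And bexp bexp

datatype com =
    SKIP
  | Assign string aexp aexp
  | Flip string aexp
  | Seq com com
  | If bexp com com
  | While bexp com

primrec aval :: "aexp \<Rightarrow> store \<Rightarrow> nat" where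
  "aval (N k) s = k"
| "aval (Cell x a) s = s x (aval a s)"
| "aval (Plus a b) s = aval a s + aval b s"
| "aval (Minus a b) s = aval a s - aval b s"

primrec bval :: "bexp \<Rightarrow> store \<Rightarrow> bool" where
  "bval (Less a b) s \<longleftrightarrow> aval a s < aval b s"
| "bval (Not b) s \<longleftrightarrow> \<not> bval b s"
| "bval (And b c) s \<longleftrightarrow> bval b s \<and> bval c s"

definition put :: "string \<Rightarrow> nat \<Rightarrow> nat \<Rightarrow> store \<Rightarrow> store" where
  "put x i k s = s(x := (s x)(i := k))"

text \<open>One computation step. The command \<open>SKIP\<close> is the halted program.\<close>

primrec step :: "com \<Rightarrow> store \<Rightarrow> (com \<times> store) pmf" where
  "step SKIP s = return_pmf (SKIP, s)"
| "step (Assign x a b) s = return_pmf (SKIP, put x (aval a s) (aval b s) s)"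
| "step (Flip x a) s =
     map_pmf (\<lambda>b. (SKIP, put x (aval a s) (of_bool b) s)) (bernoulli_pmf (1/2))"
| "step (Seq c1 c2) s =
     (if c1 = SKIP then return_pmf (c2, s)
      else map_pmf (\<lambda>(c, s'). (Seq c c2, s')) (step c1 s))"
| "step (If b c1 c2) s = return_pmf (if bval b s then c1 else c2, s)"
| "step (While b c) s =
     return_pmf (if bval b s then Seq c (While b c) else SKIP, s)"

primrec run :: "nat \<Rightarrow> com \<Rightarrow> store \<Rightarrow> (com \<times> store) pmf" where
  "run 0 c s = return_pmf (c, s)"
| "run (Suc t) c s = bind_pmf (step c s) (\<lambda>(c', s'). run t c' s')"

text \<open>Every possible run, whatever the coin flips, halts after at most \<open>t\<close> steps.\<close>

definition halts_within :: "nat \<Rightarrow> com \<Rightarrow> store \<Rightarrow> bool" where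
  "halts_within t c s \<longleftrightarrow> (\<forall>(c', s') \<in> set_pmf (run t c s). c' = SKIP)"

text \<open>
  The input graph is given by its adjacency matrix, stored row by row, with respect to a listing
  \<open>vs\<close> of its vertices; the parameter \<open>d\<close> is part of the input. The output is the number of
  sets followed by their characteristic vectors, again stored row by row.
\<close>

definition input_store :: "'a list \<Rightarrow> 'a set set \<Rightarrow> nat \<Rightarrow> store" where
  "input_store vs E d =
     (\<lambda>x k. let n = length vs in
        if x = ''n'' \<and> k = 0 then n
        else if x = ''d'' \<and> k = 0 then d
        else if x = ''adj'' \<and> k < n * n \<and> {vs ! (k div n), vs ! (k mod n)} \<in> E then 1
        else 0)"

definition output_sets :: "'a list \<Rightarrow> store \<Rightarrow> 'a set list" where
  "output_sets vs s =
     map (\<lambda>j. {vs ! i | i. i < length vs \<and> s ''out'' (j * length vs + i) = 1})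
       [0..<s ''q'' 0]"

end

theory Submission
  imports Defs "HOL-Library.Discrete_Functions" "HOL-Real_Asymp.Real_Asymp"
begin

text \<open>
  Process the vertices in degeneracy order. Every vertex starts with weight \<open>p\<close>, slightly below
  \<open>ln d / d\<close>; a vertex is selected with probability equal to its current weight, and then the weights
  of its later neighbours become \<open>0\<close>, or, if a vertex of weight \<open>x\<close> is not selected, are multiplied
  by \<open>1 / (1 - x)\<close>. Weights exceeding a small constant \<open>1 / k\<close> are set to \<open>0\<close>. The selected set is
  independent, and without the cap each weight would be a martingale, so every vertex would be
  selected with probability exactly \<open>p\<close>.

  The cap costs little. An uncapped weight at \<open>v\<close> is large only if the weights of the earlier
  neighbours \<open>u\<close> of \<open>v\<close> have a sum well above its mean \<open>p d\<close>. Tilt the measure by the uncapped weight of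
  \<open>v\<close> and consider the product of the factors \<open>1 + c w(u)\<close>. As the graph is \<open>C\<^sub>4\<close>-free, every vertex
  other than \<open>v\<close> is adjacent to at most one \<open>u\<close>, so each step changes only one factor, and the product is
  a supermartingale. Markov's inequality then gives an exponential tail bound.

  With weights that are integer multiples of \<open>1 / M\<close>, where \<open>M\<close> is a power of two and polynomial in
  \<open>d\<close>, the process runs on fair coins in polynomial time with addition and subtraction only. The program
  fills a tape with coin flips, and is deterministic before and after that.
\<close>

section \<open>Runs of programs\<close>

text \<open>The constant 1 in front of \<open>d / ln d\<close> comes from one comparison. The
  uncapped weight of \<open>v\<close> is about \<open>p\<close> times the exponential of the sum of
  its earlier neighbours' weights. With \<open>p = \<kappa> * ln d / d\<close> that sum is about
  \<kappa> ln d or less in the mean, so the weight is about \<open>ln d\<close> times the power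
  \<kappa> - 1 of \<open>d\<close>. It tends to 0, below every fixed cap, exactly when \<kappa> < 1.

  Tilting has a concrete meaning: it turns the process into the one in which the earlier neighbours
  of \<open>v\<close> are never selected. Up to rounding, \<open>v\<close> is selected with
  probability at least \<open>p\<close> times the probability that the cap does not act in the
  tilted process. So a failure probability of o(1) suffices; no union bound over vertices enters
  here.

  The cap is also what makes the tail bound possible: it bounds every summand by a constant, so that
  exponentials of the summands can be replaced by linear factors, which are all that a martingale
  can follow. The price is that the cap must be handled inside the supermartingale as well.

  Vertices meet again only in the algorithm, where about \<open>log n\<close> expected selections
  per vertex pay for a union bound.\<close>

lemma run_add: "run (t1 + t2) c s = bind_pmf (run t1 c s) (\<lambda>(c', s'). run t2 c' s')"
  by (induction t1 arbitrary: c s)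
     (auto simp: bind_return_pmf bind_assoc_pmf split_def)

lemma run_SKIP [simp]: "run t SKIP s = return_pmf (SKIP, s)"
  by (induction t) (auto simp: bind_return_pmf)

lemma halts_within_mono:
  assumes "halts_within t c s"
  shows "run (t + k) c s = run t c s"
proof -
  have "run (t + k) c s = bind_pmf (run t c s) (\<lambda>(c', s'). run k c' s')"
    by (rule run_add)
  also have "\<dots> = bind_pmf (run t c s) return_pmf"
    using assms by (intro bind_pmf_cong) (auto simp: halts_within_def)
  finally show ?thesis by (simp add: bind_return_pmf')
qed

definition final :: "nat \<Rightarrow> com \<Rightarrow> store \<Rightarrow> store pmf" where
  "final t c s = map_pmf snd (run t c s)"

text \<open>The additional step removes the halted first component. Runs of \<open>c1\<close> that
  halt early hand their surplus steps to \<open>c2\<close>, where they do no harm because a halted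
  program idles.\<close>

lemma run_Seq:
  assumes "halts_within t c1 s"
    and "\<And>s'. s' \<in> set_pmf (final t c1 s) \<Longrightarrow> halts_within t2 c2 s'"
  shows "run (Suc (t + t2)) (Seq c1 c2) s = bind_pmf (final t c1 s) (run t2 c2)"
  using assms
proof (induction t arbitrary: c1 s)
  case 0
  then have "c1 = SKIP" by (simp add: halts_within_def)
  then show ?case by (simp add: final_def bind_return_pmf)
next
  case (Suc t)
  show ?case
  proof (cases "c1 = SKIP")
    case True
    then have "final (Suc t) c1 s = return_pmf s" by (simp add: final_def bind_return_pmf)
    with Suc.prems have "halts_within t2 c2 s" by simp
    then have "run (t2 + Suc t) c2 s = run t2 c2 s" by (rule halts_within_mono)
    with True show ?thesis
      by (simp add: final_def bind_return_pmf add.commute)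
  next
    case False
    have IH: "run (Suc (t + t2)) (Seq c' c2) s' = bind_pmf (final t c' s') (run t2 c2)"
      if "(c', s') \<in> set_pmf (step c1 s)" for c' s'
    proof (rule Suc.IH)
      show "halts_within t c' s'"
        using Suc.prems(1) that by (fastforce simp: halts_within_def)
      show "halts_within t2 c2 s''" if "s'' \<in> set_pmf (final t c' s')" for s''
        using Suc.prems(2)[of s''] that \<open>(c', s') \<in> _\<close> by (fastforce simp: final_def)
    qed
    have "run (Suc (Suc t + t2)) (Seq c1 c2) s =
      bind_pmf (step c1 s) (\<lambda>(c', s'). run (Suc (t + t2)) (Seq c' c2) s')"
      unfolding run.simps(2)[of "Suc t + t2"]
      using False by (simp add: bind_map_pmf split_def del: run.simps)
    also have "\<dots> = bind_pmf (step c1 s) (\<lambda>(c', s'). bind_pmf (final t c' s') (run t2 c2))"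
      using IH by (intro bind_pmf_cong) (auto simp del: run.simps)
    also have "\<dots> = bind_pmf (final (Suc t) c1 s) (run t2 c2)"
      by (simp add: final_def bind_map_pmf bind_assoc_pmf split_def map_bind_pmf)
    finally show ?thesis .
  qed
qed

lemma halts_within_Seq:
  assumes "halts_within t c1 s"
    and "\<And>s'. s' \<in> set_pmf (final t c1 s) \<Longrightarrow> halts_within t2 c2 s'"
  shows "halts_within (Suc (t + t2)) (Seq c1 c2) s"
proof -
  have "run (Suc (t + t2)) (Seq c1 c2) s = bind_pmf (final t c1 s) (run t2 c2)"
    using assms by (rule run_Seq)
  with assms show ?thesis by (fastforce simp: halts_within_def)
qed

section \<open>Deterministic commands: time bounds and postconditions\<close>

text \<open>The result must be a point distribution, so this judgement is meant for the stretches of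
  the program that flip no coins, where it works like total correctness with a clock.
  \<open>t\<close> acts as an upper bound on the time, since a halted program idles.\<close>

definition ok :: "nat \<Rightarrow> com \<Rightarrow> store \<Rightarrow> (store \<Rightarrow> bool) \<Rightarrow> bool" where
  "ok t c s Q \<longleftrightarrow> (\<exists>s'. run t c s = return_pmf (SKIP, s') \<and> Q s')"

lemma okE:
  assumes "ok t c s Q"
  obtains s' where "halts_within t c s" "final t c s = return_pmf s'" "Q s'"
  using assms by (auto simp: ok_def halts_within_def final_def)

lemma ok_weaken: "ok t c s Q \<Longrightarrow> t \<le> t' \<Longrightarrow> (\<And>s'. Q s' \<Longrightarrow> Q' s') \<Longrightarrow> ok t' c s Q'"
proof -
  assume *: "ok t c s Q" "t \<le> t'" "\<And>s'. Q s' \<Longrightarrow> Q' s'"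
  then obtain s' where s': "run t c s = return_pmf (SKIP, s')" "Q s'" by (auto simp: ok_def)
  then have "halts_within t c s" by (simp add: halts_within_def)
  from halts_within_mono[OF this, of "t' - t"] s' * show ?thesis by (auto simp: ok_def)
qed

lemma ok_SKIP: "Q s \<Longrightarrow> ok 0 SKIP s Q"
  by (simp add: ok_def)

lemma ok_Assign: "Q (put x (aval a s) (aval b s) s) \<Longrightarrow> ok 1 (Assign x a b) s Q"
  by (simp add: ok_def bind_return_pmf)

lemma ok_Seq:
  assumes "ok t1 c1 s (\<lambda>s'. ok t2 c2 s' Q)"
  shows "ok (Suc (t1 + t2)) (Seq c1 c2) s Q"
proof -
  from assms obtain s' where s': "halts_within t1 c1 s" "final t1 c1 s = return_pmf s'"
    "ok t2 c2 s' Q" by (rule okE)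
  then have "halts_within t2 c2 s'" by (auto elim: okE)
  with s' have "run (Suc (t1 + t2)) (Seq c1 c2) s = run t2 c2 s'"
    by (subst run_Seq) (auto simp: bind_return_pmf)
  with s' show ?thesis by (simp add: ok_def)
qed

lemma ok_If:
  assumes "bval b s \<Longrightarrow> ok t1 c1 s Q" "\<not> bval b s \<Longrightarrow> ok t2 c2 s Q"
  shows "ok (Suc (max t1 t2)) (If b c1 c2) s Q"
proof -
  have "ok (max t1 t2) (if bval b s then c1 else c2) s Q"
    using assms by (auto intro: ok_weaken)
  then show ?thesis by (simp add: ok_def bind_return_pmf)
qed

lemma ok_While_False: "\<not> bval b s \<Longrightarrow> Q s \<Longrightarrow> ok 1 (While b c) s Q"
  by (simp add: ok_def bind_return_pmf)

lemma ok_While_True: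
  "bval b s \<Longrightarrow> ok t (Seq c (While b c)) s Q \<Longrightarrow> ok (Suc t) (While b c) s Q"
  by (simp add: ok_def bind_return_pmf)

primrec writes :: "com \<Rightarrow> string set" where
  "writes SKIP = {}"
| "writes (Assign x a b) = {x}"
| "writes (Flip x a) = {x}"
| "writes (Seq c1 c2) = writes c1 \<union> writes c2"
| "writes (If b c1 c2) = writes c1 \<union> writes c2"
| "writes (While b c) = writes c"

definition same_off :: "string set \<Rightarrow> store \<Rightarrow> store \<Rightarrow> bool" where
  "same_off X s s' \<longleftrightarrow> (\<forall>x. x \<notin> X \<longrightarrow> s' x = s x)"

lemma step_writes:
  "(c', s') \<in> set_pmf (step c s) \<Longrightarrow> writes c' \<subseteq> writes c \<and> same_off (writes c) s s'"
proof (induction c arbitrary: c')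
  case (Seq c1 c2)
  show ?case
  proof (cases "c1 = SKIP")
    case False
    with Seq.prems obtain c1' where "(c1', s') \<in> set_pmf (step c1 s)" "c' = Seq c1' c2"
      by auto
    with Seq.IH(1)[of c1'] show ?thesis by (auto simp: same_off_def)
  qed (use Seq.prems in \<open>auto simp: same_off_def\<close>)
qed (auto simp: same_off_def put_def split: if_splits)

lemma run_writes: "(c', s') \<in> set_pmf (run t c s) \<Longrightarrow> same_off (writes c) s s'"
proof (induction t arbitrary: c s)
  case 0
  then show ?case by (simp add: same_off_def)
next
  case (Suc t)
  then obtain c1 s1 where "(c1, s1) \<in> set_pmf (step c s)" "(c', s') \<in> set_pmf (run t c1 s1)"
    by auto
  with Suc.IH[of c1 s1] step_writes[of c1 s1 c s] show ?case by (auto simp: same_off_def)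
qed

lemma ok_frame:
  assumes "ok t c s Q"
  shows "ok t c s (\<lambda>s'. Q s' \<and> same_off (writes c) s s')"
proof -
  from assms obtain s' where s': "run t c s = return_pmf (SKIP, s')" "Q s'" by (auto simp: ok_def)
  then have "same_off (writes c) s s'" by (intro run_writes[of SKIP s' t]) simp
  with s' show ?thesis by (auto simp: ok_def)
qed

abbreviation Var :: "string \<Rightarrow> aexp" where "Var x \<equiv> Cell x (N 0)"

abbreviation Put :: "string \<Rightarrow> aexp \<Rightarrow> com" where "Put x a \<equiv> Assign x (N 0) a"

definition For :: "string \<Rightarrow> aexp \<Rightarrow> com \<Rightarrow> com" where
  "For x a c = Seq (Put x (N 0)) (While (Less (Var x) a) (Seq c (Put x (Plus (Var x) (N 1)))))"

lemma writes_For [simp]: "writes (For x a c) = insert x (writes c)"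
  by (auto simp: For_def)

lemma put_scalar: "put x 0 k s x 0 = k" "y \<noteq> x \<Longrightarrow> put x i k s y = s y"
  by (auto simp: put_def)

text \<open>The loop bound is evaluated anew before every iteration, hence \<open>bound\<close>. The
  counter is increased after the body, hence \<open>insens\<close>. The 4 extra steps per iteration
  are the test, the increment and two removals of a halted component; the final 3 are the initial
  assignment, its removal and the failing test.\<close>

lemma ok_For:
  assumes x: "x \<notin> writes c"
    and base: "Inv 0 s"
    and bound: "\<And>s'. same_off (insert x (writes c)) s s' \<Longrightarrow> aval a s' = m"
    and body: "\<And>k s'. k < m \<Longrightarrow> same_off (insert x (writes c)) s s' \<Longrightarrow> s' x 0 = k \<Longrightarrow>
                 Inv k s' \<Longrightarrow> ok T c s' (Inv (Suc k))"
    and insens: "\<And>k j s'. Inv k s' \<Longrightarrow> Inv k (put x 0 j s')"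
    and post: "\<And>s'. same_off (insert x (writes c)) s s' \<Longrightarrow> Inv m s' \<Longrightarrow> Q s'"
  shows "ok (m * (T + 4) + 3) (For x a c) s Q"
proof -
  let ?W = "While (Less (Var x) a) (Seq c (Put x (Plus (Var x) (N 1))))"
  let ?same = "same_off (insert x (writes c)) s"
  have loop: "ok ((m - k) * (T + 4) + 1) ?W s' Q"
    if "k \<le> m" "?same s'" "s' x 0 = k" "Inv k s'" for k s'
    using that
  proof (induction "m - k" arbitrary: k s')
    case 0
    then have "ok 1 ?W s' Q"
      using bound[of s'] post[of s'] by (intro ok_While_False) auto
    with 0 show ?case by simp
  next
    case (Suc j)
    then have k: "k < m" by simp
    have "ok T c s' (\<lambda>s''. Inv (Suc k) s'' \<and> same_off (writes c) s' s'')"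
      using k Suc.prems by (intro ok_frame body)
    then have "ok T c s' (\<lambda>s''. ok 1 (Put x (Plus (Var x) (N 1))) s''
        (\<lambda>s3. Inv (Suc k) s3 \<and> s3 x 0 = Suc k \<and> ?same s3))"
    proof (rule ok_weaken)
      fix s'' assume s'': "Inv (Suc k) s'' \<and> same_off (writes c) s' s''"
      then have "s'' x 0 = k" using x Suc.prems by (simp add: same_off_def)
      then show "ok 1 (Put x (Plus (Var x) (N 1))) s''
        (\<lambda>s3. Inv (Suc k) s3 \<and> s3 x 0 = Suc k \<and> ?same s3)"
        using s'' Suc.prems insens[of "Suc k" s'' "Suc k"]
        by (intro ok_Assign) (auto simp: put_def same_off_def)
    qed simp
    then have "ok (Suc (T + 1)) (Seq c (Put x (Plus (Var x) (N 1)))) s'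
        (\<lambda>s3. Inv (Suc k) s3 \<and> s3 x 0 = Suc k \<and> ?same s3)"
      by (rule ok_Seq)
    then have "ok (Suc (T + 1)) (Seq c (Put x (Plus (Var x) (N 1)))) s'
        (\<lambda>s3. ok ((m - Suc k) * (T + 4) + 1) ?W s3 Q)"
      by (rule ok_weaken) (use Suc k in auto)
    then have "ok (Suc (Suc (T + 1) + ((m - Suc k) * (T + 4) + 1)))
        (Seq (Seq c (Put x (Plus (Var x) (N 1)))) ?W) s' Q"
      by (rule ok_Seq)
    then have "ok (Suc (Suc (Suc (T + 1) + ((m - Suc k) * (T + 4) + 1)))) ?W s' Q"
      using bound[of s'] Suc.prems k by (intro ok_While_True) auto
    moreover have "m - k = Suc (m - Suc k)" using k by simp
    ultimately show ?case by (elim ok_weaken) simp_all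
  qed
  have "ok 1 (Put x (N 0)) s (\<lambda>s'. ok ((m - 0) * (T + 4) + 1) ?W s' Q)"
    using base insens[of 0 s 0]
    by (intro ok_Assign loop) (auto simp: put_def same_off_def)
  from ok_Seq[OF this] show ?thesis
    unfolding For_def by (elim ok_weaken) simp_all
qed

section \<open>The selection process\<close>

lemma real_div_nat_ge: "real n / real x - 1 \<le> real (n div x)"
  using floor_divide_of_nat_eq[of n x, where 'a = real] by linarith

text \<open>
  Weights are stored as integer multiples of \<open>1 / M\<close>, rounded down. \<open>acc I w i j\<close> is the weight of
  position \<open>i\<close> once the positions below \<open>j\<close> have been processed, when \<open>I\<close> is the set of selected
  positions and \<open>w\<close> gives the weights of the earlier positions at their turns.
\<close>

locale weighting =
  fixes adj :: "nat \<Rightarrow> nat \<Rightarrow> bool" and M k W0 :: nat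
  assumes k2: "2 \<le> k" and W0_le: "k * W0 \<le> M" and M_pos: "0 < M" and W0_pos: "0 < W0"
begin

primrec acc :: "nat set \<Rightarrow> (nat \<Rightarrow> nat) \<Rightarrow> nat \<Rightarrow> nat \<Rightarrow> nat" where
  "acc I w i 0 = W0"
| "acc I w i (Suc j) =
     (if adj i j then
        (if j \<in> I then 0
         else let W = acc I w i j * M div (M - w j) in if M < k * W then 0 else W)
      else acc I w i j)"

text \<open>The weight of a position depends on the weights of all earlier positions at their turns.
  Building the table makes this course-of-values recursion primitive; \<open>wt_rec\<close> recovers
  the intended equation.\<close>

primrec wts :: "nat set \<Rightarrow> nat \<Rightarrow> nat \<Rightarrow> nat" where
  "wts I 0 = (\<lambda>_. 0)"
| "wts I (Suc i) = (wts I i)(i := acc I (wts I i) i i)"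

definition wt :: "nat set \<Rightarrow> nat \<Rightarrow> nat" where
  "wt I i = wts I (Suc i) i"

definition prb :: "nat set \<Rightarrow> nat \<Rightarrow> real" where
  "prb I i = real (wt I i) / real M"

text \<open>The expectation of \<open>f\<close> over the set selected in the first \<open>t\<close>
  steps, integrating out the last decision first. Being a finite recursion, it turns martingale
  arguments into inductions on \<open>t\<close>.\<close>

primrec expect :: "nat \<Rightarrow> (nat set \<Rightarrow> real) \<Rightarrow> real" where
  "expect 0 f = f {}"
| "expect (Suc t) f = expect t (\<lambda>I. (1 - prb I t) * f I + prb I t * f (insert t I))"

text \<open>The outcomes of positive probability, since no weight reaches \<open>M\<close>.
  Comparisons under \<open>expect\<close> need to hold only there.\<close>

definition reachable :: "nat \<Rightarrow> nat set \<Rightarrow> bool" where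
  "reachable t I \<longleftrightarrow> I \<subseteq> {..<t} \<and> (\<forall>i\<in>I. 0 < wt I i)"

definition left :: "nat \<Rightarrow> nat set" where
  "left i = {j. j < i \<and> adj i j}"

text \<open>\<open>W0 * fac (left i) i I\<close> is the weight of \<open>i\<close> without cap and rounding.\<close>

definition fac :: "nat set \<Rightarrow> nat \<Rightarrow> nat set \<Rightarrow> real" where
  "fac S t I = (\<Prod>j\<in>S \<inter> {..<t}. if j \<in> I then 0 else 1 / (1 - prb I j))"

lemma acc_cong:
  "(\<And>j. j < t \<Longrightarrow> w j = w' j) \<Longrightarrow> (\<And>j. j < t \<Longrightarrow> j \<in> I \<longleftrightarrow> j \<in> I') \<Longrightarrow> acc I w i t = acc I' w' i t"
  by (induction t) (simp_all add: Let_def)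

lemma wts_eq_wt: "i < m \<Longrightarrow> wts I m i = wt I i"
  by (induction m) (auto simp: wt_def less_Suc_eq)

lemma wt_rec: "wt I i = acc I (wt I) i i"
  unfolding wt_def[of I i] by (auto intro!: acc_cong simp: wts_eq_wt)

lemma wt_cong: "(\<And>j. j < i \<Longrightarrow> j \<in> I \<longleftrightarrow> j \<in> I') \<Longrightarrow> wt I i = wt I' i"
proof (induction i rule: less_induct)
  case (less i)
  then show ?case
    unfolding wt_rec[of I i] wt_rec[of I' i] by (intro acc_cong) auto
qed

lemma prb_cong: "(\<And>j. j < i \<Longrightarrow> j \<in> I \<longleftrightarrow> j \<in> I') \<Longrightarrow> prb I i = prb I' i"
  unfolding prb_def using wt_cong[of i I I'] by simp

lemma acc_le: "k * acc I w i j \<le> M"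
  by (induction j) (auto simp: Let_def W0_le)

lemma wt_le: "k * wt I i \<le> M"
  unfolding wt_rec[of I i] by (rule acc_le)

lemma wt_less_M: "wt I i < M"
proof -
  have "2 * wt I i \<le> k * wt I i" using k2 by simp
  with wt_le[of I i] M_pos show ?thesis by linarith
qed

lemma prb_bounds: "0 \<le> prb I i" "prb I i \<le> 1 / k" "prb I i \<le> 1 / 2" "prb I i < 1"
proof -
  have "real k * real (wt I i) \<le> real M" using wt_le[of I i] by (metis of_nat_le_iff of_nat_mult)
  then show "prb I i \<le> 1 / k" using M_pos k2 by (simp add: prb_def field_simps)
  also have "1 / k \<le> (1::real) / 2" using k2 by (simp add: field_simps)
  finally show "prb I i \<le> 1 / 2" .
  then show "prb I i < 1" by simp
qed (simp add: prb_def)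

lemma fac_Suc:
  "fac S (Suc t) I =
     (if t \<in> S then (if t \<in> I then 0 else 1 / (1 - prb I t)) * fac S t I else fac S t I)"
proof -
  have "S \<inter> {..<Suc t} = (if t \<in> S then insert t (S \<inter> {..<t}) else S \<inter> {..<t})"
    by (auto simp: less_Suc_eq)
  then show ?thesis by (simp add: fac_def)
qed

lemma fac_0 [simp]: "fac S 0 I = 1"
  by (simp add: fac_def)

lemma fac_insert: "fac S t (insert t I) = fac S t I"
proof -
  have "prb (insert t I) j = prb I j" if "j < t" for j
    using that by (intro prb_cong) auto
  then show ?thesis unfolding fac_def by (intro prod.cong) auto
qed

lemma fac_nonneg: "0 \<le> fac S t I"
  unfolding fac_def using prb_bounds by (intro prod_nonneg) (auto simp: less_imp_le)

lemma inv_prb_ge: "1 \<le> 1 / (1 - prb I j)"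
  using prb_bounds[of I j] by (simp add: field_simps)

lemma fac_mono:
  assumes "S \<inter> {..<t} \<inter> I = {}" "S' \<inter> {..<t'} \<subseteq> S \<inter> {..<t}"
  shows "fac S' t' I \<le> fac S t I"
proof -
  have "fac S t I = (\<Prod>j\<in>S \<inter> {..<t}. 1 / (1 - prb I j))"
    unfolding fac_def using assms by (intro prod.cong) auto
  moreover have "fac S' t' I = (\<Prod>j\<in>S' \<inter> {..<t'}. 1 / (1 - prb I j))"
    unfolding fac_def using assms by (intro prod.cong) auto
  moreover have "(\<Prod>j\<in>S' \<inter> {..<t'}. 1 / (1 - prb I j)) \<le> (\<Prod>j\<in>S \<inter> {..<t}. 1 / (1 - prb I j))"
    using assms(2) inv_prb_ge
    by (intro prod_mono2) (auto intro: order_trans[OF _ inv_prb_ge] simp: prb_bounds less_imp_le)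
  ultimately show ?thesis by simp
qed

lemma fac_ge_1: "S \<inter> {..<t} \<inter> I = {} \<Longrightarrow> 1 \<le> fac S t I"
  using fac_mono[of S t I "{}" 0] by simp

lemma fac_eq_0: "S \<inter> {..<t} \<inter> I \<noteq> {} \<Longrightarrow> fac S t I = 0"
  unfolding fac_def by (intro prod_zero) auto

lemma left_less: "j \<in> left i \<Longrightarrow> j < i"
  by (simp add: left_def)

lemma finite_left [simp]: "finite (left i)"
  by (rule finite_subset[of _ "{..<i}"]) (auto simp: left_def)

lemma real_div_M: "real (W * M) / real (M - wt I j) = real W * (1 / (1 - prb I j))"
  using wt_less_M[of I j] M_pos by (simp add: prb_def of_nat_diff less_imp_le field_simps)

lemma acc_upper: "j \<le> i \<Longrightarrow> real (acc I (wt I) i j) \<le> real W0 * fac (left i) j I"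
proof (induction j)
  case (Suc j)
  have "j \<in> left i \<longleftrightarrow> adj i j" using Suc.prems by (simp add: left_def)
  moreover have "real (acc I (wt I) i j * M div (M - wt I j))
      \<le> real W0 * fac (left i) j I * (1 / (1 - prb I j))"
  proof -
    have "real (acc I (wt I) i j * M div (M - wt I j)) \<le> real (acc I (wt I) i j * M) / real (M - wt I j)"
      by (rule of_nat_div_le_of_nat)
    also have "\<dots> = real (acc I (wt I) i j) * (1 / (1 - prb I j))" by (rule real_div_M)
    also have "\<dots> \<le> real W0 * fac (left i) j I * (1 / (1 - prb I j))"
      using Suc prb_bounds[of I j] by (intro mult_right_mono) auto
    finally show ?thesis .
  qed
  ultimately show ?case
    using Suc fac_nonneg[of "left i" j I] prb_bounds[of I j]
    by (auto simp: fac_Suc Let_def mult_ac)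
qed simp

lemma wt_upper: "real (wt I i) \<le> real W0 * fac (left i) i I"
  using acc_upper[of i i I] unfolding wt_rec[of I i] by simp

lemma acc_selected: "j \<in> I \<Longrightarrow> adj i j \<Longrightarrow> j < t \<Longrightarrow> acc I w i t = 0"
  by (induction t) (auto simp: less_Suc_eq)

lemma wt_selected: "j \<in> I \<Longrightarrow> j \<in> left i \<Longrightarrow> wt I i = 0"
  unfolding wt_rec[of I i] by (auto simp: left_def intro: acc_selected)

text \<open>
  Each rounding step loses at most \<open>1\<close>, hence at most \<open>1\<close> after division by the running product
  \<open>fac\<close>, which is at least \<open>1\<close>. So rounding amounts to lowering \<open>W0\<close> by the degree.
\<close>

lemma acc_lower:
  assumes "left i \<inter> I = {}"
    and alive: "\<And>j. j \<in> left i \<Longrightarrow> k * (acc I (wt I) i j * M div (M - wt I j)) \<le> M"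
  shows "j \<le> i \<Longrightarrow>
    (real W0 - real (card (left i \<inter> {..<j}))) * fac (left i) j I \<le> real (acc I (wt I) i j)"
proof (induction j)
  case (Suc j)
  show ?case
  proof (cases "adj i j")
    case False
    then have "left i \<inter> {..<Suc j} = left i \<inter> {..<j}" by (auto simp: left_def less_Suc_eq)
    with False Suc show ?thesis by (simp add: fac_Suc left_def)
  next
    case True
    with Suc.prems have j: "j \<in> left i" by (simp add: left_def)
    with assms(1) have jI: "j \<notin> I" by auto
    have card: "card (left i \<inter> {..<Suc j}) = Suc (card (left i \<inter> {..<j}))"
    proof -
      have "left i \<inter> {..<Suc j} = insert j (left i \<inter> {..<j})" using j by (auto simp: less_Suc_eq)
      then show ?thesis by simp
    qed
    define W where "W = acc I (wt I) i j * M div (M - wt I j)"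
    have f: "fac (left i) (Suc j) I = fac (left i) j I * (1 / (1 - prb I j))"
      using j jI by (simp add: fac_Suc)
    have acc: "acc I (wt I) i (Suc j) = W"
      using True jI alive[OF j] by (simp add: W_def Let_def not_less)
    have "(real W0 - real (card (left i \<inter> {..<Suc j}))) * fac (left i) (Suc j) I =
        (real W0 - real (card (left i \<inter> {..<j}))) * fac (left i) j I * (1 / (1 - prb I j))
          - fac (left i) (Suc j) I"
      unfolding card f of_nat_Suc by (simp only: algebra_simps)
    also have "\<dots> \<le> real (acc I (wt I) i j) * (1 / (1 - prb I j)) - 1"
      using Suc prb_bounds[of I j] fac_ge_1[of "left i" "Suc j" I] assms(1)
      by (intro diff_mono mult_right_mono) auto
    also have "\<dots> = real (acc I (wt I) i j * M) / real (M - wt I j) - 1"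
      by (simp only: real_div_M)
    also have "\<dots> \<le> real W"
      unfolding W_def by (rule real_div_nat_ge)
    finally show ?thesis using acc by simp
  qed
qed simp

lemma wt_lower_alive:
  assumes "left i \<inter> I = {}" "card (left i) \<le> d"
    and "\<And>j. j \<in> left i \<Longrightarrow> k * (acc I (wt I) i j * M div (M - wt I j)) \<le> M"
  shows "(real W0 - real d) * fac (left i) i I \<le> real (wt I i)"
proof -
  have "(real W0 - real d) * fac (left i) i I \<le>
      (real W0 - real (card (left i \<inter> {..<i}))) * fac (left i) i I"
    using assms(2) card_mono[of "left i" "left i \<inter> {..<i}"] fac_nonneg
    by (intro mult_right_mono) auto
  also have "\<dots> \<le> real (wt I i)"
    using acc_lower[OF assms(1,3), of i] unfolding wt_rec[of I i] by simp
  finally show ?thesis .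
qed

text \<open>While no neighbour is selected the uncapped weight only grows. So if its final value
  respects the cap, all intermediate values do, and the cap never acts. If a neighbour is selected,
  \<open>fac\<close> is 0.\<close>

lemma wt_lower:
  assumes "real k * (real W0 * fac (left i) i I) \<le> real M" "card (left i) \<le> d"
  shows "(real W0 - real d) * fac (left i) i I \<le> real (wt I i)"
proof (cases "left i \<inter> I = {}")
  case True
  show ?thesis
  proof (rule wt_lower_alive[OF True assms(2)])
    fix j assume j: "j \<in> left i"
    with True have jI: "j \<notin> I" by auto
    define W where "W = acc I (wt I) i j * M div (M - wt I j)"
    have "real W \<le> real (acc I (wt I) i j * M) / real (M - wt I j)"
      unfolding W_def by (rule of_nat_div_le_of_nat)
    also have "\<dots> = real (acc I (wt I) i j) * (1 / (1 - prb I j))" by (rule real_div_M)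
    also have "\<dots> \<le> real W0 * fac (left i) j I * (1 / (1 - prb I j))"
      using acc_upper[of j i I] left_less[OF j] prb_bounds[of I j] by (intro mult_right_mono) auto
    also have "\<dots> = real W0 * fac (left i) (Suc j) I" using j jI by (simp add: fac_Suc)
    also have "\<dots> \<le> real W0 * fac (left i) i I"
      using True left_less[OF j] by (intro mult_left_mono fac_mono) auto
    finally have "real k * real W \<le> real k * (real W0 * fac (left i) i I)"
      by (intro mult_left_mono) auto
    with assms(1) have "real (k * W) \<le> real M" by simp
    then show "k * W \<le> M" by (simp only: of_nat_le_iff)
  qed
next
  case False
  then have "left i \<inter> {..<i} \<inter> I \<noteq> {}" by (auto simp: left_def)
  then show ?thesis by (simp add: fac_eq_0)
qed

lemma acc_0_mono: "acc I w i s = 0 \<Longrightarrow> s \<le> t \<Longrightarrow> acc I w i t = 0"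
  by (induction t) (auto simp: le_Suc_eq Let_def simp del: acc.simps(1))

text \<open>A positive weight is a certificate after the fact: no earlier neighbour was selected and
  the cap never acted, because 0 is absorbing. No bound on \<open>fac\<close> is assumed here, so
  that this can serve as an upper bound on \<open>fac\<close> in \<open>prb_le_Y\<close>.\<close>

lemma wt_pos_lower:
  assumes "0 < wt I i" "card (left i) \<le> d"
  shows "(real W0 - real d) * fac (left i) i I \<le> real (wt I i)"
proof (rule wt_lower_alive[OF _ assms(2)])
  show "left i \<inter> I = {}" using wt_selected[of _ I i] assms(1) by auto
  show "k * (acc I (wt I) i j * M div (M - wt I j)) \<le> M" if j: "j \<in> left i" for j
  proof (rule ccontr)
    assume "\<not> ?thesis"
    then have "M < k * (acc I (wt I) i j * M div (M - wt I j))" by (simp only: not_le)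
    moreover have "adj i j" using j by (simp add: left_def)
    ultimately have "acc I (wt I) i (Suc j) = 0" by (simp only: acc.simps Let_def if_True if_cancel)
    then have "acc I (wt I) i i = 0" by (rule acc_0_mono) (simp add: left_less[OF j] Suc_leI)
    then have "wt I i = 0" by (rule wt_rec[THEN trans])
    with assms(1) show False by (simp only: less_irrefl)
  qed
qed

section \<open>Expectations and martingales of the process\<close>

lemma expect_const [simp]: "expect t (\<lambda>_. c) = c"
  by (induction t) (simp_all add: algebra_simps)

lemma expect_add: "expect t (\<lambda>I. f I + g I) = expect t f + expect t g"
proof (induction t arbitrary: f g)
  case (Suc t)
  show ?case
    unfolding expect.simps Suc.IH[symmetric] by (simp add: algebra_simps)
qed simp

lemma expect_cmult: "expect t (\<lambda>I. c * f I) = c * expect t f"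
proof (induction t arbitrary: f)
  case (Suc t)
  show ?case
    unfolding expect.simps Suc.IH[symmetric] by (simp add: algebra_simps)
qed simp

lemma expect_diff: "expect t (\<lambda>I. f I - g I) = expect t f - expect t g"
  using expect_add[of t f "\<lambda>I. (-1) * g I"] expect_cmult[of t "-1" g] by simp

lemma expect_sum: "finite A \<Longrightarrow> expect t (\<lambda>I. \<Sum>a\<in>A. f a I) = (\<Sum>a\<in>A. expect t (f a))"
  by (induction A rule: finite_induct) (simp_all add: expect_add)

lemma reachable_Suc:
  assumes "reachable t I"
  shows "reachable (Suc t) I" "0 < wt I t \<Longrightarrow> reachable (Suc t) (insert t I)"
proof -
  show "reachable (Suc t) I" using assms by (auto simp: reachable_def)
  assume "0 < wt I t"
  moreover have "wt (insert t I) i = wt I i" if "i \<le> t" for i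
    using that by (intro wt_cong) auto
  ultimately show "reachable (Suc t) (insert t I)" using assms by (auto simp: reachable_def)
qed

lemma expect_mono:
  "(\<And>I. reachable t I \<Longrightarrow> f I \<le> g I) \<Longrightarrow> expect t f \<le> expect t g"
proof (induction t arbitrary: f g)
  case 0
  then show ?case by (simp add: reachable_def)
next
  case (Suc t)
  show ?case
    unfolding expect.simps
  proof (rule Suc.IH)
    fix I assume I: "reachable t I"
    have "(1 - prb I t) * f I \<le> (1 - prb I t) * g I"
      using Suc.prems[OF reachable_Suc(1)[OF I]] prb_bounds[of I t] by (intro mult_left_mono) auto
    moreover have "prb I t * f (insert t I) \<le> prb I t * g (insert t I)"
    proof (cases "0 < wt I t")
      case True
      then show ?thesis
        using Suc.prems[OF reachable_Suc(2)[OF I]] prb_bounds[of I t] by (intro mult_left_mono) auto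
    qed (simp add: prb_def)
    ultimately show "(1 - prb I t) * f I + prb I t * f (insert t I)
      \<le> (1 - prb I t) * g I + prb I t * g (insert t I)" by (rule add_mono)
  qed
qed

lemma expect_cong:
  "(\<And>I. reachable t I \<Longrightarrow> f I = g I) \<Longrightarrow> expect t f = expect t g"
  by (intro antisym expect_mono) auto

lemma expect_supermartingale:
  assumes "\<And>t I. t < T \<Longrightarrow> reachable t I \<Longrightarrow>
    (1 - prb I t) * f (Suc t) I + prb I t * f (Suc t) (insert t I) \<le> f t I"
  shows "expect T (f T) \<le> f 0 {}"
proof -
  have "t \<le> T \<Longrightarrow> expect t (f t) \<le> f 0 {}" for t
  proof (induction t)
    case (Suc t)
    have "expect (Suc t) (f (Suc t)) \<le> expect t (f t)"
      unfolding expect.simps using Suc.prems assms by (intro expect_mono) auto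
    with Suc show ?case by simp
  qed simp
  then show ?thesis by simp
qed

text \<open>Selection kills a factor and survival divides it by the probability of survival, so
  \<open>fac\<close> is a martingale. Having mean 1, \<open>fac (left v) v\<close> is a probability
  density: this is the tilting.\<close>

lemma expect_fac: "expect t (fac S t) = 1"
proof (induction t)
  case (Suc t)
  have "expect (Suc t) (fac S (Suc t)) = expect t (fac S t)"
    unfolding expect.simps
  proof (rule expect_cong)
    fix I assume "reachable t I"
    then have "t \<notin> I" by (auto simp: reachable_def)
    then show "(1 - prb I t) * fac S (Suc t) I + prb I t * fac S (Suc t) (insert t I) = fac S t I"
      using prb_bounds[of I t] by (auto simp: fac_Suc fac_insert field_simps)
  qed
  with Suc show ?case by simp
qed simp

lemma reachable_independent:
  assumes "reachable t I" "i \<in> I" "j \<in> I" "j \<in> left i"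
  shows False
  using assms wt_selected[of j I i] by (auto simp: reachable_def)

lemma expect_member: "v < t \<Longrightarrow> expect t (\<lambda>I. of_bool (v \<in> I)) = expect v (\<lambda>I. prb I v)"
proof (induction t)
  case (Suc t)
  show ?case
  proof (cases "v = t")
    case True
    show ?thesis
      unfolding expect.simps True by (intro expect_cong) (auto simp: reachable_def)
  next
    case False
    then have "expect (Suc t) (\<lambda>I. of_bool (v \<in> I)) = expect t (\<lambda>I. of_bool (v \<in> I))"
      unfolding expect.simps by (intro expect_cong) (auto simp: algebra_simps)
    with False Suc show ?thesis by simp
  qed
qed simp

end

section \<open>Selection probabilities in C4-free graphs of bounded left degree\<close>

locale greedy = weighting +
  fixes n d :: nat
  assumes adj_sym: "adj i j \<longleftrightarrow> adj j i"
    and card_left: "i < n \<Longrightarrow> card (left i) \<le> d"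
    and no_C4: "distinct [w, x, y, z] \<Longrightarrow> {w, x, y, z} \<subseteq> {..<n} \<Longrightarrow>
       adj w x \<Longrightarrow> adj x y \<Longrightarrow> adj y z \<Longrightarrow> adj z w \<Longrightarrow> False"
    and W0_ge: "2 * d \<le> W0"
begin

text \<open>
  \<open>G v u\<close> follows the weight of an earlier neighbour \<open>u\<close> of \<open>v\<close>, leaving out the common neighbours of
  \<open>u\<close> and \<open>v\<close>: under the measure tilted by the weight of \<open>v\<close> these are never selected, so that their
  factors would drift upwards. There is at most one, so this changes the weight by a factor at most
  \<open>1 / (1 - 1 / k)\<close>. The cap in \<open>Y\<close> is \<open>2 / k\<close> rather than \<open>1 / k\<close> because \<open>G\<close> ignores rounding.
\<close>

definition G :: "nat \<Rightarrow> nat \<Rightarrow> nat \<Rightarrow> nat set \<Rightarrow> real" where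
  "G v u t I = real W0 / real M * fac (left u - left v) t I"

definition Y :: "nat \<Rightarrow> nat \<Rightarrow> nat \<Rightarrow> nat set \<Rightarrow> real" where
  "Y v u t I = (if G v u t I \<le> 2 / k then G v u t I else 0)"

definition pot :: "real \<Rightarrow> nat \<Rightarrow> nat \<Rightarrow> nat set \<Rightarrow> real" where
  "pot c v t I = (\<Prod>u\<in>left v. 1 + c * Y v u t I)"

text \<open>Here and in \<open>left_common'\<close> the absence of 4-cycles enters: here it keeps
  one step from touching two factors of \<open>pot\<close>, there it bounds what \<open>G\<close>
  leaves out.\<close>

lemma left_common:
  assumes "v < n" "u \<in> left v" "u' \<in> left v" "t \<in> left u" "t \<in> left u'"
  shows "u = u'"
proof (rule ccontr)
  assume "u \<noteq> u'"
  with assms show False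
    using no_C4[of t u v u'] adj_sym by (auto simp: left_def)
qed

lemma left_common':
  assumes "v < n" "u \<in> left v" "j \<in> left u \<inter> left v" "j' \<in> left u \<inter> left v"
  shows "j = j'"
proof (rule ccontr)
  assume "j \<noteq> j'"
  with assms show False
    using no_C4[of j u j' v] adj_sym by (auto simp: left_def)
qed

lemma G_nonneg: "0 \<le> G v u t I"
  by (simp add: G_def fac_nonneg)

lemma Y_nonneg: "0 \<le> Y v u t I"
  by (simp add: Y_def G_nonneg)

lemma Y_le: "Y v u t I \<le> 2 / k"
  by (simp add: Y_def)

lemma pot_nonneg: "0 \<le> c \<Longrightarrow> 0 \<le> pot c v t I"
  unfolding pot_def by (intro prod_nonneg) (simp add: Y_nonneg)

lemma Y_Suc_same:
  assumes "t \<notin> left u - left v"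
  shows "Y v u (Suc t) I = Y v u t I" "Y v u (Suc t) (insert t I) = Y v u t I"
proof -
  have "fac (left u - left v) (Suc t) J = fac (left u - left v) t J" for J
    by (simp only: fac_Suc assms if_False)
  then show "Y v u (Suc t) I = Y v u t I" "Y v u (Suc t) (insert t I) = Y v u t I"
    by (simp_all only: Y_def G_def fac_insert)
qed

lemma Y_Suc:
  assumes "t \<in> left u - left v" "t \<notin> I"
  shows "(1 - prb I t) * Y v u (Suc t) I \<le> Y v u t I" "Y v u (Suc t) (insert t I) = 0"
proof -
  have G: "G v u (Suc t) I = 1 / (1 - prb I t) * G v u t I"
    using assms by (simp add: G_def fac_Suc)
  \<comment> \<open>\<open>G\<close> does not fall while \<open>t\<close> stays unselected, so a
    value cut off by the cap remains cut off. Otherwise \<open>Y\<close> could jump up from 0 and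
    would not be a supermartingale.\<close>
  have "1 * G v u t I \<le> G v u (Suc t) I"
    unfolding G using inv_prb_ge G_nonneg by (intro mult_right_mono) auto
  then show "(1 - prb I t) * Y v u (Suc t) I \<le> Y v u t I"
    using G prb_bounds[of I t] G_nonneg[of v u t I] by (auto simp: Y_def)
  show "Y v u (Suc t) (insert t I) = 0"
    using assms by (simp add: Y_def G_def fac_Suc)
qed

lemma pot_step:
  assumes v: "v < n" "t < v" and t: "t \<notin> I" "t \<notin> left v" and c: "0 \<le> c"
  shows "(1 - prb I t) * pot c v (Suc t) I + prb I t * pot c v (Suc t) (insert t I) \<le> pot c v t I"
proof (cases "\<exists>u\<in>left v. t \<in> left u")
  case False
  then have "Y v u (Suc t) I = Y v u t I" "Y v u (Suc t) (insert t I) = Y v u t I"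
    if "u \<in> left v" for u
    using that by (intro Y_Suc_same; auto)+
  then have "pot c v (Suc t) I = pot c v t I" "pot c v (Suc t) (insert t I) = pot c v t I"
    unfolding pot_def by auto
  then show ?thesis by (simp add: algebra_simps)
next
  case True
  then obtain u where u: "u \<in> left v" "t \<in> left u" by blast
  define R where "R = (\<Prod>w\<in>left v - {u}. 1 + c * Y v w t I)"
  have R: "0 \<le> R" unfolding R_def using c by (intro prod_nonneg) (simp add: Y_nonneg)
  have other: "t \<notin> left w - left v" if "w \<in> left v - {u}" for w
    using left_common[OF v(1) u(1), of w t] u that by auto
  have split: "pot c v s J = (1 + c * Y v u s J) * (\<Prod>w\<in>left v - {u}. 1 + c * Y v w s J)" for s J
    unfolding pot_def using u by (intro prod.remove) auto
  have pot_t: "pot c v t I = (1 + c * Y v u t I) * R" by (simp add: split R_def)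
  have "pot c v (Suc t) I = (1 + c * Y v u (Suc t) I) * R"
    unfolding split R_def using other Y_Suc_same(1) by (intro arg_cong2[of _ _ _ _ "(*)"] prod.cong) auto
  moreover have "pot c v (Suc t) (insert t I) = (1 + c * Y v u (Suc t) (insert t I)) * R"
    unfolding split R_def using other Y_Suc_same(2) by (intro arg_cong2[of _ _ _ _ "(*)"] prod.cong) auto
  moreover have "Y v u (Suc t) (insert t I) = 0" "(1 - prb I t) * Y v u (Suc t) I \<le> Y v u t I"
    using u t by (auto intro!: Y_Suc)
  ultimately have "(1 - prb I t) * pot c v (Suc t) I + prb I t * pot c v (Suc t) (insert t I)
      = (1 + c * ((1 - prb I t) * Y v u (Suc t) I)) * R"
    by (simp add: algebra_simps)
  also have "\<dots> \<le> (1 + c * Y v u t I) * R"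
    using R c \<open>_ \<le> Y v u t I\<close> by (intro mult_right_mono add_left_mono mult_left_mono) auto
  finally show ?thesis using pot_t by simp
qed

text \<open>At a step in \<open>left v\<close> only \<open>fac\<close> moves, because
  \<open>G\<close> leaves out \<open>left v\<close>; at any other step only \<open>pot\<close>
  moves. So the two never interact and their product is a supermartingale. The bound is its initial
  value, a product of at most \<open>d\<close> factors \<open>1 + c * W0 / M\<close>.\<close>

lemma expect_fac_pot:
  assumes v: "v < n" and c: "0 \<le> c"
  shows "expect v (\<lambda>I. fac (left v) v I * pot c v v I) \<le> exp (c * real d * (real W0 / real M))"
proof -
  have "expect v (\<lambda>I. fac (left v) v I * pot c v v I) \<le> fac (left v) 0 {} * pot c v 0 {}"
  proof (rule expect_supermartingale)
    fix t I assume t: "t < v" "reachable t I"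
    then have tI: "t \<notin> I" by (auto simp: reachable_def)
    let ?x = "prb I t"
    show "(1 - ?x) * (fac (left v) (Suc t) I * pot c v (Suc t) I) +
       ?x * (fac (left v) (Suc t) (insert t I) * pot c v (Suc t) (insert t I))
       \<le> fac (left v) t I * pot c v t I"
    proof (cases "t \<in> left v")
      case True
      then have "pot c v (Suc t) I = pot c v t I"
        by (simp add: pot_def Y_Suc_same)
      with True tI prb_bounds[of I t] show ?thesis by (simp add: fac_Suc)
    next
      case False
      then have "(1 - ?x) * (fac (left v) (Suc t) I * pot c v (Suc t) I) +
          ?x * (fac (left v) (Suc t) (insert t I) * pot c v (Suc t) (insert t I)) =
          fac (left v) t I *
            ((1 - ?x) * pot c v (Suc t) I + ?x * pot c v (Suc t) (insert t I))"
        by (simp add: fac_Suc fac_insert algebra_simps)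
      also have "\<dots> \<le> fac (left v) t I * pot c v t I"
        using pot_step[OF v t(1) tI False c] by (intro mult_left_mono fac_nonneg)
      finally show ?thesis .
    qed
  qed
  also have "\<dots> \<le> (\<Prod>u\<in>left v. exp (c * (real W0 / real M)))"
    unfolding pot_def fac_0 mult_1
  proof (intro prod_mono conjI)
    fix u assume "u \<in> left v"
    have "Y v u 0 {} \<le> real W0 / real M" by (simp add: Y_def G_def)
    then have "1 + c * Y v u 0 {} \<le> 1 + c * (real W0 / real M)"
      using c by (intro add_left_mono mult_left_mono)
    also have "\<dots> \<le> exp (c * (real W0 / real M))" by (rule exp_ge_add_one_self)
    finally show "1 + c * Y v u 0 {} \<le> exp (c * (real W0 / real M))" .
  qed (simp add: c Y_nonneg)
  also have "\<dots> = exp (real (card (left v)) * (c * (real W0 / real M)))"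
    by (simp only: prod_constant exp_of_nat_mult)
  also have "\<dots> \<le> exp (real d * (c * (real W0 / real M)))"
    using card_left[OF v] c by (intro iffD2[OF exp_le_cancel_iff] mult_right_mono) auto
  finally show ?thesis by (simp add: mult_ac)
qed

text \<open>The true weight of \<open>u\<close> differs from \<open>G\<close> by the factor of at
  most one common neighbour, which \<open>1 - 1 / k\<close> absorbs. If the weight is positive, the
  cap has not acted on \<open>u\<close>; then \<open>G\<close> is at most \<open>2 / k\<close>, and
  \<open>Y\<close> has not been cut off either.\<close>

lemma prb_le_Y:
  assumes v: "v < n" and u: "u \<in> left v"
  shows "(1 - 1 / k) * prb I u \<le> Y v u v I"
proof (cases "wt I u = 0")
  case True
  then show ?thesis by (simp add: prb_def Y_nonneg)
next
  case False
  have un: "u < n" using u v by (simp add: left_def)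
  have disj: "left u \<inter> I = {}" using wt_selected[of _ I u] False by auto
  \<comment> \<open>The earlier neighbours of \<open>u\<close> all precede \<open>u\<close>, so
    \<open>G v u\<close> has not changed since the turn of \<open>u\<close>.\<close>
  have GG: "G v u v I = real W0 / real M * fac (left u - left v) u I"
  proof -
    have "(left u - left v) \<inter> {..<v} = (left u - left v) \<inter> {..<u}"
      using u by (auto simp: left_def)
    then show ?thesis by (simp add: G_def fac_def)
  qed
  have k: "0 < 1 - 1 / real k" using k2 by simp
  have "(1 - 1 / k) * fac (left u) u I \<le> fac (left u - left v) u I"
  proof -
    have "left u \<inter> {..<u} = (left u - left v) \<inter> {..<u} \<union> left u \<inter> left v"
      by (auto simp: left_def)
    then have "fac (left u) u I = fac (left u - left v) u I *
        (\<Prod>j\<in>left u \<inter> left v. if j \<in> I then 0 else 1 / (1 - prb I j))"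
      unfolding fac_def by (simp only:) (rule prod.union_disjoint, auto)
    moreover have "(1 - 1 / k) * (\<Prod>j\<in>left u \<inter> left v. if j \<in> I then 0 else 1 / (1 - prb I j)) \<le> 1"
    proof (cases "left u \<inter> left v = {}")
      case True
      then show ?thesis by simp
    next
      case False
      then obtain j where "j \<in> left u \<inter> left v" by blast
      then have eq: "left u \<inter> left v = {j}" using left_common'[OF v u, of j] by blast
      with disj have "j \<notin> I" by auto
      with prb_bounds(2)[of I j] prb_bounds(4)[of I j] show ?thesis
        unfolding eq by (simp add: field_simps)
    qed
    ultimately show ?thesis
      using mult_left_mono[OF _ fac_nonneg[of "left u - left v" u I]] by (fastforce simp: mult_ac)
  qed
  then have "(1 - 1 / k) * (real W0 / real M * fac (left u) u I) \<le> G v u v I"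
    unfolding GG using M_pos mult_left_mono[of _ _ "real W0 / real M"] by (fastforce simp: mult_ac)
  moreover have "prb I u \<le> real W0 / real M * fac (left u) u I"
    using wt_upper[of I u] M_pos by (simp add: prb_def field_simps)
  ultimately have "(1 - 1 / k) * prb I u \<le> G v u v I"
    using k by (meson less_imp_le mult_left_mono order_trans)
  moreover have "G v u v I \<le> 2 / k"
  proof -
    \<comment> \<open>By \<open>W0_ge\<close> rounding costs at most half of the initial weight, so
      a rounded weight of at most \<open>M / k\<close> still forces \<open>G\<close> to be at most
      \<open>2 / k\<close>.\<close>
    have "(real W0 / 2) * fac (left u - left v) u I \<le> (real W0 - real d) * fac (left u) u I"
      using disj W0_ge by (intro mult_mono fac_mono) (auto simp: fac_nonneg)
    also have "\<dots> \<le> real (wt I u)"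
      using False card_left[OF un] by (intro wt_pos_lower) auto
    also have "\<dots> = prb I u * real M" using M_pos by (simp add: prb_def)
    also have "\<dots> \<le> 1 / k * real M"
      using prb_bounds(2)[of I u] by (intro mult_right_mono) auto
    finally show ?thesis using M_pos by (simp add: GG field_simps)
  qed
  ultimately show ?thesis by (simp add: Y_def)
qed

text \<open>Markov's inequality in the tilted measure, with \<Lambda> as threshold for the sum of
  the neighbours' probabilities. The exponential bounds the tilted probability of exceeding
  \<Lambda>; below the threshold the hypothesis on \<Lambda> keeps the cap from acting.\<close>

theorem expect_prb_ge:
  fixes \<eta> \<Lambda> :: real
  assumes v: "v < n" and \<eta>: "0 < \<eta>" "\<eta> \<le> 1"
    and \<Lambda>: "real k * (real W0 * exp ((1 + 2 / k) * \<Lambda>)) \<le> real M"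
  shows "(real W0 - real d) / real M *
      (1 - exp (\<eta> * k / 2 * ((1 + \<eta>) * (real d * real W0 / real M) - (1 - 1 / k) * \<Lambda>)))
    \<le> expect v (\<lambda>I. prb I v)"
proof -
  \<comment> \<open>Since \<open>Y\<close> is at most \<open>2 / k\<close>, this is the largest
    \<open>l\<close> that guarantees \<open>l * Y \<le> \<eta>\<close>. In that range
    \<open>exp y \<le> 1 + (1 + \<eta>) * y\<close>, which makes \<open>c\<close> the coefficient
    that dominates the exponential.\<close>
  define l where "l = \<eta> * k / 2"
  define c where "c = l * (1 + \<eta>)"
  define e where "e = exp (l * ((1 - 1 / k) * \<Lambda>))"
  let ?F = "fac (left v) v" and ?P = "pot c v v"
  have l: "0 < l" using \<eta> k2 by (simp add: l_def)
  have c: "0 \<le> c" using l \<eta> by (simp add: c_def)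
  have e: "0 < e" by (simp add: e_def)
  have W: "0 \<le> real W0 - real d" using W0_ge by linarith
  \<comment> \<open>One pointwise inequality covers both cases, so that no expectation has to be
    split along an event: below the threshold the subtracted term is a mere loss, above it the term
    outweighs \<open>?F I\<close>.\<close>
  have key: "(real W0 - real d) / real M * (?F I - 1 / e * (?F I * ?P I)) \<le> prb I v" for I
  proof (cases "(\<Sum>u\<in>left v. prb I u) \<le> \<Lambda>")
    case True
    have "?F I \<le> (\<Prod>u\<in>left v. exp ((1 + 2 / k) * prb I u))"
    proof -
      have "(if u \<in> I then 0 else 1 / (1 - prb I u)) \<le> exp ((1 + 2 / k) * prb I u)" for u
      proof -
        define x where "x = prb I u"
        have x: "0 \<le> x" "x \<le> 1 / 2" "x \<le> 1 / k" using prb_bounds[of I u] by (simp_all add: x_def)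
        have "x * (2 * x) \<le> 1 * x" using x by (intro order_trans[OF mult_right_mono[of x "1/2"]]) auto
        \<comment> \<open>The right side exceeds 1 by \<open>x * x * (1 - 2 * x)\<close>.\<close>
        then have "1 \<le> (1 - x) * (1 + (1 + 2 * x) * x)"
          using x mult_nonneg_nonneg[of "x * x" "1 - 2 * x"] by (simp add: algebra_simps)
        then have "1 / (1 - x) \<le> 1 + (1 + 2 * x) * x"
          using x by (simp add: pos_divide_le_eq mult.commute)
        also have "\<dots> \<le> 1 + (1 + 2 / k) * x"
          using x by (intro add_left_mono mult_right_mono) auto
        also have "\<dots> \<le> exp ((1 + 2 / k) * x)" by (rule exp_ge_add_one_self)
        finally show ?thesis by (auto simp: x_def)
      qed
      then show ?thesis unfolding fac_def
        using prb_bounds by (subst Int_absorb2) (auto intro!: prod_mono simp: left_def less_imp_le)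
    qed
    also have "\<dots> = exp ((1 + 2 / k) * (\<Sum>u\<in>left v. prb I u))"
      by (simp add: exp_sum sum_distrib_left)
    also have "\<dots> \<le> exp ((1 + 2 / k) * \<Lambda>)"
      using True by (intro iffD2[OF exp_le_cancel_iff] mult_left_mono) auto
    finally have "real k * (real W0 * ?F I) \<le> real k * (real W0 * exp ((1 + 2 / k) * \<Lambda>))"
      by (intro mult_left_mono) auto
    with \<Lambda> have "(real W0 - real d) * ?F I \<le> real (wt I v)"
      using card_left[OF v] by (intro wt_lower) auto
    then have "(real W0 - real d) / real M * ?F I \<le> prb I v"
      by (simp add: prb_def divide_right_mono)
    moreover have "(real W0 - real d) / real M * (?F I - 1 / e * (?F I * ?P I)) \<le>
        (real W0 - real d) / real M * ?F I"
      using W e fac_nonneg pot_nonneg[OF c] by (intro mult_left_mono) auto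
    ultimately show ?thesis by linarith
  next
    case False
    have "e \<le> exp (l * (\<Sum>u\<in>left v. Y v u v I))"
    proof -
      have "(1 - 1 / k) * \<Lambda> \<le> (1 - 1 / k) * (\<Sum>u\<in>left v. prb I u)"
        using False k2 by (intro mult_left_mono) auto
      also have "\<dots> \<le> (\<Sum>u\<in>left v. Y v u v I)"
        unfolding sum_distrib_left using prb_le_Y[OF v] by (intro sum_mono)
      finally show ?thesis unfolding e_def using l by simp
    qed
    also have "\<dots> = (\<Prod>u\<in>left v. exp (l * Y v u v I))"
      by (simp add: exp_sum sum_distrib_left)
    also have "\<dots> \<le> ?P I"
      unfolding pot_def
    proof (intro prod_mono conjI)
      fix u
      define y where "y = l * Y v u v I"
      have "y \<le> l * (2 / k)" unfolding y_def using l Y_le by (intro mult_left_mono) auto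
      also have "\<dots> = \<eta>" using k2 by (simp add: l_def)
      finally have y: "0 \<le> y" "y \<le> \<eta>" using l Y_nonneg by (auto simp: y_def)
      have "exp y \<le> 1 + y + y\<^sup>2" using y \<eta> by (intro exp_bound) auto
      also have "\<dots> \<le> 1 + y + \<eta> * y"
        unfolding power2_eq_square using y by (intro add_left_mono mult_right_mono) auto
      also have "\<dots> = 1 + c * Y v u v I" by (simp add: y_def c_def algebra_simps)
      finally show "exp (l * Y v u v I) \<le> 1 + c * Y v u v I" by (simp add: y_def)
    qed simp
    finally have "1 \<le> ?P I / e" using e by simp
    then have "?F I * 1 \<le> ?F I * (?P I / e)" by (intro mult_left_mono fac_nonneg)
    then have "?F I - 1 / e * (?F I * ?P I) \<le> 0" by simp
    then have "(real W0 - real d) / real M * (?F I - 1 / e * (?F I * ?P I)) \<le> 0"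
      using W by (intro mult_nonneg_nonpos) auto
    with prb_bounds(1)[of I v] show ?thesis by linarith
  qed
  have "l * ((1 + \<eta>) * (real d * real W0 / real M) - (1 - 1 / k) * \<Lambda>) =
      c * real d * (real W0 / real M) - l * ((1 - 1 / k) * \<Lambda>)"
    by (simp add: c_def algebra_simps add_divide_distrib)
  then have "exp (l * ((1 + \<eta>) * (real d * real W0 / real M) - (1 - 1 / k) * \<Lambda>)) =
      1 / e * exp (c * real d * (real W0 / real M))"
    by (simp add: e_def exp_diff)
  then have "(real W0 - real d) / real M *
      (1 - exp (l * ((1 + \<eta>) * (real d * real W0 / real M) - (1 - 1 / k) * \<Lambda>))) \<le>
      (real W0 - real d) / real M * (1 - 1 / e * expect v (\<lambda>I. ?F I * ?P I))"
    using expect_fac_pot[OF v c] e W by (intro mult_left_mono diff_left_mono) (auto simp: divide_right_mono)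
  also have "\<dots> = expect v (\<lambda>I. (real W0 - real d) / real M * (?F I - 1 / e * (?F I * ?P I)))"
    by (simp only: expect_cmult expect_diff expect_fac)
  also have "\<dots> \<le> expect v (\<lambda>I. prb I v)" by (rule expect_mono) (rule key)
  finally show ?thesis by (simp add: l_def)
qed

end

section \<open>Coin flips and independent rounds\<close>

text \<open>The mean of \<open>F\<close> over all sequences of \<open>K\<close> digits below
  \<open>m\<close>, continued by 0: independent uniform digits without product measures.\<close>

primrec avg :: "nat \<Rightarrow> nat \<Rightarrow> ((nat \<Rightarrow> nat) \<Rightarrow> real) \<Rightarrow> real" where
  "avg m 0 F = F (\<lambda>_. 0)"
| "avg m (Suc K) F = avg m K (\<lambda>g. (\<Sum>x<m. F (g(K := x))) / real m)"

lemma avg_mono: "(\<And>g. F g \<le> H g) \<Longrightarrow> avg m K F \<le> avg m K H"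
proof (induction K arbitrary: F H)
  case (Suc K)
  show ?case
    unfolding avg.simps by (intro Suc.IH divide_right_mono sum_mono Suc.prems) simp
qed simp

lemma avg_cmult: "avg m K (\<lambda>g. c * F g) = c * avg m K F"
proof (induction K arbitrary: F)
  case (Suc K)
  show ?case
    unfolding avg.simps Suc.IH[symmetric] by (simp add: sum_distrib_left)
qed simp

lemma avg_sum: "finite A \<Longrightarrow> avg m K (\<lambda>g. \<Sum>a\<in>A. F a g) = (\<Sum>a\<in>A. avg m K (F a))"
proof (induction K arbitrary: F)
  case (Suc K)
  have "(\<Sum>x<m. \<Sum>a\<in>A. F a (g(K := x))) / real m = (\<Sum>a\<in>A. (\<Sum>x<m. F a (g(K := x))) / real m)" for g
    by (simp add: sum.swap[of _ A] sum_divide_distrib)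
  with Suc show ?case by simp
qed simp

text \<open>Horner evaluation of binary digits, \<open>h 0\<close> being the most significant;
  \<open>Draw\<close> reads the tape in this order.\<close>

primrec dec :: "nat \<Rightarrow> (nat \<Rightarrow> nat) \<Rightarrow> nat" where
  "dec 0 h = 0"
| "dec (Suc b) h = 2 * dec b h + h b"

lemma dec_cong: "(\<And>j. j < b \<Longrightarrow> h j = h' j) \<Longrightarrow> dec b h = dec b h'"
  by (induction b) auto

lemma sum_lessThan_double:
  fixes f :: "nat \<Rightarrow> real"
  shows "(\<Sum>x<2 * m. f x) = (\<Sum>x<m. f (2 * x) + f (2 * x + 1))"
  by (induction m) auto

lemma sum_lessThan_2: "(\<Sum>x<2. f x) = f 0 + (f 1 :: real)" for f :: "nat \<Rightarrow> real"
  by (simp add: numeral_2_eq_2)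

text \<open>Averaging over the last, least significant bit pairs the values at \<open>2 * x\<close>
  and \<open>2 * x + 1\<close>. The hypothesis says that the first argument of \<open>F\<close>
  matters only through the bits before the block.\<close>

lemma avg_dec_block:
  assumes "\<And>g k x y. K \<le> k \<Longrightarrow> F (g(k := x)) y = F g y"
  shows "avg 2 (K + b) (\<lambda>g. F g (dec b (\<lambda>j. g (K + j)))) = avg 2 K (\<lambda>g. (\<Sum>x<2 ^ b. F g x) / 2 ^ b)"
  using assms
proof (induction b arbitrary: F)
  case 0
  then show ?case by simp
next
  case (Suc b)
  define F' where "F' g x = (F g (2 * x) + F g (2 * x + 1)) / 2" for g x
  have "dec b (\<lambda>j. (g(K + b := x)) (K + j)) = dec b (\<lambda>j. g (K + j))" for g x
    by (intro dec_cong) auto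
  moreover have "F (g(K + b := x)) y = F g y" for g x y
    by (rule Suc.prems) simp
  ultimately have "avg 2 (K + Suc b) (\<lambda>g. F g (dec (Suc b) (\<lambda>j. g (K + j)))) =
      avg 2 (K + b) (\<lambda>g. F' g (dec b (\<lambda>j. g (K + j))))"
    unfolding add_Suc_right avg.simps sum_lessThan_2 dec.simps F'_def
    by (simp only: fun_upd_same of_nat_numeral add_0_right)
  also have "\<dots> = avg 2 K (\<lambda>g. (\<Sum>x<2 ^ b. F' g x) / 2 ^ b)"
    using Suc.prems by (intro Suc.IH) (simp add: F'_def)
  also have "\<dots> = avg 2 K (\<lambda>g. (\<Sum>x<2 ^ Suc b. F g x) / 2 ^ Suc b)"
    by (simp add: F'_def sum_lessThan_double flip: sum_divide_distrib)
  finally show ?case .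
qed

text \<open>Blocks of \<open>B\<close> fair bits decode to independent uniform numbers below
  \<open>2 ^ B\<close>; this is why \<open>M\<close> is a power of two. The default 0 beyond
  \<open>K\<close> agrees with the one in \<open>avg\<close>.\<close>

lemma avg_dec:
  "avg 2 (K * B) (\<lambda>g. F (\<lambda>k. if k < K then dec B (\<lambda>b. g (k * B + b)) else 0)) = avg (2 ^ B) K F"
proof (induction K arbitrary: F)
  case 0
  then show ?case by simp
next
  case (Suc K)
  let ?D = "\<lambda>g k. if k < K then dec B (\<lambda>b. g (k * B + b)) else 0"
  have insens: "?D (g(k := x)) = ?D g" if "K * B \<le> k" for g x k
  proof
    fix i
    have "i * B + b < k" if "i < K" "b < B" for b
    proof -
      have "i * B + b < Suc i * B" using that by simp
      also have "\<dots> \<le> K * B" using that by (intro mult_le_mono1) auto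
      finally show ?thesis using \<open>K * B \<le> k\<close> by simp
    qed
    then have "dec B (\<lambda>b. (g(k := x)) (i * B + b)) = dec B (\<lambda>b. g (i * B + b))" if "i < K"
      using that by (intro dec_cong) fastforce
    then show "?D (g(k := x)) i = ?D g i" by presburger
  qed
  have "(\<lambda>k. if k < Suc K then dec B (\<lambda>b. g (k * B + b)) else 0) =
      (?D g)(K := dec B (\<lambda>b. g (K * B + b)))" for g
    by (auto simp: less_Suc_eq)
  then have "avg 2 (Suc K * B) (\<lambda>g. F (\<lambda>k. if k < Suc K then dec B (\<lambda>b. g (k * B + b)) else 0)) =
      avg 2 (K * B + B) (\<lambda>g. F ((?D g)(K := dec B (\<lambda>b. g (K * B + b)))))"
    by (simp add: add.commute)
  also have "\<dots> = avg 2 (K * B) (\<lambda>g. (\<Sum>x<2 ^ B. F ((?D g)(K := x))) / 2 ^ B)"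
    by (rule avg_dec_block[where F = "\<lambda>g x. F ((?D g)(K := x))"]) (simp only: insens)
  also have "\<dots> = avg (2 ^ B) (Suc K) F"
    using Suc.IH[of "\<lambda>h. (\<Sum>x<2 ^ B. F (h(K := x))) / 2 ^ B"] by simp
  finally show ?case .
qed

primrec coins :: "nat \<Rightarrow> nat \<Rightarrow> (nat \<Rightarrow> nat) \<Rightarrow> (nat \<Rightarrow> nat) pmf" where
  "coins k 0 g = return_pmf g"
| "coins k (Suc m) g = bind_pmf (bernoulli_pmf (1 / 2)) (\<lambda>b. coins (Suc k) m (g(k := of_bool b)))"

text \<open>\<open>coins\<close> flips from the front, like the loop of the program, whereas
  \<open>avg\<close> peels off the last digit; this passes from one to the other.\<close>

lemma coins_append:
  "coins k (Suc m) g = bind_pmf (coins k m g)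
     (\<lambda>g'. map_pmf (\<lambda>b. g'(k + m := of_bool b)) (bernoulli_pmf (1 / 2)))"
proof (induction m arbitrary: k g)
  case 0
  show ?case by (simp only: coins.simps bind_return_pmf add_0_right map_pmf_def)
next
  case (Suc m)
  let ?B = "bernoulli_pmf (1 / 2)"
  have "coins k (Suc (Suc m)) g = bind_pmf ?B (\<lambda>b. bind_pmf (coins (Suc k) m (g(k := of_bool b)))
      (\<lambda>g'. map_pmf (\<lambda>b. g'(Suc k + m := of_bool b)) ?B))"
    unfolding coins.simps(2)[of k "Suc m"] Suc.IH ..
  also have "\<dots> = bind_pmf (coins k (Suc m) g) (\<lambda>g'. map_pmf (\<lambda>b. g'(k + Suc m := of_bool b)) ?B)"
    unfolding coins.simps(2) bind_assoc_pmf add_Suc add_Suc_right ..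
  finally show ?case .
qed

lemma finite_set_coins: "finite (set_pmf (coins k m g))"
  by (induction m arbitrary: k g) auto

lemma expectation_coins:
  "measure_pmf.expectation (coins 0 m (\<lambda>_. 0)) F = avg 2 m F"
proof (induction m arbitrary: F)
  case 0
  then show ?case by simp
next
  case (Suc m)
  let ?C = "coins 0 m (\<lambda>_. 0)"
  have "measure_pmf.expectation (coins 0 (Suc m) (\<lambda>_. 0)) F =
      (\<Sum>g\<in>set_pmf ?C. pmf ?C g *\<^sub>R
         measure_pmf.expectation (map_pmf (\<lambda>b. g(0 + m := of_bool b)) (bernoulli_pmf (1 / 2))) F)"
    unfolding coins_append by (intro pmf_expectation_bind) (auto simp: finite_set_coins)
  also have "\<dots> = (\<Sum>g\<in>set_pmf ?C. pmf ?C g *\<^sub>R ((\<Sum>x<2. F (g(m := x))) / 2))"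
    by (intro sum.cong refl arg_cong2[of _ _ _ _ scaleR])
       (simp add: numeral_2_eq_2 field_simps)
  also have "\<dots> = measure_pmf.expectation ?C (\<lambda>g. (\<Sum>x<2. F (g(m := x))) / 2)"
    by (rule integral_measure_pmf[symmetric]) (auto simp: finite_set_coins)
  finally show ?case by (simp only: Suc.IH avg.simps of_nat_numeral)
qed

section \<open>Independent rounds of the process on uniform digits\<close>

context weighting
begin

primrec sel :: "(nat \<Rightarrow> nat) \<Rightarrow> nat \<Rightarrow> nat set" where
  "sel u 0 = {}"
| "sel u (Suc i) = (if u i < wt (sel u i) i then insert i (sel u i) else sel u i)"

lemma sel_cong: "(\<And>j. j < i \<Longrightarrow> u j = u' j) \<Longrightarrow> sel u i = sel u' i"
  by (induction i) auto

lemma reachable_sel: "reachable i (sel u i)"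
proof (induction i)
  case 0
  then show ?case by (simp add: reachable_def)
next
  case (Suc i)
  then show ?case using reachable_Suc[of i "sel u i"] by auto
qed

text \<open>\<open>h\<close> stands for the earlier rounds, which do not see the new block. Exactly
  \<open>wt I i\<close> of the \<open>M\<close> values of the last digit select position
  \<open>i\<close>, so summing out that digit reproduces one unfolding of \<open>expect\<close> and
  leaves \<open>h\<close> untouched.\<close>

lemma avg_sel_block:
  assumes "\<And>g k x. K \<le> k \<Longrightarrow> h (g(k := x)) = h g"
  shows "avg M (K + i) (\<lambda>g. h g * f (sel (\<lambda>j. g (K + j)) i)) = avg M K h * expect i f"
proof (induction i arbitrary: f)
  case 0
  then show ?case using avg_cmult[of M K "f {}" h] by (simp add: mult.commute)
next
  case (Suc i)
  have step: "(\<Sum>x<M. h (g(K + i := x)) * f (sel (\<lambda>j. (g(K + i := x)) (K + j)) (Suc i))) / real M =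
      h g * ((1 - prb I i) * f I + prb I i * f (insert i I))"
    if I: "I = sel (\<lambda>j. g (K + j)) i" for g I
  proof -
    have "sel (\<lambda>j. (g(K + i := x)) (K + j)) i = I" for x
      unfolding I by (intro sel_cong) auto
    then have "(\<Sum>x<M. h (g(K + i := x)) * f (sel (\<lambda>j. (g(K + i := x)) (K + j)) (Suc i))) =
        (\<Sum>x<M. h g * (if x < wt I i then f (insert i I) else f I))"
      using assms by (intro sum.cong) auto
    also have "\<dots> = h g * (\<Sum>x<M. if x < wt I i then f (insert i I) else f I)"
      by (simp add: sum_distrib_left)
    also have "(\<Sum>x<M. if x < wt I i then f (insert i I) else f I) =
        real (wt I i) * f (insert i I) + (real M - real (wt I i)) * f I"
    proof -
      have "{..<M} \<inter> {x. x < wt I i} = {..<wt I i}" "{..<M} \<inter> - {x. x < wt I i} = {wt I i..<M}"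
        using wt_less_M[of I i] by auto
      then show ?thesis
        using wt_less_M[of I i] by (simp add: sum.If_cases of_nat_diff)
    qed
    finally show ?thesis using M_pos by (simp only:) (simp add: prb_def field_simps)
  qed
  have "avg M (K + Suc i) (\<lambda>g. h g * f (sel (\<lambda>j. g (K + j)) (Suc i))) =
      avg M (K + i) (\<lambda>g. h g * (\<lambda>I. (1 - prb I i) * f I + prb I i * f (insert i I))
        (sel (\<lambda>j. g (K + j)) i))"
    unfolding add_Suc_right avg.simps by (simp only: step[OF refl])
  also have "\<dots> = avg M K h * expect (Suc i) f"
    unfolding expect.simps by (rule Suc.IH)
  finally show ?case .
qed

lemma avg_sel_prod:
  "avg M (q * n) (\<lambda>g. \<Prod>j<q. f (sel (\<lambda>i. g (j * n + i)) n)) = expect n f ^ q"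
proof (induction q)
  case 0
  then show ?case by simp
next
  case (Suc q)
  let ?h = "\<lambda>g. \<Prod>j<q. f (sel (\<lambda>i. g (j * n + i)) n)"
  have "?h (g(k := x)) = ?h g" if "q * n \<le> k" for g k x
  proof (rule prod.cong)
    fix j assume j: "j \<in> {..<q}"
    have "j * n + i < k" if "i < n" for i
    proof -
      have "j * n + i < Suc j * n" using that by simp
      also have "\<dots> \<le> q * n" using j by (intro mult_le_mono1) auto
      finally show ?thesis using \<open>q * n \<le> k\<close> by simp
    qed
    then have "sel (\<lambda>i. (g(k := x)) (j * n + i)) n = sel (\<lambda>i. g (j * n + i)) n"
      by (intro sel_cong) auto
    then show "f (sel (\<lambda>i. (g(k := x)) (j * n + i)) n) = f (sel (\<lambda>i. g (j * n + i)) n)"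
      by (rule arg_cong)
  qed simp
  from avg_sel_block[of "q * n" ?h n f, OF this]
  have "avg M (q * n + n) (\<lambda>g. ?h g * f (sel (\<lambda>j. g (q * n + j)) n)) = expect n f ^ q * expect n f"
    using Suc by simp
  then show ?case by (simp add: add.commute)
qed

definition round_set :: "nat \<Rightarrow> nat \<Rightarrow> (nat \<Rightarrow> nat) \<Rightarrow> nat \<Rightarrow> nat set" where
  "round_set n B g j = sel (\<lambda>i. dec B (\<lambda>b. g ((j * n + i) * B + b))) n"

lemma expect_member_exp:
  assumes v: "v < n" and \<beta>: "\<beta> \<le> expect v (\<lambda>I. prb I v)" and s: "0 \<le> s"
  shows "expect n (\<lambda>I. exp (- s * of_bool (v \<in> I))) \<le> exp (- \<beta> * (1 - exp (- s)))"
proof -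
  have "(\<lambda>I. exp (- s * of_bool (v \<in> I))) = (\<lambda>I. 1 - (1 - exp (- s)) * of_bool (v \<in> I))"
    by auto
  then have "expect n (\<lambda>I. exp (- s * of_bool (v \<in> I))) =
      1 - (1 - exp (- s)) * expect v (\<lambda>I. prb I v)"
    using v by (simp only: expect_diff expect_const expect_cmult expect_member)
  also have "\<dots> \<le> 1 - (1 - exp (- s)) * \<beta>"
    using \<beta> s by (intro diff_left_mono mult_left_mono) auto
  also have "\<dots> \<le> exp (- \<beta> * (1 - exp (- s)))"
    using exp_ge_add_one_self[of "- \<beta> * (1 - exp (- s))"] by (simp add: mult.commute)
  finally show ?thesis .
qed

lemma expect_nonneg: "(\<And>I. 0 \<le> f I) \<Longrightarrow> 0 \<le> expect t f"
  using expect_mono[of t "\<lambda>_. 0" f] by simp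

text \<open>A Chernoff bound for the lower tail with free parameter \<open>s\<close>: if
  \<open>N\<close> counts the rounds that select \<open>v\<close>, the indicator is at most
  \<open>exp (s * (\<alpha> * q - N))\<close>, and the mean of \<open>exp (- s * N)\<close> factors
  over the independent rounds.\<close>

lemma avg_few_rounds:
  assumes v: "v < n" and \<beta>: "\<beta> \<le> expect v (\<lambda>I. prb I v)" and s: "0 \<le> s" and M: "M = 2 ^ B"
  shows "avg 2 (q * n * B)
      (\<lambda>g. of_bool (real (card {j. j < q \<and> v \<in> round_set n B g j}) < \<alpha> * real q))
    \<le> exp (real q * (s * \<alpha> - \<beta> * (1 - exp (- s))))"
proof -
  let ?f = "\<lambda>I. exp (- s * of_bool (v \<in> I))"
  let ?N = "\<lambda>g. card {j. j < q \<and> v \<in> round_set n B g j}"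
  let ?D = "\<lambda>g k. if k < q * n then dec B (\<lambda>b. g (k * B + b)) else 0"
  \<comment> \<open>The tape has no end while \<open>avg_dec\<close> fills up with zeros; the first
    \<open>q\<close> rounds never look beyond digit \<open>q * n\<close>.\<close>
  have rs: "round_set n B g j = sel (\<lambda>i. ?D g (j * n + i)) n" if "j < q" for g j
    unfolding round_set_def
  proof (intro sel_cong)
    fix i assume "i < n"
    then have "j * n + i < Suc j * n" by simp
    also have "\<dots> \<le> q * n" using that by (intro mult_le_mono1) auto
    finally show "dec B (\<lambda>b. g ((j * n + i) * B + b)) = ?D g (j * n + i)" by simp
  qed
  have prod: "(\<Prod>j<q. ?f (round_set n B g j)) = exp (- s * real (?N g))" for g
  proof -
    have "(\<Sum>j<q. of_bool (v \<in> round_set n B g j)) = real (?N g)"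
      by (simp add: Int_def)
    then have "- s * real (?N g) = (\<Sum>j<q. - s * of_bool (v \<in> round_set n B g j))"
      by (simp only: sum_distrib_left[symmetric])
    then show ?thesis by (simp only: exp_sum finite_lessThan)
  qed
  have "avg 2 (q * n * B) (\<lambda>g. of_bool (real (?N g) < \<alpha> * real q)) \<le>
      avg 2 (q * n * B) (\<lambda>g. exp (s * (\<alpha> * real q)) * (\<Prod>j<q. ?f (round_set n B g j)))"
  proof (rule avg_mono)
    fix g
    have "1 \<le> exp (s * (\<alpha> * real q) + - s * real (?N g))" if "real (?N g) < \<alpha> * real q"
    proof -
      have "s * real (?N g) \<le> s * (\<alpha> * real q)" using that s by (intro mult_left_mono) auto
      then show ?thesis unfolding one_le_exp_iff by simp
    qed
    then show "of_bool (real (?N g) < \<alpha> * real q) \<le>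
        exp (s * (\<alpha> * real q)) * (\<Prod>j<q. ?f (round_set n B g j))"
      unfolding prod exp_add[symmetric] by (simp only: of_bool_def exp_ge_zero split: if_splits) simp
  qed
  also have "\<dots> = exp (s * (\<alpha> * real q)) *
      avg 2 (q * n * B) (\<lambda>g. \<Prod>j<q. ?f (sel (\<lambda>i. ?D g (j * n + i)) n))"
    unfolding avg_cmult by (simp add: rs)
  also have "avg 2 (q * n * B) (\<lambda>g. \<Prod>j<q. ?f (sel (\<lambda>i. ?D g (j * n + i)) n)) =
      avg (2 ^ B) (q * n) (\<lambda>h. \<Prod>j<q. ?f (sel (\<lambda>i. h (j * n + i)) n))"
    by (rule avg_dec[where F = "\<lambda>h. \<Prod>j<q. ?f (sel (\<lambda>i. h (j * n + i)) n)"])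
  also have "\<dots> = expect n ?f ^ q"
    unfolding M[symmetric] by (rule avg_sel_prod)
  also have "exp (s * (\<alpha> * real q)) * expect n ?f ^ q \<le>
      exp (s * (\<alpha> * real q)) * exp (- \<beta> * (1 - exp (- s))) ^ q"
    using expect_member_exp[OF v \<beta> s] by (intro mult_left_mono power_mono expect_nonneg) auto
  also have "\<dots> = exp (real q * (s * \<alpha> - \<beta> * (1 - exp (- s))))"
    by (simp add: algebra_simps flip: exp_of_nat_mult exp_add)
  finally show ?thesis .
qed

end

section \<open>The program\<close>

lemma ok_le: "ok t c s Q \<Longrightarrow> t \<le> t' \<Longrightarrow> ok t' c s Q"
  by (rule ok_weaken)

lemmas ok_intros = ok_Seq ok_Assign ok_If ok_SKIP

lemma ok_SeqI:
  assumes "ok t1 c1 s P"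
    and "\<And>s'. P s' \<Longrightarrow> same_off (writes c1) s s' \<Longrightarrow> ok t2 c2 s' Q"
  shows "ok (Suc (t1 + t2)) (Seq c1 c2) s Q"
  using assms by (intro ok_Seq ok_weaken[OF ok_frame[OF assms(1)]]) auto

text \<open>For factors that are constants of the program: unrolled into additions, the product is
  an ordinary expression and costs no loop.\<close>

primrec smult :: "nat \<Rightarrow> aexp \<Rightarrow> aexp" where
  "smult 0 a = N 0"
| "smult (Suc c) a = Plus a (smult c a)"

lemma aval_smult [simp]: "aval (smult c a) s = c * aval a s"
  by (induction c) auto

text \<open>Repeated addition takes time proportional to the product, which is affordable because
  all operands are polynomial in \<open>n\<close> and \<open>d\<close>. The second loop runs once
  per unit of the product, no less often than the quotient requires, so a counting loop
  suffices.\<close>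

definition MulDiv :: "aexp \<Rightarrow> aexp \<Rightarrow> aexp \<Rightarrow> com" where
  "MulDiv x y z =
     Seq (Put ''prod'' (N 0))
    (Seq (For ''m'' x (Put ''prod'' (Plus (Var ''prod'') y)))
    (Seq (Put ''part'' (N 0))
    (Seq (Put ''quot'' (N 0))
         (For ''m'' (Var ''prod'')
            (If (Not (Less (Var ''prod'') (Plus (Var ''part'') z)))
               (Seq (Put ''part'' (Plus (Var ''part'') z)) (Put ''quot'' (Plus (Var ''quot'') (N 1))))
               SKIP)))))"

lemma writes_MulDiv [simp]: "writes (MulDiv x y z) = {''prod'', ''m'', ''part'', ''quot''}"
  by (auto simp: MulDiv_def)

lemma same_off_trans': "same_off X s s' \<Longrightarrow> same_off Y s' s'' \<Longrightarrow> X \<subseteq> Z \<Longrightarrow> Y \<subseteq> Z \<Longrightarrow> same_off Z s s''"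
  unfolding same_off_def by (metis subsetD)

lemma same_off_put: "x \<in> X \<Longrightarrow> same_off X s (put x i k s)"
  by (auto simp: same_off_def put_def)

lemma ok_MulDiv:
  assumes z: "0 < c"
    and vals: "\<And>s'. same_off {''prod'', ''m'', ''part'', ''quot''} s s' \<Longrightarrow>
       aval x s' = a \<and> aval y s' = b \<and> aval z s' = c"
  shows "ok (5 * a + 8 * (a * b) + 20) (MulDiv x y z) s (\<lambda>s'. s' ''quot'' 0 = a * b div c)"
proof -
  let ?X = "{''prod'', ''m'', ''part'', ''quot''}"
  let ?S = "same_off ?X s"
  have 1: "ok (a * (1 + 4) + 3) (For ''m'' x (Put ''prod'' (Plus (Var ''prod'') y))) s1
      (\<lambda>s'. s' ''prod'' 0 = a * b \<and> ?S s')"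
    if s1: "?S s1" "s1 ''prod'' 0 = 0" for s1
  proof (rule ok_For[where Inv = "\<lambda>k s'. s' ''prod'' 0 = k * b"])
    fix s' assume "same_off (insert ''m'' (writes (Put ''prod'' (Plus (Var ''prod'') y)))) s1 s'"
    then have S: "?S s'" by (auto intro: same_off_trans'[OF s1(1)])
    then show "aval x s' = a" using vals by blast
    show "s' ''prod'' 0 = a * b \<Longrightarrow> s' ''prod'' 0 = a * b \<and> ?S s'" using S by blast
    show "ok 1 (Put ''prod'' (Plus (Var ''prod'') y)) s' (\<lambda>s'. s' ''prod'' 0 = Suc k * b)"
      if "s' ''prod'' 0 = k * b" for k
      using that vals[OF S] by (intro ok_Assign) (simp add: put_def)
  qed (use s1 in \<open>auto simp: put_def\<close>)
  define D where "D = a * b div c"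
  have D: "c * m + c \<le> a * b \<longleftrightarrow> Suc m \<le> D" for m
    using less_eq_div_iff_mult_less_eq[OF z, of "Suc m" "a * b"]
    by (simp add: D_def mult.commute add.commute)
  have Dle: "D \<le> a * b" by (simp add: D_def)
  have 2: "ok (a * b * (4 + 4) + 3) (For ''m'' (Var ''prod'')
            (If (Not (Less (Var ''prod'') (Plus (Var ''part'') z)))
               (Seq (Put ''part'' (Plus (Var ''part'') z)) (Put ''quot'' (Plus (Var ''quot'') (N 1))))
               SKIP)) s1 (\<lambda>s'. s' ''quot'' 0 = D)"
    if s1: "?S s1" "s1 ''prod'' 0 = a * b" "s1 ''part'' 0 = 0" "s1 ''quot'' 0 = 0" for s1
  \<comment> \<open>The quotient grows by 1 in each of the first \<open>D\<close> iterations, and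
    the remaining ones are idle; hence \<open>min k D\<close>.\<close>
  proof (rule ok_For[where Inv = "\<lambda>k s'. s' ''quot'' 0 = min k D \<and> s' ''part'' 0 = c * min k D"],
      goal_cases)
    case (3 s')
    then show ?case using s1 by (simp add: same_off_def)
  next
    case (4 k s')
    then have S: "?S s'" by (auto intro: same_off_trans'[OF s1(1)])
    define m where "m = min k D"
    have step: "min (Suc k) D = (if c * m + c \<le> a * b then Suc m else m)"
      unfolding D by (auto simp: m_def)
    have "s' ''prod'' 0 = a * b" using 4(2) s1 by (simp add: same_off_def)
    moreover have "s' ''quot'' 0 = m" "s' ''part'' 0 = c * m" using 4(4) by (simp_all add: m_def)
    moreover have "aval z s' = c" using vals[OF S] by simp
    ultimately show ?case unfolding step
      by - (rule ok_le[where t = "Suc (max (Suc (1 + 1)) 0)"], (intro ok_intros)?,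
         simp_all add: put_def not_less)
  qed (use s1 Dle in \<open>auto simp: put_def min_absorb2\<close>)
  show ?thesis
    unfolding MulDiv_def D_def[symmetric]
    apply (rule ok_le)
     apply (rule ok_Seq, rule ok_Assign)
     apply (rule ok_Seq, rule ok_weaken[OF 1])
        apply (simp add: same_off_put)
       apply (simp add: put_def)
      apply (rule order_refl)
     apply (rule ok_Seq, rule ok_Assign)
     apply (rule ok_Seq, rule ok_Assign)
     apply (rule 2)
        apply (auto simp: put_def same_off_def)
    done
qed

definition Log2 :: "aexp \<Rightarrow> com" where
  "Log2 x =
     Seq (Put ''pow'' (N 1))
    (Seq (Put ''log'' (N 0))
         (For ''m'' x
            (If (Not (Less x (Plus (Var ''pow'') (Var ''pow''))))
               (Seq (Put ''pow'' (Plus (Var ''pow'') (Var ''pow''))) (Put ''log'' (Plus (Var ''log'') (N 1))))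
               SKIP)))"

lemma writes_Log2 [simp]: "writes (Log2 x) = {''pow'', ''m'', ''log''}"
  by (auto simp: Log2_def)

lemma floor_log_le_self: "floor_log n \<le> n"
proof (cases "n = 0")
  case False
  then have "2 ^ floor_log n \<le> n" by (intro floor_log_exp2_le) simp
  with less_exp[of "floor_log n"] show ?thesis by linarith
qed simp

lemma Suc_le_floor_log_iff:
  assumes "0 < n"
  shows "2 ^ l + 2 ^ l \<le> n \<longleftrightarrow> Suc l \<le> floor_log n"
proof
  assume "2 ^ l + 2 ^ l \<le> n"
  then have "floor_log (2 ^ Suc l) \<le> floor_log n" by (intro floor_log_le_iff) simp
  then show "Suc l \<le> floor_log n" by (simp only: floor_log_power)
next
  assume "Suc l \<le> floor_log n"
  then have "(2::nat) ^ Suc l \<le> 2 ^ floor_log n" by (intro power_increasing) auto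
  also have "\<dots> \<le> n" using assms by (intro floor_log_exp2_le) simp
  finally show "2 ^ l + 2 ^ l \<le> n" by simp
qed

lemma ok_Log2:
  assumes vals: "\<And>s'. same_off {''pow'', ''m'', ''log''} s s' \<Longrightarrow> aval x s' = a"
  shows "ok (8 * a + 7) (Log2 x) s (\<lambda>s'. s' ''log'' 0 = floor_log a)"
proof -
  let ?X = "{''pow'', ''m'', ''log''}"
  let ?S = "same_off ?X s"
  define D where "D = floor_log a"
  have Dle: "D \<le> a" by (simp add: D_def floor_log_le_self)
  have loop: "ok (a * (4 + 4) + 3) (For ''m'' x
            (If (Not (Less x (Plus (Var ''pow'') (Var ''pow''))))
               (Seq (Put ''pow'' (Plus (Var ''pow'') (Var ''pow''))) (Put ''log'' (Plus (Var ''log'') (N 1))))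
               SKIP)) s1 (\<lambda>s'. s' ''log'' 0 = D)"
    if s1: "?S s1" "s1 ''pow'' 0 = 1" "s1 ''log'' 0 = 0" for s1
  proof (rule ok_For[where Inv = "\<lambda>k s'. s' ''log'' 0 = min k D \<and> s' ''pow'' 0 = 2 ^ min k D"],
      goal_cases)
    case (3 s')
    then have "?S s'" by (auto intro: same_off_trans'[OF s1(1)])
    then show ?case by (rule vals)
  next
    case (4 k s')
    then have S: "?S s'" by (auto intro: same_off_trans'[OF s1(1)])
    define m where "m = min k D"
    have "0 < a" using 4 by simp
    from Suc_le_floor_log_iff[OF this]
    have step: "min (Suc k) D = (if 2 ^ m + 2 ^ m \<le> a then Suc m else m)"
      by (auto simp: m_def D_def)
    have "s' ''log'' 0 = m" "s' ''pow'' 0 = 2 ^ m" using 4(4) by (simp_all add: m_def)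
    moreover have "aval x s' = a" using vals[OF S] by simp
    ultimately show ?case unfolding step
      by - (rule ok_le[where t = "Suc (max (Suc (1 + 1)) 0)"], (intro ok_intros)?,
         simp_all add: put_def not_less)
  qed (use s1 Dle in \<open>auto simp: put_def min_absorb2\<close>)
  show ?thesis
    unfolding Log2_def D_def[symmetric]
    apply (rule ok_le)
     apply (rule ok_Seq, rule ok_Assign)
     apply (rule ok_Seq, rule ok_Assign)
     apply (rule loop)
       apply (auto simp: put_def same_off_def)
    done
qed

text \<open>The row offsets of the adjacency matrix are tabulated once, as addresses cannot be
  computed by multiplication.\<close>

definition Table :: com where
  "Table = Seq (Put ''base'' (N 0))
     (For ''i'' (Var ''n'') (Seq (Assign ''rn'' (Var ''i'') (Var ''base''))
        (Put ''base'' (Plus (Var ''base'') (Var ''n'')))))"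

lemma writes_Table [simp]: "writes Table = {''base'', ''i'', ''rn''}"
  by (auto simp: Table_def)

lemma ok_Table:
  assumes "s ''n'' 0 = n"
  shows "ok (7 * n + 5) Table s (\<lambda>s'. \<forall>i<n. s' ''rn'' i = i * n)"
proof -
  have loop: "ok (n * (3 + 4) + 3) (For ''i'' (Var ''n'') (Seq (Assign ''rn'' (Var ''i'') (Var ''base''))
        (Put ''base'' (Plus (Var ''base'') (Var ''n''))))) s1 (\<lambda>s'. \<forall>i<n. s' ''rn'' i = i * n)"
    if s1: "s1 ''n'' 0 = n" "s1 ''base'' 0 = 0" for s1
  proof (rule ok_For[where Inv = "\<lambda>k s'. s' ''base'' 0 = k * n \<and> (\<forall>i<k. s' ''rn'' i = i * n)"],
      goal_cases)
    case (4 k s')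
    then have "s' ''n'' 0 = n" using s1 by (simp add: same_off_def)
    with 4 show ?case
      by - (rule ok_le[where t = "Suc (1 + 1)"], (intro ok_intros)?,
         auto simp: put_def less_Suc_eq)
  qed (use s1 in \<open>auto simp: put_def same_off_def\<close>)
  show ?thesis
    unfolding Table_def
    apply (rule ok_le)
     apply (rule ok_Seq, rule ok_Assign)
     apply (rule loop)
      apply (use assms in \<open>auto simp: put_def\<close>)
    done
qed

definition Pow2 :: com where
  "Pow2 = Seq (Put ''M'' (N 1)) (For ''i'' (Var ''bits'') (Put ''M'' (Plus (Var ''M'') (Var ''M''))))"

lemma writes_Pow2 [simp]: "writes Pow2 = {''M'', ''i''}"
  by (auto simp: Pow2_def)

lemma ok_Pow2:
  assumes "s ''bits'' 0 = b"
  shows "ok (5 * b + 5) Pow2 s (\<lambda>s'. s' ''M'' 0 = 2 ^ b)"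
proof -
  have loop: "ok (b * (1 + 4) + 3) (For ''i'' (Var ''bits'') (Put ''M'' (Plus (Var ''M'') (Var ''M''))))
      s1 (\<lambda>s'. s' ''M'' 0 = 2 ^ b)"
    if s1: "s1 ''bits'' 0 = b" "s1 ''M'' 0 = 1" for s1
  proof (rule ok_For[where Inv = "\<lambda>k s'. s' ''M'' 0 = 2 ^ k"], goal_cases)
    case (4 k s')
    then show ?case by (intro ok_intros) (simp add: put_def)
  qed (use s1 in \<open>auto simp: put_def same_off_def\<close>)
  show ?thesis
    unfolding Pow2_def
    apply (rule ok_le)
     apply (rule ok_Seq, rule ok_Assign)
     apply (rule loop)
      apply (use assms in \<open>auto simp: put_def\<close>)
    done
qed

text \<open>\<open>2 ^ bits_of d\<close> lies between \<open>d ^ 3\<close> and \<open>8 * d ^ 3\<close> for \<open>d > 0\<close>.\<close>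

definition bits_of :: "nat \<Rightarrow> nat" where
  "bits_of d = 3 * floor_log d + 3"

definition precision :: "nat \<Rightarrow> nat" where
  "precision d = 2 ^ bits_of d"

text \<open>\<open>a / b\<close> approximates \<open>\<kappa> * ln 2\<close>: the program has only
  the integer binary logarithm, and the factor \<open>ln 2\<close> converts it to the natural
  one.\<close>

definition start_weight :: "nat \<Rightarrow> nat \<Rightarrow> nat \<Rightarrow> nat" where
  "start_weight a b d = a * floor_log d * precision d div (b * d)"

text \<open>For \<open>n \<le> 1\<close> this is \<open>0\<close>, as \<open>floor_log 0 = floor_log 1 = 0\<close>, in agreement with \<open>ln 0 = ln 1 = 0\<close>.\<close>

definition rounds :: "nat \<Rightarrow> nat \<Rightarrow> nat \<Rightarrow> nat" where
  "rounds C n d = C * d * floor_log n div floor_log d"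

definition Setup :: "nat \<Rightarrow> nat \<Rightarrow> nat \<Rightarrow> com" where
  "Setup a b C =
     Seq Table
    (Seq (Log2 (Var ''d''))
    (Seq (Put ''lam'' (Var ''log''))
    (Seq (Log2 (Var ''n''))
    (Seq (Put ''bits'' (Plus (smult 3 (Var ''lam'')) (N 3)))
    (Seq Pow2
    (Seq (MulDiv (smult a (Var ''lam'')) (Var ''M'') (smult b (Var ''d'')))
    (Seq (Put ''W0'' (Var ''quot''))
    (Seq (MulDiv (smult C (Var ''d'')) (Var ''log'') (Var ''lam''))
    (Seq (Put ''q'' (Var ''quot''))
    (Seq (MulDiv (Var ''q'') (Var ''n'') (N 1))
    (Seq (Put ''len'' (Var ''quot''))
    (Seq (MulDiv (Var ''len'') (Var ''bits'') (N 1))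
         (Put ''len'' (Var ''quot''))))))))))))))"

definition ready :: "nat \<Rightarrow> nat \<Rightarrow> nat \<Rightarrow> nat \<Rightarrow> nat \<Rightarrow> (nat \<Rightarrow> nat) \<Rightarrow> store \<Rightarrow> bool" where
  "ready a b C n d adj s \<longleftrightarrow>
     s ''n'' 0 = n \<and> s ''d'' 0 = d \<and> s ''adj'' = adj \<and> (\<forall>i<n. s ''rn'' i = i * n) \<and>
     s ''bits'' 0 = bits_of d \<and> s ''M'' 0 = precision d \<and> s ''W0'' 0 = start_weight a b d \<and>
     s ''q'' 0 = rounds C n d \<and> s ''len'' 0 = rounds C n d * n * bits_of d \<and>
     s ''r'' = (\<lambda>_. 0) \<and> s ''rem'' = (\<lambda>_. 0) \<and> s ''out'' = (\<lambda>_. 0)"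

definition setup_time :: "nat \<Rightarrow> nat \<Rightarrow> nat \<Rightarrow> nat \<Rightarrow> nat \<Rightarrow> nat" where
  "setup_time a b C n d =
     7 * n + 8 * d + 8 * n + 5 * bits_of d + (5 * (a * floor_log d) + 8 * (a * floor_log d * precision d)) +
     (5 * (C * d) + 8 * (C * d * floor_log n)) + (5 * rounds C n d + 8 * (rounds C n d * n)) +
     (5 * (rounds C n d * n) + 8 * (rounds C n d * n * bits_of d)) + 200"

lemma ok_Setup:
  assumes d: "2 \<le> d" and b: "0 < b"
    and s: "s ''n'' 0 = n" "s ''d'' 0 = d" "s ''r'' = (\<lambda>_. 0)" "s ''rem'' = (\<lambda>_. 0)" "s ''out'' = (\<lambda>_. 0)"
  shows "ok (setup_time a b C n d) (Setup a b C) s (ready a b C n d (s ''adj''))"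
proof -
  have lam: "0 < floor_log d"
    using d by (subst floor_log_rec) auto
  show ?thesis
    unfolding Setup_def
    apply (rule ok_le)
     apply (rule ok_SeqI, rule ok_Table, rule s(1))
     apply (rule ok_SeqI, rule ok_Log2[where a = d])
      subgoal by (use s in \<open>simp add: same_off_def\<close>)
     apply (rule ok_Seq, rule ok_Assign)
     apply (rule ok_SeqI, rule ok_Log2[where a = n])
      subgoal by (use s in \<open>simp add: same_off_def put_def\<close>)
     apply (rule ok_Seq, rule ok_Assign)
     apply (rule ok_SeqI, rule ok_Pow2[where b = "bits_of d"])
      subgoal by (use s in \<open>simp add: same_off_def put_def bits_of_def\<close>)
     apply (rule ok_SeqI, rule ok_MulDiv[where a = "a * floor_log d" and b = "precision d" and c = "b * d"])
       subgoal using b d by simp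
      subgoal by (use s in \<open>simp add: same_off_def put_def precision_def\<close>)
     apply (rule ok_Seq, rule ok_Assign)
     apply (rule ok_SeqI, rule ok_MulDiv[where a = "C * d" and b = "floor_log n" and c = "floor_log d"])
       subgoal by (rule lam)
      subgoal by (use s in \<open>simp add: same_off_def put_def\<close>)
     apply (rule ok_Seq, rule ok_Assign)
     apply (rule ok_SeqI, rule ok_MulDiv[where a = "rounds C n d" and b = n and c = 1])
       subgoal by simp
      subgoal by (use s in \<open>simp add: same_off_def put_def rounds_def\<close>)
     apply (rule ok_Seq, rule ok_Assign)
     apply (rule ok_SeqI, rule ok_MulDiv[where a = "rounds C n d * n" and b = "bits_of d" and c = 1])
       subgoal by simp
      subgoal by (use s in \<open>simp add: same_off_def put_def bits_of_def\<close>)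
     apply (rule ok_Assign)
    subgoal by (use s in \<open>simp add: ready_def same_off_def put_def bits_of_def precision_def start_weight_def rounds_def\<close>)
    apply (simp add: setup_time_def)
    done
qed

section \<open>Computing a degeneracy order\<close>

lemma card_less_Suc_filter:
  "card {c. c < Suc k \<and> P c} = card {c. c < k \<and> P c} + of_bool (P k)"
proof -
  have "{c. c < Suc k \<and> P c} = (if P k then insert k {c. c < k \<and> P c} else {c. c < k \<and> P c})"
    by (auto simp: less_Suc_eq)
  then show ?thesis by simp
qed

definition Count :: com where
  "Count = Seq (Put ''cnt'' (N 0))
     (For ''c'' (Var ''n'')
        (If (And (Less (Cell ''rem'' (Var ''c'')) (N 1))
                 (Less (N 0) (Cell ''adj'' (Plus (Cell ''rn'' (Var ''b'')) (Var ''c'')))))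
           (Put ''cnt'' (Plus (Var ''cnt'') (N 1)))
           SKIP))"

lemma writes_Count [simp]: "writes Count = {''cnt'', ''c''}"
  by (auto simp: Count_def)

lemma ok_Count:
  assumes s: "s ''n'' 0 = n" "s ''b'' 0 = b" "s ''rn'' b = b * n"
  shows "ok (6 * n + 5) Count s
    (\<lambda>s'. s' ''cnt'' 0 = card {c. c < n \<and> s ''rem'' c = 0 \<and> 0 < s ''adj'' (b * n + c)})"
proof -
  let ?P = "\<lambda>c. s ''rem'' c = 0 \<and> 0 < s ''adj'' (b * n + c)"
  have loop: "ok (n * (2 + 4) + 3) (For ''c'' (Var ''n'')
        (If (And (Less (Cell ''rem'' (Var ''c'')) (N 1))
                 (Less (N 0) (Cell ''adj'' (Plus (Cell ''rn'' (Var ''b'')) (Var ''c'')))))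
           (Put ''cnt'' (Plus (Var ''cnt'') (N 1)))
           SKIP)) s1 (\<lambda>s'. s' ''cnt'' 0 = card {c. c < n \<and> ?P c})"
    if s1: "same_off {''cnt'', ''c''} s s1" "s1 ''cnt'' 0 = 0" for s1
  proof (rule ok_For[where Inv = "\<lambda>k s'. s' ''cnt'' 0 = card {c. c < k \<and> ?P c}"], goal_cases)
    case (4 k s')
    then have "same_off {''cnt'', ''c''} s s'" by (auto intro: same_off_trans'[OF s1(1)])
    then have "s' ''rem'' = s ''rem''" "s' ''adj'' = s ''adj''" "s' ''rn'' = s ''rn''" "s' ''b'' = s ''b''"
      by (simp_all add: same_off_def)
    with 4 s show ?case
      unfolding card_less_Suc_filter
      by - (rule ok_le[where t = "Suc (max 1 0)"], (intro ok_intros)?, auto simp: put_def)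
  qed (use s s1 in \<open>auto simp: put_def same_off_def\<close>)
  show ?thesis
    unfolding Count_def
    apply (rule ok_le)
     apply (rule ok_Seq, rule ok_Assign)
     apply (rule loop)
      apply (auto simp: put_def same_off_def)
    done
qed

definition Pick :: com where
  "Pick = For ''b'' (Var ''n'')
     (Seq Count
        (If (And (Less (Cell ''rem'' (Var ''b'')) (N 1)) (Not (Less (Var ''d'') (Var ''cnt''))))
           (Put ''pick'' (Var ''b''))
           SKIP))"

lemma writes_Pick [simp]: "writes Pick = {''b'', ''cnt'', ''c'', ''pick''}"
  by (auto simp: Pick_def)

lemma ok_Pick:
  fixes s :: store and n d :: nat
  defines "good \<equiv> \<lambda>b. s ''rem'' b = 0 \<and> card {c. c < n \<and> s ''rem'' c = 0 \<and> 0 < s ''adj'' (b * n + c)} \<le> d"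
  assumes s: "s ''n'' 0 = n" "s ''d'' 0 = d" "\<forall>i<n. s ''rn'' i = i * n"
    and ex: "\<exists>b<n. good b"
  shows "ok (n * (6 * n + 12) + 3) Pick s (\<lambda>s'. s' ''pick'' 0 < n \<and> good (s' ''pick'' 0))"
proof -
  let ?X = "{''b'', ''cnt'', ''c'', ''pick''}"
  have "ok (n * (6 * n + 8 + 4) + 3) Pick s (\<lambda>s'. s' ''pick'' 0 < n \<and> good (s' ''pick'' 0))"
    unfolding Pick_def
  proof (rule ok_For[where Inv = "\<lambda>k s'. (\<exists>b<k. good b) \<longrightarrow> s' ''pick'' 0 < n \<and> good (s' ''pick'' 0)"],
      goal_cases)
    case (4 k s')
    from 4(2) have S: "same_off ?X s s'" by (simp add: insert_commute)
    then have eqs: "s' ''rem'' = s ''rem''" "s' ''adj'' = s ''adj''" "s' ''rn'' = s ''rn''"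
        "s' ''n'' = s ''n''" "s' ''d'' = s ''d''"
      by (simp_all add: same_off_def)
    have branch: "ok (Suc (max 1 0)) (If (And (Less (Cell ''rem'' (Var ''b'')) (N 1)) (Not (Less (Var ''d'') (Var ''cnt''))))
           (Put ''pick'' (Var ''b'')) SKIP) s2
        (\<lambda>s'. (\<exists>b<Suc k. good b) \<longrightarrow> s' ''pick'' 0 < n \<and> good (s' ''pick'' 0))"
      if cnt: "s2 ''cnt'' 0 = card {c. c < n \<and> s' ''rem'' c = 0 \<and> 0 < s' ''adj'' (k * n + c)}"
        and S2: "same_off (writes Count) s' s2" for s2
    proof -
      have eqs2: "s2 ''b'' 0 = k" "s2 ''rem'' = s ''rem''" "s2 ''d'' 0 = d" "s2 ''pick'' = s' ''pick''"
        using S2 4(3) eqs s by (simp_all add: same_off_def)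
      have cond: "bval (And (Less (Cell ''rem'' (Var ''b'')) (N 1)) (Not (Less (Var ''d'') (Var ''cnt'')))) s2
          \<longleftrightarrow> good k"
        unfolding good_def by (simp add: eqs2 cnt eqs not_less)
      show ?thesis
      proof (rule ok_If, unfold cond)
        assume "good k"
        then show "ok 1 (Put ''pick'' (Var ''b'')) s2
            (\<lambda>s'. (\<exists>b<Suc k. good b) \<longrightarrow> s' ''pick'' 0 < n \<and> good (s' ''pick'' 0))"
          using 4(1) by (intro ok_Assign) (simp add: put_scalar eqs2)
      next
        assume "\<not> good k"
        then show "ok 0 SKIP s2 (\<lambda>s'. (\<exists>b<Suc k. good b) \<longrightarrow> s' ''pick'' 0 < n \<and> good (s' ''pick'' 0))"
          using 4(4) unfolding eqs2(4)[symmetric] by (intro ok_SKIP) (auto simp only: less_Suc_eq)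
      qed
    qed
    have count: "ok (6 * n + 5) Count s'
        (\<lambda>s2. s2 ''cnt'' 0 = card {c. c < n \<and> s' ''rem'' c = 0 \<and> 0 < s' ''adj'' (k * n + c)})"
      using 4(1,3) s(1,3) eqs by (intro ok_Count) simp_all
    show ?case
      by (rule ok_le, rule ok_SeqI, rule count, rule branch, assumption+, simp)
  qed (use s ex in \<open>auto simp: put_def same_off_def\<close>)
  then show ?thesis by (rule ok_le) simp
qed

text \<open>The order is filled from the back. The vertex placed at \<open>n - a - 1\<close> has at
  most \<open>d\<close> neighbours among the vertices not yet removed, and those will occupy the
  earlier positions.\<close>

definition Order :: com where
  "Order = For ''a'' (Var ''n'')
     (Seq Pick
     (Seq (Assign ''rem'' (Var ''pick'') (N 1))
          (Assign ''ord'' (Minus (Minus (Var ''n'') (Var ''a'')) (N 1)) (Var ''pick''))))"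

lemma writes_Order [simp]: "writes Order = {''a'', ''b'', ''cnt'', ''c'', ''pick'', ''rem'', ''ord''}"
  by (auto simp: Order_def)

definition elimination_order :: "nat \<Rightarrow> nat \<Rightarrow> (nat \<Rightarrow> nat) \<Rightarrow> (nat \<Rightarrow> nat) \<Rightarrow> bool" where
  "elimination_order n d adj od \<longleftrightarrow>
     bij_betw od {..<n} {..<n} \<and>
     (\<forall>i<n. card {j. j < i \<and> 0 < adj (od i * n + od j)} \<le> d)"

definition partial_order_ok :: "nat \<Rightarrow> nat \<Rightarrow> (nat \<Rightarrow> nat) \<Rightarrow> nat \<Rightarrow> (nat \<Rightarrow> nat) \<Rightarrow> bool" where
  "partial_order_ok n d adj m od \<longleftrightarrow>
     inj_on od {m..<n} \<and> od ` {m..<n} \<subseteq> {..<n} \<and>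
     (\<forall>i\<in>{m..<n}. card {c. c < n \<and> c \<notin> od ` {Suc i..<n} \<and> 0 < adj (od i * n + c)} \<le> d)"

lemma partial_order_ok_step:
  assumes "partial_order_ok n d adj (Suc m) od" "m < n" "v < n" "v \<notin> od ` {Suc m..<n}"
    and "card {c. c < n \<and> c \<notin> od ` {Suc m..<n} \<and> 0 < adj (v * n + c)} \<le> d"
  shows "partial_order_ok n d adj m (od(m := v))"
proof -
  have img: "(od(m := v)) ` {Suc i..<n} = od ` {Suc i..<n}" if "m \<le> i" for i
    using that by (intro image_cong) auto
  have set: "{m..<n} = insert m {Suc m..<n}" using assms(2) by auto
  have "inj_on (od(m := v)) {Suc m..<n}"
    using assms(1) by (subst inj_on_cong[of _ _ od]) (auto simp: partial_order_ok_def)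
  then have "inj_on (od(m := v)) {m..<n}"
    unfolding set inj_on_insert using img[of m] assms(4) by (simp del: fun_upd_image)
  moreover have "(od(m := v)) ` {m..<n} \<subseteq> {..<n}"
    unfolding set image_insert img[OF order_refl] using assms(1,3) by (simp add: partial_order_ok_def)
  moreover have "card {c. c < n \<and> c \<notin> (od(m := v)) ` {Suc i..<n} \<and> 0 < adj ((od(m := v)) i * n + c)} \<le> d"
    if i: "i \<in> {m..<n}" for i
  proof -
    have "m \<le> i" using i by simp
    show ?thesis
      unfolding img[OF \<open>m \<le> i\<close>] using assms(1,5) i by (cases "i = m") (auto simp: partial_order_ok_def)
  qed
  ultimately show ?thesis unfolding partial_order_ok_def by blast
qed

text \<open>By injectivity a vertex at a position below \<open>i\<close> is not placed after
  \<open>i\<close>, so it was still present, and counted, when \<open>od i\<close> was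
  chosen.\<close>

lemma partial_order_ok_0:
  assumes "partial_order_ok n d adj 0 od"
  shows "elimination_order n d adj od"
proof -
  have inj: "inj_on od {..<n}" and sub: "od ` {..<n} \<subseteq> {..<n}"
    using assms by (auto simp: partial_order_ok_def lessThan_atLeast0)
  have "card {j. j < i \<and> 0 < adj (od i * n + od j)} \<le> d" if i: "i < n" for i
  proof -
    have "card {j. j < i \<and> 0 < adj (od i * n + od j)} =
        card (od ` {j. j < i \<and> 0 < adj (od i * n + od j)})"
      using i by (intro card_image[symmetric] inj_on_subset[OF inj]) auto
    also have "\<dots> \<le> card {c. c < n \<and> c \<notin> od ` {Suc i..<n} \<and> 0 < adj (od i * n + c)}"
    proof (intro card_mono subsetI)
      fix c assume "c \<in> od ` {j. j < i \<and> 0 < adj (od i * n + od j)}"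
      then obtain j where j: "c = od j" "j < i" "0 < adj (od i * n + od j)" by auto
      have "od j \<notin> od ` {Suc i..<n}"
      proof
        assume "od j \<in> od ` {Suc i..<n}"
        then obtain j' where "od j = od j'" "Suc i \<le> j'" "j' < n" by auto
        with inj_onD[OF inj, of j j'] j i show False by auto
      qed
      moreover have "od j < n" using sub j i by (auto simp: image_subset_iff)
      ultimately show "c \<in> {c. c < n \<and> c \<notin> od ` {Suc i..<n} \<and> 0 < adj (od i * n + c)}" using j by simp
    qed simp
    also have "\<dots> \<le> d" using assms i by (auto simp: partial_order_ok_def)
    finally show ?thesis .
  qed
  moreover have "od ` {..<n} = {..<n}"
    using inj sub by (intro card_subset_eq) (auto simp: card_image)
  ultimately show ?thesis using inj by (auto simp: elimination_order_def bij_betw_def)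
qed

lemma ok_Order:
  assumes s: "s ''n'' 0 = n" "s ''d'' 0 = d" "\<forall>i<n. s ''rn'' i = i * n" "s ''rem'' = (\<lambda>_. 0)"
    and deg: "\<And>R. R \<subseteq> {..<n} \<Longrightarrow> R \<noteq> {} \<Longrightarrow>
      \<exists>v\<in>R. card {c. c < n \<and> c \<in> R \<and> 0 < s ''adj'' (v * n + c)} \<le> d"
  shows "ok (n * (n * (6 * n + 12) + 12) + 3) Order s (\<lambda>s'. elimination_order n d (s ''adj'') (s' ''ord''))"
proof -
  let ?X = "{''a'', ''b'', ''cnt'', ''c'', ''pick'', ''rem'', ''ord''}"
  let ?adj = "s ''adj''"
  have "ok (n * (n * (6 * n + 12) + 8 + 4) + 3) Order s (\<lambda>s'. elimination_order n d ?adj (s' ''ord''))"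
    unfolding Order_def
  proof (rule ok_For[where Inv = "\<lambda>k s'. partial_order_ok n d ?adj (n - k) (s' ''ord'') \<and>
      (\<forall>b<n. s' ''rem'' b = of_bool (b \<in> s' ''ord'' ` {n - k..<n}))"], goal_cases)
    case (2)
    then show ?case using s by (simp add: partial_order_ok_def)
  next
    case (4 k s')
    define od where "od = s' ''ord''"
    define m where "m = n - Suc k"
    have nk: "n - k = Suc m" "m < n" "n - k - 1 = m" using 4(1) by (auto simp: m_def)
    from 4(2) have S: "same_off ?X s s'" by (simp add: insert_commute)
    then have eqs: "s' ''adj'' = ?adj" "s' ''rn'' = s ''rn''" "s' ''n'' = s ''n''" "s' ''d'' = s ''d''"
      by (simp_all add: same_off_def)
    have P: "partial_order_ok n d ?adj (Suc m) od"
      and rem: "\<And>b. b < n \<Longrightarrow> s' ''rem'' b = of_bool (b \<in> od ` {Suc m..<n})"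
      using 4(4) nk by (simp_all add: od_def)
    define R where "R = {..<n} - od ` {Suc m..<n}"
    have "card (od ` {Suc m..<n}) < card {..<n}"
      using card_image_le[of "{Suc m..<n}" od] nk by simp
    then have "R \<noteq> {}" unfolding R_def
      by (metis Diff_eq_empty_iff card_mono finite_atLeastLessThan finite_imageI linorder_not_less)
    have Rset: "{c. c < n \<and> s' ''rem'' c = 0 \<and> 0 < s' ''adj'' (b * n + c)} =
        {c. c < n \<and> c \<in> R \<and> 0 < ?adj (b * n + c)}" for b
      using eqs rem by (auto simp: R_def)
    obtain b where b: "b \<in> R" "card {c. c < n \<and> c \<in> R \<and> 0 < ?adj (b * n + c)} \<le> d"
      using deg[of R] \<open>R \<noteq> {}\<close> by (auto simp: R_def)
    then have ex: "\<exists>b<n. s' ''rem'' b = 0 \<and>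
        card {c. c < n \<and> s' ''rem'' c = 0 \<and> 0 < s' ''adj'' (b * n + c)} \<le> d"
      unfolding Rset using rem by (intro exI[of _ b]) (auto simp: R_def)
    show ?case
    proof (rule ok_le, rule ok_SeqI, rule ok_Pick[where n = n and d = d])
      fix s2 assume pick: "s2 ''pick'' 0 < n \<and> s' ''rem'' (s2 ''pick'' 0) = 0 \<and>
          card {c. c < n \<and> s' ''rem'' c = 0 \<and> 0 < s' ''adj'' (s2 ''pick'' 0 * n + c)} \<le> d"
        and S2: "same_off (writes Pick) s' s2"
      define v where "v = s2 ''pick'' 0"
      have v: "v < n" "v \<notin> od ` {Suc m..<n}" using pick rem[of v] by (auto simp: v_def)
      have cv: "card {c. c < n \<and> c \<notin> od ` {Suc m..<n} \<and> 0 < ?adj (v * n + c)} \<le> d"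
      proof -
        have "{c. c < n \<and> c \<in> R \<and> 0 < ?adj (v * n + c)} =
            {c. c < n \<and> c \<notin> od ` {Suc m..<n} \<and> 0 < ?adj (v * n + c)}" by (auto simp: R_def)
        with pick show ?thesis unfolding Rset v_def by simp
      qed
      have s2: "s2 ''n'' 0 = n" "s2 ''a'' 0 = k" "s2 ''ord'' = od" "s2 ''rem'' = s' ''rem''"
        using S2 4(3) eqs s by (simp_all add: same_off_def od_def)
      have img: "(od(m := v)) ` {m..<n} = insert v (od ` {Suc m..<n})"
      proof -
        have "{m..<n} = insert m {Suc m..<n}" using nk by auto
        moreover have "(od(m := v)) ` {Suc m..<n} = od ` {Suc m..<n}" by (intro image_cong) auto
        ultimately show ?thesis by (simp only: image_insert fun_upd_same)
      qed
      show "ok (Suc (1 + 1)) (Seq (Assign ''rem'' (Var ''pick'') (N 1))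
          (Assign ''ord'' (Minus (Minus (Var ''n'') (Var ''a'')) (N 1)) (Var ''pick''))) s2
        (\<lambda>s'. partial_order_ok n d ?adj (n - Suc k) (s' ''ord'') \<and>
          (\<forall>b<n. s' ''rem'' b = of_bool (b \<in> s' ''ord'' ` {n - Suc k..<n})))"
      proof (intro ok_intros, goal_cases)
        case 1
        let ?s = "put ''ord'' m v (put ''rem'' v 1 s2)"
        have "partial_order_ok n d ?adj m (?s ''ord'')"
          using partial_order_ok_step[OF P nk(2) v cv] s2 by (simp add: put_def)
        moreover have "\<forall>b<n. ?s ''rem'' b = of_bool (b \<in> ?s ''ord'' ` {m..<n})"
          using img s2 rem by (auto simp: put_def)
        ultimately show ?case
          using s2 nk(3) by (simp add: put_def v_def m_def)
      qed
    qed (use s eqs ex 4 in auto)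
  next
    case 5
    then show ?case by (simp add: put_def)
  qed (use s partial_order_ok_0 in \<open>auto simp: put_def same_off_def\<close>)
  then show ?thesis by (rule ok_le) simp
qed

section \<open>Sampling the independent sets\<close>

definition Weigh :: "nat \<Rightarrow> com" where
  "Weigh k =
     Seq (Put ''W'' (Var ''W0''))
         (For ''k'' (Var ''i'')
            (If (Less (N 0) (Cell ''adj'' (Plus (Cell ''rn'' (Var ''v'')) (Cell ''ord'' (Var ''k'')))))
               (If (Less (N 0) (Cell ''sel'' (Var ''k'')))
                  (Put ''W'' (N 0))
                  (Seq (MulDiv (Var ''W'') (Var ''M'') (Minus (Var ''M'') (Cell ''wt'' (Var ''k''))))
                       (If (Less (Var ''M'') (smult k (Var ''quot'')))
                          (Put ''W'' (N 0))
                          (Put ''W'' (Var ''quot'')))))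
               SKIP))"

lemma writes_Weigh [simp]: "writes (Weigh k) = {''W'', ''k'', ''prod'', ''m'', ''part'', ''quot''}"
  by (auto simp: Weigh_def)

definition weigh_time :: "nat \<Rightarrow> nat" where
  "weigh_time M = 5 * M + 8 * (M * M) + 40"

lemma (in weighting) ok_Weigh:
  assumes s: "s ''i'' 0 = i" "s ''M'' 0 = M" "s ''W0'' 0 = W0" "s ''rn'' (s ''v'' 0) = s ''v'' 0 * n"
    and adj: "\<And>j. j < i \<Longrightarrow> adj i j \<longleftrightarrow> 0 < s ''adj'' (s ''v'' 0 * n + s ''ord'' j)"
    and sel: "\<And>j. j < i \<Longrightarrow> s ''sel'' j = of_bool (j \<in> I)"
    and wt: "\<And>j. j < i \<Longrightarrow> s ''wt'' j = wt I j"
  shows "ok (i * weigh_time M + 5) (Weigh k) s (\<lambda>s'. s' ''W'' 0 = wt I i)"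
proof -
  let ?X = "{''W'', ''k'', ''prod'', ''m'', ''part'', ''quot''}"
  have loop: "ok (i * (5 * M + 8 * (M * M) + 30 + 4) + 3) (For ''k'' (Var ''i'')
            (If (Less (N 0) (Cell ''adj'' (Plus (Cell ''rn'' (Var ''v'')) (Cell ''ord'' (Var ''k'')))))
               (If (Less (N 0) (Cell ''sel'' (Var ''k'')))
                  (Put ''W'' (N 0))
                  (Seq (MulDiv (Var ''W'') (Var ''M'') (Minus (Var ''M'') (Cell ''wt'' (Var ''k''))))
                       (If (Less (Var ''M'') (smult k (Var ''quot'')))
                          (Put ''W'' (N 0))
                          (Put ''W'' (Var ''quot'')))))
               SKIP)) s1 (\<lambda>s'. s' ''W'' 0 = wt I i)"
    if s1: "same_off ?X s s1" "s1 ''W'' 0 = W0" for s1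
  proof (rule ok_For[where Inv = "\<lambda>j s'. s' ''W'' 0 = acc I (wt I) i j"], goal_cases)
    case (4 j s')
    then have S: "same_off ?X s s'" by (auto intro: same_off_trans'[OF s1(1)])
    then have eqs: "s' ''adj'' = s ''adj''" "s' ''rn'' = s ''rn''" "s' ''ord'' = s ''ord''"
        "s' ''sel'' = s ''sel''" "s' ''wt'' = s ''wt''" "s' ''M'' = s ''M''" "s' ''v'' = s ''v''"
      by (simp_all add: same_off_def)
    define a where "a = acc I (wt I) i j"
    have a: "s' ''W'' 0 = a" using 4(4) by (simp add: a_def)
    \<comment> \<open>This makes the running time of the multiplication depend on \<open>M\<close>
      alone.\<close>
    have "a \<le> M"
    proof -
      have "1 * a \<le> k * a" using k2 by (intro mult_right_mono) auto
      with acc_le[of I "wt I" i j] show ?thesis unfolding a_def by linarith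
    qed
    have c1: "bval (Less (N 0) (Cell ''adj'' (Plus (Cell ''rn'' (Var ''v'')) (Cell ''ord'' (Var ''k''))))) s'
        \<longleftrightarrow> adj i j"
      using adj[OF 4(1)] by (simp add: eqs s 4(3))
    have c2: "bval (Less (N 0) (Cell ''sel'' (Var ''k''))) s' \<longleftrightarrow> j \<in> I"
      using sel[OF 4(1)] by (simp add: eqs 4(3))
    have MD: "ok (5 * M + 8 * (M * M) + 20)
        (MulDiv (Var ''W'') (Var ''M'') (Minus (Var ''M'') (Cell ''wt'' (Var ''k'')))) s'
        (\<lambda>s'. s' ''quot'' 0 = a * M div (M - wt I j))"
    proof (rule ok_le, rule ok_MulDiv)
      show "0 < M - wt I j" using wt_less_M by simp
      show "aval (Var ''W'') s2 = a \<and> aval (Var ''M'') s2 = M \<and>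
          aval (Minus (Var ''M'') (Cell ''wt'' (Var ''k''))) s2 = M - wt I j"
        if "same_off {''prod'', ''m'', ''part'', ''quot''} s' s2" for s2
      proof -
        have "s2 ''W'' 0 = a" "s2 ''M'' 0 = M" "s2 ''wt'' = s ''wt''" "s2 ''k'' 0 = j"
          using that 4(3) a eqs s by (simp_all add: same_off_def)
        then show ?thesis using wt[OF 4(1)] by simp
      qed
      show "5 * a + 8 * (a * M) + 20 \<le> 5 * M + 8 * (M * M) + 20"
        using \<open>a \<le> M\<close> by (intro add_mono mult_le_mono) auto
    qed
    define W where "W = a * M div (M - wt I j)"
    have acc: "acc I (wt I) i (Suc j) =
        (if adj i j then if j \<in> I then 0 else if M < k * W then 0 else W else a)"
      by (simp add: a_def W_def Let_def)
    have kill: "ok (Suc (max 1 1)) (If (Less (Var ''M'') (smult k (Var ''quot'')))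
          (Put ''W'' (N 0)) (Put ''W'' (Var ''quot''))) s2
        (\<lambda>s'. s' ''W'' 0 = (if M < k * W then 0 else W))"
      if "s2 ''quot'' 0 = a * M div (M - wt I j)"
        "same_off (writes (MulDiv (Var ''W'') (Var ''M'') (Minus (Var ''M'') (Cell ''wt'' (Var ''k''))))) s' s2"
      for s2
    proof -
      have "s2 ''quot'' 0 = W" "s2 ''M'' 0 = M"
        using that eqs s by (simp_all add: W_def same_off_def)
      then show ?thesis by (intro ok_intros) (simp_all add: put_def)
    qed
    have live: "ok (Suc (5 * M + 8 * (M * M) + 20 + Suc (max 1 1)))
        (Seq (MulDiv (Var ''W'') (Var ''M'') (Minus (Var ''M'') (Cell ''wt'' (Var ''k''))))
             (If (Less (Var ''M'') (smult k (Var ''quot''))) (Put ''W'' (N 0)) (Put ''W'' (Var ''quot'')))) s'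
        (\<lambda>s'. s' ''W'' 0 = (if M < k * W then 0 else W))"
      by (rule ok_SeqI, rule MD, rule kill, assumption+)
    show ?case
      unfolding acc
      apply (rule ok_le)
       apply (rule ok_If[OF _ ok_SKIP])
        apply (rule ok_If[OF ok_Assign])
      unfolding c1 c2
         apply (simp add: put_def)
        apply (rule ok_weaken[OF live order_refl])
        apply (simp only: if_True if_False)
       apply (simp add: a)
      apply simp
      done
  next
    case (6 s')
    have "wt I i = acc I (wt I) i i" by (rule wt_rec)
    with 6 show ?case by (simp only:)
  qed (use s s1 in \<open>auto simp: put_def same_off_def\<close>)
  show ?thesis
    unfolding Weigh_def weigh_time_def
    apply (rule ok_le)
     apply (rule ok_Seq, rule ok_Assign)
     apply (rule loop)
      apply (use s in \<open>auto simp: put_def same_off_def\<close>)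
    done
qed

definition Draw :: com where
  "Draw = Seq (Put ''u'' (N 0))
     (For ''b'' (Var ''bits'')
        (Seq (Put ''u'' (Plus (Plus (Var ''u'') (Var ''u'')) (Cell ''r'' (Var ''pos''))))
             (Put ''pos'' (Plus (Var ''pos'') (N 1)))))"

lemma writes_Draw [simp]: "writes Draw = {''u'', ''b'', ''pos''}"
  by (auto simp: Draw_def)

lemma ok_Draw:
  assumes s: "s ''bits'' 0 = B" "s ''pos'' 0 = p"
  shows "ok (7 * B + 5) Draw s (\<lambda>s'. s' ''u'' 0 = dec B (\<lambda>b. s ''r'' (p + b)) \<and> s' ''pos'' 0 = p + B)"
proof -
  have loop: "ok (B * (3 + 4) + 3) (For ''b'' (Var ''bits'')
        (Seq (Put ''u'' (Plus (Plus (Var ''u'') (Var ''u'')) (Cell ''r'' (Var ''pos''))))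
             (Put ''pos'' (Plus (Var ''pos'') (N 1)))))
      s1 (\<lambda>s'. s' ''u'' 0 = dec B (\<lambda>b. s ''r'' (p + b)) \<and> s' ''pos'' 0 = p + B)"
    if s1: "same_off {''u'', ''b'', ''pos''} s s1" "s1 ''u'' 0 = 0" "s1 ''pos'' 0 = p" for s1
  proof (rule ok_For[where Inv = "\<lambda>k s'. s' ''u'' 0 = dec k (\<lambda>b. s ''r'' (p + b)) \<and> s' ''pos'' 0 = p + k"],
      goal_cases)
    case (4 k s')
    then have "s' ''r'' = s ''r''" using s1 by (simp add: same_off_def)
    with 4(4) show ?case
      by - (rule ok_le[where t = "Suc (1 + 1)"], (intro ok_intros)?, simp_all add: put_def)
  qed (use s s1 in \<open>auto simp: put_def same_off_def\<close>)
  show ?thesis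
    unfolding Draw_def
    apply (rule ok_le)
     apply (rule ok_Seq, rule ok_Assign)
     apply (rule loop)
       apply (use s in \<open>auto simp: put_def same_off_def\<close>)
    done
qed

text \<open>A negative answer has to be written to \<open>sel\<close> as well, because the entries
  of the previous round are still there.\<close>

definition Visit :: "nat \<Rightarrow> com" where
  "Visit k =
     Seq (Put ''v'' (Cell ''ord'' (Var ''i'')))
    (Seq (Weigh k)
    (Seq (Assign ''wt'' (Var ''i'') (Var ''W''))
    (Seq Draw
         (If (Less (Var ''u'') (Var ''W''))
            (Seq (Assign ''sel'' (Var ''i'') (N 1))
                 (Assign ''out'' (Plus (Var ''base'') (Var ''v'')) (N 1)))
            (Assign ''sel'' (Var ''i'') (N 0))))))"

lemma writes_Visit [simp]:
  "writes (Visit k) = {''v'', ''W'', ''k'', ''prod'', ''m'', ''part'', ''quot'', ''wt'', ''u'', ''b'', ''pos'', ''sel'', ''out''}"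
  by (auto simp: Visit_def)

definition Sample :: "nat \<Rightarrow> com" where
  "Sample k =
     Seq (Put ''base'' (N 0))
    (Seq (Put ''pos'' (N 0))
         (For ''j'' (Var ''q'')
            (Seq (For ''i'' (Var ''n'') (Visit k))
                 (Put ''base'' (Plus (Var ''base'') (Var ''n''))))))"

definition visit_time :: "nat \<Rightarrow> nat \<Rightarrow> nat \<Rightarrow> nat" where
  "visit_time n M B = n * weigh_time M + 7 * B + 30"

definition sample_time :: "nat \<Rightarrow> nat \<Rightarrow> nat \<Rightarrow> nat \<Rightarrow> nat" where
  "sample_time q n M B = q * (n * (visit_time n M B + 4) + 10) + 10"

context weighting
begin

text \<open>\<open>prev\<close> describes the output cells set by earlier rounds: \<open>out\<close>
  is never cleared, so the invariant must carry them along.\<close>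

lemma ok_Visit:
  fixes s :: store and u :: "nat \<Rightarrow> nat"
  assumes s: "s ''i'' 0 = i" "i < n" "s ''M'' 0 = M" "s ''W0'' 0 = W0" "s ''bits'' 0 = B"
      "s ''base'' 0 = base" "s ''pos'' 0 = p" "\<forall>i<n. s ''rn'' i = i * n"
    and od: "\<forall>j\<le>i. s ''ord'' j < n"
    and adj: "\<And>j. j < i \<Longrightarrow> adj i j \<longleftrightarrow> 0 < s ''adj'' (s ''ord'' i * n + s ''ord'' j)"
    and sel: "\<And>j. j < i \<Longrightarrow> s ''sel'' j = of_bool (j \<in> sel u i)"
    and wt: "\<And>j. j < i \<Longrightarrow> s ''wt'' j = wt (sel u i) j"
    and u: "u i = dec B (\<lambda>b. s ''r'' (p + b))"
    and out: "\<And>x. s ''out'' x = of_bool (prev x \<or> (\<exists>j\<in>sel u i. x = base + s ''ord'' j))"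
  shows "ok (visit_time n M B) (Visit k) s (\<lambda>s'.
     (\<forall>j<Suc i. s' ''sel'' j = of_bool (j \<in> sel u (Suc i))) \<and>
     (\<forall>j<Suc i. s' ''wt'' j = wt (sel u (Suc i)) j) \<and>
     s' ''pos'' 0 = p + B \<and>
     (\<forall>x. s' ''out'' x = of_bool (prev x \<or> (\<exists>j\<in>sel u (Suc i). x = base + s ''ord'' j))))"
proof -
  let ?I = "sel u i"
  have I: "?I \<subseteq> {..<i}" using reachable_sel[of i u] by (simp add: reachable_def)
  have wt_ins: "wt (insert i ?I) j = wt ?I j" if "j \<le> i" for j
    using that by (intro wt_cong) auto
  define s1 where "s1 = put ''v'' 0 (s ''ord'' i) s"
  have s1: "s1 ''v'' 0 = s ''ord'' i" "same_off {''v''} s s1"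
    by (simp_all add: s1_def put_def same_off_def)
  have w: "ok (i * weigh_time M + 5) (Weigh k) s1 (\<lambda>s'. s' ''W'' 0 = wt ?I i)"
    by (rule ok_Weigh[where n = n]) (use s od adj sel wt in \<open>simp_all add: s1_def put_def\<close>)
  show ?thesis
    unfolding Visit_def visit_time_def
  proof (rule ok_le, rule ok_Seq, rule ok_Assign, rule ok_SeqI)
    show "ok (i * weigh_time M + 5) (Weigh k) (put ''v'' (aval (N 0) s) (aval (Cell ''ord'' (Var ''i'')) s) s)
        (\<lambda>s'. s' ''W'' 0 = wt ?I i)"
      using w s by (simp add: s1_def)
  next
    fix s2 assume s2: "s2 ''W'' 0 = wt ?I i"
      and "same_off (writes (Weigh k)) (put ''v'' (aval (N 0) s) (aval (Cell ''ord'' (Var ''i'')) s) s) s2"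
    then have S2: "same_off {''W'', ''k'', ''prod'', ''m'', ''part'', ''quot''} s1 s2"
      using s by (simp add: s1_def)
    define s3 where "s3 = put ''wt'' i (wt ?I i) s2"
    have s3: "s3 ''W'' 0 = wt ?I i" "s3 ''wt'' = (s ''wt'')(i := wt ?I i)" "s3 ''bits'' 0 = B"
        "s3 ''pos'' 0 = p" "s3 ''r'' = s ''r''" "s3 ''i'' 0 = i" "s3 ''base'' 0 = base"
        "s3 ''v'' 0 = s ''ord'' i" "s3 ''sel'' = s ''sel''" "s3 ''out'' = s ''out''"
      using S2 s2 s by (auto simp: s3_def put_def same_off_def s1_def)
    have s3_eq: "put ''wt'' (aval (Var ''i'') s2) (aval (Var ''W'') s2) s2 = s3"
      using S2 s2 s by (simp add: s3_def put_def same_off_def s1_def)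
    show "ok (Suc (1 + Suc (7 * B + 5 + Suc (max (Suc (1 + 1)) 1))))
        (Seq (Assign ''wt'' (Var ''i'') (Var ''W''))
        (Seq Draw (If (Less (Var ''u'') (Var ''W''))
            (Seq (Assign ''sel'' (Var ''i'') (N 1))
                 (Assign ''out'' (Plus (Var ''base'') (Var ''v'')) (N 1)))
            (Assign ''sel'' (Var ''i'') (N 0))))) s2
        (\<lambda>s'. (\<forall>j<Suc i. s' ''sel'' j = of_bool (j \<in> sel u (Suc i))) \<and>
         (\<forall>j<Suc i. s' ''wt'' j = wt (sel u (Suc i)) j) \<and>
         s' ''pos'' 0 = p + B \<and>
         (\<forall>x. s' ''out'' x = of_bool (prev x \<or> (\<exists>j\<in>sel u (Suc i). x = base + s ''ord'' j))))"
    proof (rule ok_Seq, rule ok_Assign, unfold s3_eq, rule ok_SeqI, rule ok_Draw[where s = s3 and B = B and p = p, OF s3(3,4)], elim conjE)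
      fix s4 assume "s4 ''u'' 0 = dec B (\<lambda>b. s3 ''r'' (p + b))" and pos: "s4 ''pos'' 0 = p + B"
        and S4: "same_off (writes Draw) s3 s4"
      then have u4: "s4 ''u'' 0 = u i" using s3(5) u by simp
      have s4: "s4 ''W'' 0 = wt ?I i" "s4 ''wt'' = (s ''wt'')(i := wt ?I i)" "s4 ''i'' 0 = i"
        "s4 ''base'' 0 = base" "s4 ''v'' 0 = s ''ord'' i" "s4 ''sel'' = s ''sel''" "s4 ''out'' = s ''out''"
        using S4 s3 by (simp_all add: same_off_def)
      show "ok (Suc (max (Suc (1 + 1)) 1)) (If (Less (Var ''u'') (Var ''W''))
            (Seq (Assign ''sel'' (Var ''i'') (N 1))
                 (Assign ''out'' (Plus (Var ''base'') (Var ''v'')) (N 1)))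
            (Assign ''sel'' (Var ''i'') (N 0))) s4
        (\<lambda>s'. (\<forall>j<Suc i. s' ''sel'' j = of_bool (j \<in> sel u (Suc i))) \<and>
         (\<forall>j<Suc i. s' ''wt'' j = wt (sel u (Suc i)) j) \<and>
         s' ''pos'' 0 = p + B \<and>
         (\<forall>x. s' ''out'' x = of_bool (prev x \<or> (\<exists>j\<in>sel u (Suc i). x = base + s ''ord'' j))))"
      proof (cases "u i < wt ?I i")
        case True
        then have "sel u (Suc i) = insert i ?I" by simp
        with True show ?thesis
          using s4 u4 pos sel wt out wt_ins
          by (intro ok_intros) (auto simp: put_def less_Suc_eq simp del: sel.simps)
      next
        case False
        then have "sel u (Suc i) = ?I" by simp
        with False show ?thesis
          using s4 u4 pos sel wt out I
          by (intro ok_intros) (auto simp: put_def less_Suc_eq simp del: sel.simps)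
      qed
    qed
  next
    have "Suc (1 + Suc (x + 5 + Suc (1 + Suc (7 * B + 5 + Suc (max (Suc (1 + 1)) 1))))) \<le> y + 7 * B + 30"
      if "x \<le> y" for x y :: nat
      using that by simp
    from this[of "i * weigh_time M" "n * weigh_time M"]
    show "Suc (1 + Suc (i * weigh_time M + 5 +
        Suc (1 + Suc (7 * B + 5 + Suc (max (Suc (1 + 1)) 1))))) \<le> n * weigh_time M + 7 * B + 30"
      using s(2) mult_le_mono1[of i n "weigh_time M"] by (simp only: less_imp_le simp_thms)
  qed
qed

lemma ok_Sample:
  assumes s: "s ''n'' 0 = n" "s ''q'' 0 = q" "s ''M'' 0 = M" "s ''W0'' 0 = W0" "s ''bits'' 0 = B"
      "\<forall>i<n. s ''rn'' i = i * n" "s ''out'' = (\<lambda>_. 0)"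
    and od: "\<forall>i<n. s ''ord'' i < n"
    and adj: "\<And>i j. i < n \<Longrightarrow> j < i \<Longrightarrow> adj i j \<longleftrightarrow> 0 < s ''adj'' (s ''ord'' i * n + s ''ord'' j)"
  shows "ok (sample_time q n M B) (Sample k) s
     (\<lambda>s'. \<forall>x. s' ''out'' x = of_bool (\<exists>j<q. \<exists>i\<in>round_set n B (s ''r'') j. x = j * n + s ''ord'' i))"
proof -
  let ?X = "{''i'', ''v'', ''W'', ''k'', ''prod'', ''m'', ''part'', ''quot'', ''wt'', ''u'', ''b'', ''pos'', ''sel'', ''out''}"
  let ?Y = "insert ''j'' (insert ''base'' ?X)"
  define prev where "prev j x \<longleftrightarrow> (\<exists>j'<j. \<exists>i\<in>round_set n B (s ''r'') j'. x = j' * n + s ''ord'' i)" for j x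
  define u where "u j i = dec B (\<lambda>b. s ''r'' ((j * n + i) * B + b))" for j i
  have rs: "round_set n B (s ''r'') j = sel (u j) n" for j
    by (simp add: round_set_def u_def[abs_def])
  have inner: "ok (n * (visit_time n M B + 4) + 3) (For ''i'' (Var ''n'') (Visit k)) s1
      (\<lambda>s'. s' ''pos'' 0 = Suc j * n * B \<and> (\<forall>x. s' ''out'' x = of_bool (prev (Suc j) x)))"
    if s1: "same_off ?Y s s1" "s1 ''base'' 0 = j * n" "s1 ''pos'' 0 = j * n * B"
      "\<forall>x. s1 ''out'' x = of_bool (prev j x)" for s1 j
  proof (rule ok_For[where Inv = "\<lambda>i s'. (\<forall>l<i. s' ''sel'' l = of_bool (l \<in> sel (u j) i)) \<and>
      (\<forall>l<i. s' ''wt'' l = wt (sel (u j) i) l) \<and> s' ''pos'' 0 = (j * n + i) * B \<and>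
      (\<forall>x. s' ''out'' x = of_bool (prev j x \<or> (\<exists>l\<in>sel (u j) i. x = j * n + s ''ord'' l)))"], goal_cases)
    case (4 i s')
    then have "same_off ?X s1 s'" by simp
    with s1 s have s': "s' ''M'' 0 = M" "s' ''W0'' 0 = W0" "s' ''bits'' 0 = B" "s' ''base'' 0 = j * n"
        "s' ''rn'' = s ''rn''" "s' ''ord'' = s ''ord''" "s' ''adj'' = s ''adj''" "s' ''r'' = s ''r''"
      by (simp_all add: same_off_def)
    have "ok (visit_time n M B) (Visit k) s' (\<lambda>s''.
     (\<forall>l<Suc i. s'' ''sel'' l = of_bool (l \<in> sel (u j) (Suc i))) \<and>
     (\<forall>l<Suc i. s'' ''wt'' l = wt (sel (u j) (Suc i)) l) \<and>
     s'' ''pos'' 0 = (j * n + i) * B + B \<and>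
     (\<forall>x. s'' ''out'' x = of_bool (prev j x \<or> (\<exists>l\<in>sel (u j) (Suc i). x = j * n + s' ''ord'' l))))"
      by (rule ok_Visit) (use 4(1,3,4) s' s od adj in \<open>simp_all add: u_def\<close>)
    then show ?case
      by (rule ok_weaken) (simp_all add: s' add.commute del: sel.simps)
  next
    case (6 s')
    then have "s' ''pos'' 0 = Suc j * n * B" by (simp add: add.commute)
    moreover have "prev (Suc j) x \<longleftrightarrow> prev j x \<or> (\<exists>l\<in>sel (u j) n. x = j * n + s ''ord'' l)" for x
      by (auto simp: prev_def less_Suc_eq rs)
    ultimately show ?case using 6 by simp
  qed (use s s1 in \<open>auto simp: put_def same_off_def\<close>)
  have outer: "ok (q * (n * (visit_time n M B + 4) + 5 + 4) + 3) (For ''j'' (Var ''q'')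
            (Seq (For ''i'' (Var ''n'') (Visit k))
                 (Put ''base'' (Plus (Var ''base'') (Var ''n''))))) s1
      (\<lambda>s'. \<forall>x. s' ''out'' x = of_bool (prev q x))"
    if s1: "same_off ?Y s s1" "s1 ''base'' 0 = 0" "s1 ''pos'' 0 = 0" "s1 ''out'' = (\<lambda>_. 0)" for s1
  proof (rule ok_For[where Inv = "\<lambda>j s'. s' ''base'' 0 = j * n \<and> s' ''pos'' 0 = j * n * B \<and>
      (\<forall>x. s' ''out'' x = of_bool (prev j x))"], goal_cases)
    case (4 j s')
    then have S: "same_off ?Y s s'" by (auto intro: same_off_trans'[OF s1(1)])
    show ?case
    proof (rule ok_le[where t = "Suc (n * (visit_time n M B + 4) + 3 + 1)"], rule ok_SeqI,
        rule inner[OF S, of j], goal_cases)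
      case (4 s2)
      then have "s2 ''base'' 0 = j * n" "s2 ''n'' 0 = n"
        using \<open>_ \<and> _ \<and> _\<close> S s by (simp_all add: same_off_def)
      with 4(1) show ?case by (intro ok_Assign) (simp add: put_def)
    qed (use 4(4) in auto)
  next
    case 2
    then show ?case using s1 by (simp add: prev_def)
  qed (use s s1 in \<open>auto simp: put_def same_off_def\<close>)
  show ?thesis
    unfolding Sample_def sample_time_def prev_def[symmetric]
    apply (rule ok_le)
     apply (rule ok_Seq, rule ok_Assign)
     apply (rule ok_Seq, rule ok_Assign)
     apply (rule outer)
        apply (use s in \<open>auto simp: put_def same_off_def\<close>)[4]
    apply (simp add: algebra_simps)
    done
qed

end

definition Flips :: com where
  "Flips = For ''i'' (Var ''len'') (Flip ''r'' (Var ''i''))"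

text \<open>Each iteration takes 5 steps whatever the coin shows. All branches therefore stay in
  lockstep, and the run is the exact image of \<open>coins\<close>.\<close>

lemma run_Flips_loop:
  assumes "s ''i'' 0 = k" "s ''len'' 0 = k + m" "s ''r'' = g"
  shows "run (5 * m + 1)
      (While (Less (Var ''i'') (Var ''len'')) (Seq (Flip ''r'' (Var ''i'')) (Put ''i'' (Plus (Var ''i'') (N 1))))) s =
    map_pmf (\<lambda>h. (SKIP, put ''i'' 0 (k + m) (s(''r'' := h)))) (coins k m g)"
  using assms
proof (induction m arbitrary: s k g)
  case 0
  then have "put ''i'' 0 (k + 0) (s(''r'' := g)) = s" by (auto simp: put_def fun_eq_iff)
  then show ?case unfolding coins.simps map_return_pmf using 0 by (simp add: bind_return_pmf)
next
  case (Suc m)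
  let ?W = "While (Less (Var ''i'') (Var ''len'')) (Seq (Flip ''r'' (Var ''i'')) (Put ''i'' (Plus (Var ''i'') (N 1))))"
  let ?B = "bernoulli_pmf (1 / 2)"
  define S where "S b = put ''i'' 0 (Suc k) (put ''r'' k (of_bool b) s)" for b
  have "run 5 ?W s = map_pmf (\<lambda>b. (?W, S b)) ?B"
    using Suc.prems
    by (simp add: eval_nat_numeral bind_return_pmf bind_map_pmf map_pmf_def bind_assoc_pmf put_def S_def)
  then have "run (5 + (5 * m + 1)) ?W s = bind_pmf ?B (\<lambda>b. run (5 * m + 1) ?W (S b))"
    unfolding run_add by (simp only: bind_map_pmf split_conv)
  also have "\<dots> = bind_pmf ?B (\<lambda>b. map_pmf (\<lambda>h. (SKIP, put ''i'' 0 (Suc k + m) ((S b)(''r'' := h))))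
      (coins (Suc k) m (g(k := of_bool b))))"
    by (intro bind_pmf_cong refl Suc.IH) (use Suc.prems in \<open>simp_all add: S_def put_def\<close>)
  also have "\<dots> = bind_pmf ?B (\<lambda>b. map_pmf (\<lambda>h. (SKIP, put ''i'' 0 (k + Suc m) (s(''r'' := h))))
      (coins (Suc k) m (g(k := of_bool b))))"
  proof -
    have "put ''i'' 0 (Suc k + m) ((S b)(''r'' := h)) = put ''i'' 0 (k + Suc m) (s(''r'' := h))" for b h
      by (auto simp: S_def put_def fun_eq_iff)
    then show ?thesis by simp
  qed
  also have "\<dots> = map_pmf (\<lambda>h. (SKIP, put ''i'' 0 (k + Suc m) (s(''r'' := h)))) (coins k (Suc m) g)"
    by (simp add: map_bind_pmf)
  finally show ?case by (simp only: mult_Suc_right add.assoc)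
qed

lemma run_Flips:
  assumes "s ''len'' 0 = m" "s ''r'' = (\<lambda>_. 0)"
  shows "run (5 * m + 3) Flips s =
    map_pmf (\<lambda>h. (SKIP, put ''i'' 0 m (s(''r'' := h)))) (coins 0 m (\<lambda>_. 0))"
proof -
  let ?W = "While (Less (Var ''i'') (Var ''len'')) (Seq (Flip ''r'' (Var ''i'')) (Put ''i'' (Plus (Var ''i'') (N 1))))"
  have "run 2 Flips s = return_pmf (?W, put ''i'' 0 0 s)"
    by (simp add: Flips_def For_def numeral_2_eq_2 bind_return_pmf)
  then have "run (2 + (5 * m + 1)) Flips s = run (5 * m + 1) ?W (put ''i'' 0 0 s)"
    unfolding run_add by (simp only: bind_return_pmf split_conv)
  also have "\<dots> = map_pmf (\<lambda>h. (SKIP, put ''i'' 0 (0 + m) ((put ''i'' 0 0 s)(''r'' := h)))) (coins 0 m (\<lambda>_. 0))"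
    by (rule run_Flips_loop) (use assms in \<open>simp_all add: put_def\<close>)
  also have "(\<lambda>h. (SKIP, put ''i'' 0 (0 + m) ((put ''i'' 0 0 s)(''r'' := h)))) =
      (\<lambda>h. (SKIP, put ''i'' 0 m (s(''r'' := h))))"
    by (auto simp: put_def fun_eq_iff)
  moreover have "2 + (5 * m + 1) = 5 * m + 3" by simp
  ultimately show ?thesis by (simp only:)
qed

text \<open>The interface between deterministic and random reasoning. \<open>s1\<close> is a single
  store, independent of the tape \<open>h\<close>, and everything after the flips is a function of
  \<open>h\<close>; so the final distribution is an image of \<open>coins\<close>.\<close>

lemma run_around_Flips:
  assumes c1: "ok t1 c1 s (\<lambda>s'. s' ''len'' 0 = m \<and> s' ''r'' = (\<lambda>_. 0) \<and> R s')"
    and c2: "\<And>s' h. s' ''len'' 0 = m \<Longrightarrow> R s' \<Longrightarrow> ok t2 c2 (put ''i'' 0 m (s'(''r'' := h))) (P s' h)"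
  obtains s1 f where "R s1" "\<And>h. P s1 h (f h)"
    "run (Suc (t1 + Suc (5 * m + 3 + t2))) (Seq c1 (Seq Flips c2)) s =
      map_pmf (\<lambda>h. (SKIP, f h)) (coins 0 m (\<lambda>_. 0))"
proof -
  from c1 obtain s1 where s1: "halts_within t1 c1 s" "final t1 c1 s = return_pmf s1"
      "s1 ''len'' 0 = m" "s1 ''r'' = (\<lambda>_. 0)" "R s1"
    by (elim okE) auto
  have "\<exists>s2. run t2 c2 (put ''i'' 0 m (s1(''r'' := h))) = return_pmf (SKIP, s2) \<and> P s1 h s2" for h
    using c2[OF s1(3,5)] by (simp add: ok_def)
  then obtain f where f: "run t2 c2 (put ''i'' 0 m (s1(''r'' := h))) = return_pmf (SKIP, f h)" "P s1 h (f h)"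
    for h by metis
  note flips = run_Flips[OF s1(3,4)]
  have halt: "halts_within (5 * m + 3) Flips s1" by (auto simp: halts_within_def flips)
  have fin: "final (5 * m + 3) Flips s1 = map_pmf (\<lambda>h. put ''i'' 0 m (s1(''r'' := h))) (coins 0 m (\<lambda>_. 0))"
    by (simp add: final_def flips map_pmf_comp)
  have "halts_within t2 c2 s2" if "s2 \<in> set_pmf (final (5 * m + 3) Flips s1)" for s2
    using that by (auto simp: fin halts_within_def f(1))
  note * = halt this
  have "run (Suc (t1 + Suc (5 * m + 3 + t2))) (Seq c1 (Seq Flips c2)) s =
      bind_pmf (final t1 c1 s) (run (Suc (5 * m + 3 + t2)) (Seq Flips c2))"
    by (rule run_Seq[OF s1(1)]) (simp only: s1(2) set_return_pmf singleton_iff halts_within_Seq[OF *])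
  also have "\<dots> = bind_pmf (final (5 * m + 3) Flips s1) (run t2 c2)"
    by (simp only: s1(2) bind_return_pmf run_Seq[OF *])
  also have "\<dots> = map_pmf (\<lambda>h. (SKIP, f h)) (coins 0 m (\<lambda>_. 0))"
    unfolding fin bind_map_pmf f(1) by (simp only: map_pmf_def)
  finally show ?thesis by (intro that[of s1 f] s1(5) f(2))
qed

section \<open>From positions back to the vertices of the graph\<close>

definition vertex_adj :: "'a list \<Rightarrow> 'a set set \<Rightarrow> (nat \<Rightarrow> nat) \<Rightarrow> nat \<Rightarrow> nat \<Rightarrow> bool" where
  "vertex_adj vs E od i j \<longleftrightarrow> i < length vs \<and> j < length vs \<and> {vs ! od i, vs ! od j} \<in> E"

text \<open>The member of \<open>R\<close> that comes last in a degeneracy ordering has all its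
  neighbours in \<open>R\<close> before it. So removing vertices of low degree greedily never gets
  stuck.\<close>

lemma degenerate_subset:
  assumes "degenerate d V E" "distinct vs" "set vs = V" "R \<subseteq> {..<length vs}" "R \<noteq> {}"
  shows "\<exists>v\<in>R. card {c. c < length vs \<and> c \<in> R \<and> {vs ! v, vs ! c} \<in> E} \<le> d"
proof -
  obtain ws where ws: "distinct ws" "set ws = V"
    "\<And>i. i < length ws \<Longrightarrow> card {u \<in> set (take (Suc i) ws). {u, ws ! i} \<in> E} \<le> d"
    using assms(1) by (auto simp: degenerate_def)
  have "\<exists>p. p < length ws \<and> ws ! p = vs ! i" if "i \<in> R" for i
  proof -
    have "vs ! i \<in> set ws" using that assms(3,4) ws(2) nth_mem by blast
    then show ?thesis by (auto simp: in_set_conv_nth)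
  qed
  then obtain p where p: "\<And>i. i \<in> R \<Longrightarrow> p i < length ws" "\<And>i. i \<in> R \<Longrightarrow> ws ! p i = vs ! i"
    by metis
  have fin: "finite R" using assms(4) finite_subset by blast
  then have "Max (p ` R) \<in> p ` R" using assms(5) by (intro Max_in) auto
  then obtain v where v: "v \<in> R" "p v = Max (p ` R)" by auto
  have max: "p c \<le> p v" if "c \<in> R" for c using that fin v(2) by simp
  let ?C = "{c. c < length vs \<and> c \<in> R \<and> {vs ! v, vs ! c} \<in> E}"
  have "card ?C = card ((!) vs ` ?C)"
    using assms(2) by (intro card_image[symmetric] inj_onI) (auto simp: nth_eq_iff_index_eq)
  also have "\<dots> \<le> card {u \<in> set (take (Suc (p v)) ws). {u, ws ! p v} \<in> E}"
  proof (intro card_mono subsetI)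
    fix u assume "u \<in> (!) vs ` ?C"
    then obtain c where c: "u = vs ! c" "c \<in> R" "{vs ! v, vs ! c} \<in> E" by auto
    have "take (Suc (p v)) ws ! p c = u" using max[OF c(2)] p(2)[OF c(2)] c(1) by simp
    moreover have "p c < length (take (Suc (p v)) ws)" using max[OF c(2)] p(1)[OF c(2)] by simp
    ultimately have "u \<in> set (take (Suc (p v)) ws)" by (metis nth_mem)
    with c p(2)[OF v(1)] show "u \<in> {u \<in> set (take (Suc (p v)) ws). {u, ws ! p v} \<in> E}"
      by (simp add: insert_commute)
  qed simp
  also have "\<dots> \<le> d" using ws(3) p(1)[OF v(1)] .
  finally show ?thesis using v(1) by blast
qed

lemma input_store_adj:
  assumes "i < length vs" "j < length vs"
  shows "input_store vs E d ''adj'' (i * length vs + j) = of_bool ({vs ! i, vs ! j} \<in> E)"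
proof -
  have "i * length vs + j < Suc i * length vs" using assms by simp
  also have "\<dots> \<le> length vs * length vs" using assms by (intro mult_le_mono1) auto
  finally have "i * length vs + j < length vs * length vs" .
  moreover have "vs \<noteq> []" using assms by auto
  then have "(i * length vs + j) div length vs = i" "(i * length vs + j) mod length vs = j"
    using assms by simp_all
  ultimately show ?thesis unfolding input_store_def Let_def by simp
qed

lemma simple_graph_no_loop: "simple_graph V E \<Longrightarrow> {x} \<notin> E"
  by (fastforce simp: simple_graph_def)

text \<open>A vertex has three names: its position \<open>i\<close> in the elimination order, its
  index \<open>od i\<close> in the input listing, and itself, \<open>vs ! od i\<close>.\<close>

locale ordered_graph = greedy "vertex_adj vs E od" M k W0 n d
  for V :: "'a set" and E and vs :: "'a list" and od and M k W0 n d :: nat +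
  assumes graph: "simple_graph V E" and vs: "distinct vs" "set vs = V" "length vs = n"
    and od: "bij_betw od {..<n} {..<n}"
begin

definition vertices :: "nat set \<Rightarrow> 'a set" where
  "vertices I = (\<lambda>i. vs ! od i) ` I"

lemma inj_on_vertex: "inj_on (\<lambda>i. vs ! od i) {..<n}"
proof (rule inj_onI)
  fix i j assume ij: "i \<in> {..<n}" "j \<in> {..<n}" and eq: "vs ! od i = vs ! od j"
  have "od i < length vs" "od j < length vs" using ij od vs(3) by (auto simp: bij_betw_def)
  with eq vs(1) have "od i = od j" by (simp add: nth_eq_iff_index_eq)
  with od ij show "i = j" unfolding bij_betw_def by (blast dest: inj_onD)
qed

lemma vertex_exists: "x \<in> V \<Longrightarrow> \<exists>i<n. x = vs ! od i"
  using vs od by (metis bij_betw_def imageE in_set_conv_nth lessThan_iff)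

lemma vertex_in_V: "i < n \<Longrightarrow> vs ! od i \<in> V"
  using vs od bij_betwE nth_mem by fastforce

lemma vertex_in_vertices: "i < n \<Longrightarrow> I \<subseteq> {..<n} \<Longrightarrow> vs ! od i \<in> vertices I \<longleftrightarrow> i \<in> I"
  using inj_on_vertex unfolding vertices_def by (auto dest: inj_onD)

lemma vertices_independent:
  assumes "reachable n I"
  shows "vertices I \<in> indep_sets V E"
proof -
  have I: "I \<subseteq> {..<n}" using assms by (simp add: reachable_def)
  have less: "{vs ! od i, vs ! od j} \<notin> E" if ij: "i \<in> I" "j \<in> I" "j < i" for i j
  proof
    assume e: "{vs ! od i, vs ! od j} \<in> E"
    then have "j \<in> left i" using ij I vs(3) by (auto simp: left_def vertex_adj_def)
    with assms ij show False by (blast dest: reachable_independent)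
  qed
  have "{vs ! od i, vs ! od j} \<notin> E" if "i \<in> I" "j \<in> I" for i j
    using less[of i j] less[of j i] that simple_graph_no_loop[OF graph]
    by (cases i j rule: linorder_cases) (auto simp: insert_commute)
  with I vertex_in_V show ?thesis by (auto simp: indep_sets_def vertices_def)
qed

lemma finite_indep_sets: "finite (indep_sets V E)"
proof (rule finite_subset)
  show "finite (Pow V)" using graph unfolding simple_graph_def by blast
qed (auto simp: indep_sets_def)

text \<open>The distribution of the selected set, scaled by \<open>1 / \<beta>\<close>, is a
  fractional cover: a vertex receives its selection probability divided by \<beta>, which is at
  least 1, and the total weight is \<open>1 / \<beta>\<close>.\<close>

lemma fractional_chromatic_number_le:
  assumes \<beta>: "0 < \<beta>" "\<And>v. v < n \<Longrightarrow> \<beta> \<le> expect v (\<lambda>I. prb I v)"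
  shows "fractional_chromatic_number V E \<le> 1 / \<beta>"
proof -
  define x where "x S = 1 / \<beta> * expect n (\<lambda>I. of_bool (vertices I = S))" for S
  have sum: "(\<Sum>S\<in>A. x S) = 1 / \<beta> * expect n (\<lambda>I. of_bool (vertices I \<in> A))" if "finite A" for A
  proof -
    have "(\<Sum>S\<in>A. x S) = 1 / \<beta> * expect n (\<lambda>I. \<Sum>S\<in>A. of_bool (vertices I = S))"
      unfolding x_def by (simp only: sum_distrib_left expect_sum[OF that])
    also have "(\<lambda>I. \<Sum>S\<in>A. of_bool (vertices I = S) :: real) = (\<lambda>I. of_bool (vertices I \<in> A))"
      using that by (simp add: of_bool_def)
    finally show ?thesis .
  qed
  have "fractional_cover V E x"
    unfolding fractional_cover_def
  proof (intro conjI ballI)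
    show "0 \<le> x S" for S
      unfolding x_def using \<beta> by (intro mult_nonneg_nonneg expect_nonneg) auto
    fix y assume "y \<in> V"
    then obtain i where i: "i < n" "y = vs ! od i" using vertex_exists by blast
    have "(\<Sum>S | S \<in> indep_sets V E \<and> y \<in> S. x S) =
        1 / \<beta> * expect n (\<lambda>I. of_bool (vertices I \<in> {S. S \<in> indep_sets V E \<and> y \<in> S}))"
      using finite_indep_sets by (intro sum) simp
    also have "expect n (\<lambda>I. of_bool (vertices I \<in> {S. S \<in> indep_sets V E \<and> y \<in> S})) =
        expect n (\<lambda>I. of_bool (i \<in> I))"
      using vertices_independent vertex_in_vertices[OF i(1)] i(2)
      by (intro expect_cong) (auto simp: reachable_def)
    also have "\<dots> = expect i (\<lambda>I. prb I i)" using i(1) by (rule expect_member)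
    finally show "1 \<le> (\<Sum>S | S \<in> indep_sets V E \<and> y \<in> S. x S)"
      using \<beta>(2)[OF i(1)] \<beta>(1) by simp
  qed
  moreover have "(\<Sum>S\<in>indep_sets V E. x S) = 1 / \<beta>"
  proof -
    have "expect n (\<lambda>I. of_bool (vertices I \<in> indep_sets V E)) = expect n (\<lambda>_. 1)"
      using vertices_independent by (intro expect_cong) auto
    then show ?thesis using sum[OF finite_indep_sets] by simp
  qed
  ultimately have "1 / \<beta> \<in> {\<Sum>S\<in>indep_sets V E. x S | x. fractional_cover V E x}"
    unfolding mem_Collect_eq by metis
  moreover have "bdd_below {\<Sum>S\<in>indep_sets V E. x S | x. fractional_cover V E x}"
    by (intro bdd_belowI[of _ 0]) (auto simp: fractional_cover_def intro!: sum_nonneg)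
  ultimately show ?thesis
    unfolding fractional_chromatic_number_def by (intro cInf_lower)
qed

lemma output_is_coloring:
  assumes q: "s ''q'' 0 = q"
    and out: "\<And>x. s ''out'' x = of_bool (\<exists>j<q. \<exists>i\<in>round_set n B g j. x = j * n + od i)"
    and many: "\<And>v. v < n \<Longrightarrow> \<alpha> * real q \<le> real (card {j. j < q \<and> v \<in> round_set n B g j})"
  shows "is_coloring V E \<alpha> q (output_sets vs s)"
proof -
  have R: "reachable n (round_set n B g j)" for j by (simp add: round_set_def reachable_sel)
  then have sub: "round_set n B g j \<subseteq> {..<n}" for j by (simp add: reachable_def)
  have odn: "od i < n" if "i < n" for i using od that by (auto simp: bij_betw_def)
  have "{vs ! x | x. x < length vs \<and> s ''out'' (j * length vs + x) = 1} = vertices (round_set n B g j)"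
    if j: "j < q" for j
  proof -
    have "s ''out'' (j * n + x) = 1 \<longleftrightarrow> x \<in> od ` round_set n B g j" if x: "x < n" for x
    proof -
      have "j * n + x = j' * n + od i \<longleftrightarrow> j = j' \<and> x = od i" if "i \<in> round_set n B g j'" for j' i
      proof
        assume eq: "j * n + x = j' * n + od i"
        have i: "od i < n" using that sub odn by blast
        have "(j * n + x) div n = j" "(j * n + x) mod n = x" using x by simp_all
        moreover have "(j' * n + od i) div n = j'" "(j' * n + od i) mod n = od i" using i by simp_all
        ultimately show "j = j' \<and> x = od i" using eq by simp
      qed simp
      then show ?thesis using j by (auto simp: out)
    qed
    then have "{vs ! x | x. x < length vs \<and> s ''out'' (j * length vs + x) = 1} =
        (!) vs ` {x. x < n \<and> x \<in> od ` round_set n B g j}"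
      using vs(3) by auto
    also have "{x. x < n \<and> x \<in> od ` round_set n B g j} = od ` round_set n B g j"
      using sub odn by blast
    finally show ?thesis by (simp add: vertices_def image_image)
  qed
  then have os: "output_sets vs s = map (\<lambda>j. vertices (round_set n B g j)) [0..<q]"
    by (simp add: output_sets_def q)
  show ?thesis
    unfolding is_coloring_def
  proof (intro conjI ballI)
    show "length (output_sets vs s) = q" by (simp add: os)
    show "set (output_sets vs s) \<subseteq> indep_sets V E" using R vertices_independent by (auto simp: os)
    fix y assume "y \<in> V"
    then obtain v where v: "v < n" "y = vs ! od v" using vertex_exists by blast
    have "length (filter (\<lambda>I. y \<in> I) (output_sets vs s)) = card {j. j < q \<and> v \<in> round_set n B g j}"
      unfolding os length_filter_conv_card v(2)
      by (intro arg_cong[where f = card] Collect_cong)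
         (simp add: vertex_in_vertices[OF v(1) sub] cong: conj_cong)
    with many[OF v(1)] show "\<alpha> * real q \<le> real (length (filter (\<lambda>I. y \<in> I) (output_sets vs s)))"
      by simp
  qed
qed

end

lemma ordered_graphI:
  assumes g: "simple_graph V E" "C4_free V E" "distinct vs" "set vs = V" "length vs = n"
    and od: "bij_betw od {..<n} {..<n}"
    and deg: "\<And>i. i < n \<Longrightarrow> card {j. j < i \<and> {vs ! od i, vs ! od j} \<in> E} \<le> d"
    and W: "2 \<le> k" "k * W0 \<le> M" "0 < W0" "2 * d \<le> W0"
  shows "ordered_graph V E vs od M k W0 n d"
proof -
  have M: "0 < M" using W by (metis gr0I leD le_0_eq mult_is_0 not_numeral_le_zero)
  interpret weighting "vertex_adj vs E od" M k W0 using W M by unfold_locales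
  have odn: "od i < n" if "i < n" for i using od that by (auto simp: bij_betw_def)
  show ?thesis
  proof (unfold_locales, goal_cases)
    case (1 i j)
    then show ?case by (auto simp: vertex_adj_def insert_commute)
  next
    case (2 i)
    have "left i = {j. j < i \<and> {vs ! od i, vs ! od j} \<in> E}"
      using 2 g(5) by (auto simp: left_def vertex_adj_def)
    with deg[OF 2] show ?case by simp
  next
    case (3 w x y z)
    have inj: "vs ! od i = vs ! od j \<longleftrightarrow> i = j" if "i < n" "j < n" for i j
      using g(3,5) od odn[OF that(1)] odn[OF that(2)] that
      by (auto simp: nth_eq_iff_index_eq bij_betw_def dest: inj_onD)
    have "distinct [vs ! od w, vs ! od x, vs ! od y, vs ! od z]" using 3 by (simp add: inj)
    moreover have inV: "vs ! od i \<in> V" if "i < n" for i using odn[OF that] g(4,5) nth_mem by blast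
    then have "vs ! od w \<in> V" "vs ! od x \<in> V" "vs ! od y \<in> V" "vs ! od z \<in> V" using 3(2) by simp_all
    moreover have "{vs ! od w, vs ! od x} \<in> E" "{vs ! od x, vs ! od y} \<in> E"
        "{vs ! od y, vs ! od z} \<in> E" "{vs ! od z, vs ! od w} \<in> E"
      using 3(3-6) by (simp_all add: vertex_adj_def)
    ultimately show ?case using g(2) unfolding C4_free_def by blast
  qed (use g od W in auto)
qed

text \<open>The vertex ordering is computed before the coins are flipped, so that it does not depend on them.\<close>

definition Prog :: "nat \<Rightarrow> nat \<Rightarrow> nat \<Rightarrow> nat \<Rightarrow> com" where
  "Prog a b C k = Seq (Seq (Setup a b C) Order) (Seq Flips (Sample k))"

definition prog_time :: "nat \<Rightarrow> nat \<Rightarrow> nat \<Rightarrow> nat \<Rightarrow> nat \<Rightarrow> nat" where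
  "prog_time a b C n d =
     Suc (Suc (setup_time a b C n d + (n * (n * (6 * n + 12) + 12) + 3)) +
       Suc (5 * (rounds C n d * n * bits_of d) + 3 + sample_time (rounds C n d) n (precision d) (bits_of d)))"

lemma elimination_orderD:
  assumes "elimination_order (length vs) d (input_store vs E d ''adj'') od"
  shows "bij_betw od {..<length vs} {..<length vs}"
    "i < length vs \<Longrightarrow> card {j. j < i \<and> {vs ! od i, vs ! od j} \<in> E} \<le> d"
proof -
  show od: "bij_betw od {..<length vs} {..<length vs}"
    using assms by (simp add: elimination_order_def)
  assume i: "i < length vs"
  have "{j. j < i \<and> {vs ! od i, vs ! od j} \<in> E} =
      {j. j < i \<and> 0 < input_store vs E d ''adj'' (od i * length vs + od j)}"
  proof (rule Collect_cong, rule conj_cong[OF refl])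
    fix j assume "j < i"
    then have "od i < length vs" "od j < length vs"
      using od i by (auto simp: bij_betw_def)
    then show "{vs ! od i, vs ! od j} \<in> E \<longleftrightarrow> 0 < input_store vs E d ''adj'' (od i * length vs + od j)"
      by (simp add: input_store_adj)
  qed
  then show "card {j. j < i \<and> {vs ! od i, vs ! od j} \<in> E} \<le> d"
    using assms i by (simp add: elimination_order_def)
qed

text \<open>A union bound over the \<open>n\<close> vertices. The bound \<beta> is assumed for every
  admissible order, since the program itself determines which one is used.\<close>

lemma prob_Prog:
  fixes V :: "'a set" and a b C k n d :: nat and \<alpha> \<beta> s :: real
  defines "M \<equiv> precision d" and "W0 \<equiv> start_weight a b d" and "q \<equiv> rounds C n d"
  assumes g: "simple_graph V E" "degenerate d V E" "C4_free V E"
    and vs: "distinct vs" "set vs = V" "length vs = n"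
    and params: "2 \<le> d" "0 < b" "2 \<le> k" "k * W0 \<le> M" "0 < W0" "2 * d \<le> W0"
    and \<beta>: "\<And>od v. ordered_graph V E vs od M k W0 n d \<Longrightarrow> v < n \<Longrightarrow>
      \<beta> \<le> weighting.expect (vertex_adj vs E od) M k W0 v
        (\<lambda>I. weighting.prb (vertex_adj vs E od) M k W0 I v)"
    and s: "0 \<le> s" and t: "prog_time a b C n d \<le> t"
  shows "halts_within t (Prog a b C k) (input_store vs E d)" (is ?halts)
    and "1 - real n * exp (real q * (s * \<alpha> - \<beta> * (1 - exp (- s))))
      \<le> measure_pmf.prob (run t (Prog a b C k) (input_store vs E d))
          {(c, s'). is_coloring V E \<alpha> q (output_sets vs s')}" (is ?prob)
proof -
  let ?s0 = "input_store vs E d" and ?B = "bits_of d"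
  let ?adj = "input_store vs E d ''adj''" and ?N = "q * n * bits_of d"
  have ready: "ok (setup_time a b C n d) (Setup a b C) ?s0 (ready a b C n d ?adj)"
    by (rule ok_Setup) (use params vs in \<open>auto simp: input_store_def fun_eq_iff\<close>)
  define R where "R s' \<longleftrightarrow> s' ''n'' 0 = n \<and> s' ''q'' 0 = q \<and> s' ''M'' 0 = M \<and> s' ''W0'' 0 = W0 \<and>
    s' ''bits'' 0 = ?B \<and> (\<forall>i<n. s' ''rn'' i = i * n) \<and> s' ''out'' = (\<lambda>_. 0) \<and> s' ''adj'' = ?adj \<and>
    elimination_order n d ?adj (s' ''ord'')" for s' :: store
  have c1: "ok (Suc (setup_time a b C n d + (n * (n * (6 * n + 12) + 12) + 3))) (Seq (Setup a b C) Order) ?s0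
      (\<lambda>s'. s' ''len'' 0 = ?N \<and> s' ''r'' = (\<lambda>_. 0) \<and> R s')"
  proof (rule ok_SeqI[OF ready])
    fix s1 assume s1: "ready a b C n d ?adj s1"
    have "ok (n * (n * (6 * n + 12) + 12) + 3) Order s1 (\<lambda>s'. elimination_order n d (s1 ''adj'') (s' ''ord''))"
    proof (rule ok_Order)
      fix Q assume Q: "Q \<subseteq> {..<n}" "Q \<noteq> {}"
      then obtain v where v: "v \<in> Q" "card {c. c < n \<and> c \<in> Q \<and> {vs ! v, vs ! c} \<in> E} \<le> d"
        using degenerate_subset[OF g(2) vs(1,2), of Q] vs(3) by auto
      have "{c. c < n \<and> c \<in> Q \<and> 0 < s1 ''adj'' (v * n + c)} =
          {c. c < n \<and> c \<in> Q \<and> {vs ! v, vs ! c} \<in> E}"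
        using s1 v(1) Q(1) vs(3) input_store_adj[of v vs _ E d] by (auto simp: ready_def)
      with v show "\<exists>v\<in>Q. card {c. c < n \<and> c \<in> Q \<and> 0 < s1 ''adj'' (v * n + c)} \<le> d"
        by (intro bexI[of _ v]) (simp_all only:)
    qed (use s1 in \<open>auto simp: ready_def\<close>)
    from ok_frame[OF this] show "ok (n * (n * (6 * n + 12) + 12) + 3) Order s1
        (\<lambda>s'. s' ''len'' 0 = ?N \<and> s' ''r'' = (\<lambda>_. 0) \<and> R s')"
      by (rule ok_weaken)
         (use s1 in \<open>simp_all add: ready_def R_def same_off_def M_def W0_def q_def\<close>)
  qed
  have graph: "ordered_graph V E vs od M k W0 n d" if "elimination_order n d ?adj od" for od
    using that elimination_orderD[of vs d E od] g vs params
    by (intro ordered_graphI) auto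
  define P where "P s1 h s' \<longleftrightarrow> s' ''q'' 0 = q \<and> (\<forall>x. s' ''out'' x = of_bool (\<exists>j<q.
      \<exists>i\<in>weighting.round_set (vertex_adj vs E (s1 ''ord'')) M k W0 n ?B h j. x = j * n + s1 ''ord'' i))"
    for s1 s' :: store and h
  have c2: "ok (sample_time q n M ?B) (Sample k) (put ''i'' 0 ?N (s1(''r'' := h))) (P s1 h)"
    if s1: "R s1" for s1 h
  proof -
    interpret ordered_graph V E vs "s1 ''ord''" M k W0 n d
      using s1 by (intro graph) (simp add: R_def)
    let ?s = "put ''i'' 0 ?N (s1(''r'' := h))"
    have odn: "s1 ''ord'' i < n" if "i < n" for i using od that by (auto simp: bij_betw_def)
    have "ok (sample_time q n M ?B) (Sample k) ?s (\<lambda>s'. \<forall>x. s' ''out'' x =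
        of_bool (\<exists>j<q. \<exists>i\<in>round_set n ?B (?s ''r'') j. x = j * n + ?s ''ord'' i))"
    proof (rule ok_Sample)
      fix i j assume "i < n" "j < i"
      then show "vertex_adj vs E (s1 ''ord'') i j \<longleftrightarrow> 0 < ?s ''adj'' (?s ''ord'' i * n + ?s ''ord'' j)"
        using odn[of i] odn[of j] s1 vs(3) input_store_adj[of "s1 ''ord'' i" vs "s1 ''ord'' j" E d]
        by (auto simp: put_def R_def vertex_adj_def)
    qed (use s1 odn in \<open>auto simp: R_def put_def\<close>)
    from ok_frame[OF this] show ?thesis
      by (rule ok_weaken) (use s1 in \<open>simp_all add: P_def R_def same_off_def put_def Sample_def\<close>)
  qed
  obtain s1 f where s1: "R s1" and f: "\<And>h. P s1 h (f h)" and
    run0: "run (Suc (Suc (setup_time a b C n d + (n * (n * (6 * n + 12) + 12) + 3)) +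
        Suc (5 * ?N + 3 + sample_time q n M ?B))) (Prog a b C k) ?s0 =
      map_pmf (\<lambda>h. (SKIP, f h)) (coins 0 ?N (\<lambda>_. 0))"
    unfolding Prog_def by (rule run_around_Flips[OF c1, where P = P, OF c2]) auto
  then have run0: "run (prog_time a b C n d) (Prog a b C k) ?s0 =
      map_pmf (\<lambda>h. (SKIP, f h)) (coins 0 ?N (\<lambda>_. 0))"
    by (simp only: prog_time_def q_def M_def)
  then have "halts_within (prog_time a b C n d) (Prog a b C k) ?s0" by (auto simp: halts_within_def)
  from halts_within_mono[OF this, of "t - prog_time a b C n d"] t
  have run: "run t (Prog a b C k) ?s0 = map_pmf (\<lambda>h. (SKIP, f h)) (coins 0 ?N (\<lambda>_. 0))"
    by (simp add: run0)
  then show ?halts by (auto simp: halts_within_def)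
  interpret ordered_graph V E vs "s1 ''ord''" M k W0 n d
    using s1 by (intro graph) (simp add: R_def)
  let ?bad = "\<lambda>v h. real (card {j. j < q \<and> v \<in> round_set n ?B h j}) < \<alpha> * real q"
  have M: "M = 2 ^ ?B" by (simp add: M_def precision_def)
  have "measure_pmf.prob (coins 0 ?N (\<lambda>_. 0)) {h. \<exists>v<n. ?bad v h} =
      measure_pmf.expectation (coins 0 ?N (\<lambda>_. 0)) (indicator {h. \<exists>v<n. ?bad v h})"
    by simp
  also have "\<dots> = avg 2 ?N (indicator {h. \<exists>v<n. ?bad v h})" by (rule expectation_coins)
  also have "\<dots> \<le> avg 2 ?N (\<lambda>h. \<Sum>v<n. of_bool (?bad v h))"
  proof (rule avg_mono)
    fix h
    show "indicator {h. \<exists>v<n. ?bad v h} h \<le> (\<Sum>v<n. of_bool (?bad v h) :: real)"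
    proof (cases "\<exists>v<n. ?bad v h")
      case True
      then obtain v where "v < n" "?bad v h" by blast
      then have "of_bool (?bad v h) \<le> (\<Sum>v<n. of_bool (?bad v h) :: real)"
        by (intro member_le_sum) auto
      with \<open>?bad v h\<close> show ?thesis by (simp add: indicator_def)
    qed (simp add: sum_nonneg)
  qed
  also have "\<dots> = (\<Sum>v<n. avg 2 ?N (\<lambda>h. of_bool (?bad v h)))" by (rule avg_sum) simp
  also have "\<dots> \<le> (\<Sum>v<n. exp (real q * (s * \<alpha> - \<beta> * (1 - exp (- s)))))"
    using \<beta>[OF ordered_graph_axioms] s M by (intro sum_mono avg_few_rounds) auto
  finally have bad: "measure_pmf.prob (coins 0 ?N (\<lambda>_. 0)) {h. \<exists>v<n. ?bad v h} \<le>
      real n * exp (real q * (s * \<alpha> - \<beta> * (1 - exp (- s))))" by simp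
  have "is_coloring V E \<alpha> q (output_sets vs (f h))" if "\<not> (\<exists>v<n. ?bad v h)" for h
  proof (rule output_is_coloring[where g = h and B = ?B])
    show "\<alpha> * real q \<le> real (card {j. j < q \<and> v \<in> round_set n ?B h j})" if "v < n" for v
      using that \<open>\<not> (\<exists>v<n. ?bad v h)\<close> by (meson not_less)
  qed (use f[of h] in \<open>simp_all add: P_def\<close>)
  then have "measure_pmf.prob (coins 0 ?N (\<lambda>_. 0)) (- {h. \<exists>v<n. ?bad v h}) \<le>
      measure_pmf.prob (coins 0 ?N (\<lambda>_. 0)) {h. is_coloring V E \<alpha> q (output_sets vs (f h))}"
    by (intro measure_pmf.finite_measure_mono) auto
  also have "\<dots> = measure_pmf.prob (run t (Prog a b C k) ?s0)
      {(c, s'). is_coloring V E \<alpha> q (output_sets vs s')}"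
    unfolding run by (simp add: vimage_def)
  finally have "measure_pmf.prob (coins 0 ?N (\<lambda>_. 0)) (- {h. \<exists>v<n. ?bad v h}) \<le>
      measure_pmf.prob (run t (Prog a b C k) ?s0) {(c, s'). is_coloring V E \<alpha> q (output_sets vs s')}" .
  moreover have "measure_pmf.prob (coins 0 ?N (\<lambda>_. 0)) (- {h. \<exists>v<n. ?bad v h}) =
      1 - measure_pmf.prob (coins 0 ?N (\<lambda>_. 0)) {h. \<exists>v<n. ?bad v h}"
    using measure_pmf.prob_compl[of "{h. \<exists>v<n. ?bad v h}" "coins 0 ?N (\<lambda>_. 0)"]
    by (simp add: Compl_eq_Diff_UNIV)
  ultimately show ?prob using bad by linarith
qed

lemma fractional_chromatic_number_degenerate:
  fixes V :: "'a set"
  assumes g: "simple_graph V E" "degenerate d V E" "C4_free V E" "card V = n"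
    and W: "2 \<le> k" "k * W0 \<le> M" "0 < W0" "2 * d \<le> W0"
    and \<beta>: "0 < \<beta>" "\<And>vs od v. ordered_graph V E vs od M k W0 n d \<Longrightarrow> v < n \<Longrightarrow>
      \<beta> \<le> weighting.expect (vertex_adj vs E od) M k W0 v
        (\<lambda>I. weighting.prb (vertex_adj vs E od) M k W0 I v)"
  shows "fractional_chromatic_number V E \<le> 1 / \<beta>"
proof -
  obtain vs where vs: "distinct vs" "set vs = V"
    "\<And>i. i < length vs \<Longrightarrow> card {u \<in> set (take (Suc i) vs). {u, vs ! i} \<in> E} \<le> d"
    using g(2) by (auto simp: degenerate_def)
  have len: "length vs = n" using vs g(4) distinct_card by fastforce
  have deg: "card {j. j < i \<and> {vs ! id i, vs ! id j} \<in> E} \<le> d" if i: "i < n" for i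
  proof -
    let ?L = "{j. j < i \<and> {vs ! id i, vs ! id j} \<in> E}"
    have "card ?L = card ((!) vs ` ?L)"
      using vs(1) i len by (intro card_image[symmetric] inj_onI) (auto simp: nth_eq_iff_index_eq)
    also have "\<dots> \<le> card {u \<in> set (take (Suc i) vs). {u, vs ! i} \<in> E}"
    proof (intro card_mono subsetI)
      fix u assume "u \<in> (!) vs ` ?L"
      then obtain j where j: "u = vs ! j" "j < i" "{vs ! i, vs ! j} \<in> E" by auto
      have "take (Suc i) vs ! j = u" "j < length (take (Suc i) vs)" using j i len by simp_all
      then have "u \<in> set (take (Suc i) vs)" by (metis nth_mem)
      with j show "u \<in> {u \<in> set (take (Suc i) vs). {u, vs ! i} \<in> E}" by (simp add: insert_commute)
    qed simp
    also have "\<dots> \<le> d" using vs(3) i len by simp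
    finally show ?thesis .
  qed
  \<comment> \<open>Without an input listing to respect, the degeneracy ordering itself can serve as
    the listing, so \<open>od\<close> is the identity.\<close>
  interpret ordered_graph V E vs id M k W0 n d
    by (rule ordered_graphI) (use g vs len deg W in \<open>simp_all add: bij_betw_def\<close>)
  show ?thesis
    using \<beta>(1) \<beta>(2)[OF ordered_graph_axioms] by (rule fractional_chromatic_number_le)
qed

section \<open>Polynomial bounds on the running time\<close>

definition polybd :: "(nat \<Rightarrow> nat \<Rightarrow> nat) \<Rightarrow> bool" where
  "polybd f \<longleftrightarrow> (\<exists>K. \<forall>n d. f n d \<le> K * (n + d + 1) ^ K)"

lemma polybd_mono: "polybd g \<Longrightarrow> (\<And>n d. f n d \<le> g n d) \<Longrightarrow> polybd f"
  unfolding polybd_def by (meson order_trans)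

lemma polybd_const: "polybd (\<lambda>_ _. c)"
  unfolding polybd_def by (intro exI[of _ c]) (simp add: Suc_leI)

lemma polybd_n: "polybd (\<lambda>n _. n)"
  unfolding polybd_def by (intro exI[of _ 1]) simp

lemma polybd_d: "polybd (\<lambda>_ d. d)"
  unfolding polybd_def by (intro exI[of _ 1]) simp

lemma polybd_add:
  assumes "polybd f" "polybd g"
  shows "polybd (\<lambda>n d. f n d + g n d)"
proof -
  obtain K L where K: "\<And>n d. f n d \<le> K * (n + d + 1) ^ K" and L: "\<And>n d. g n d \<le> L * (n + d + 1) ^ L"
    using assms by (auto simp: polybd_def)
  have "f n d + g n d \<le> (K + L) * (n + d + 1) ^ (K + L)" for n d
  proof -
    have "f n d \<le> K * (n + d + 1) ^ (K + L)"
      by (rule order_trans[OF K]) (intro mult_le_mono power_increasing, auto)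
    moreover have "g n d \<le> L * (n + d + 1) ^ (K + L)"
      by (rule order_trans[OF L]) (intro mult_le_mono power_increasing, auto)
    ultimately show ?thesis by (simp add: distrib_right)
  qed
  then show ?thesis unfolding polybd_def by blast
qed

lemma polybd_mult:
  assumes "polybd f" "polybd g"
  shows "polybd (\<lambda>n d. f n d * g n d)"
proof -
  obtain K L where K: "\<And>n d. f n d \<le> K * (n + d + 1) ^ K" and L: "\<And>n d. g n d \<le> L * (n + d + 1) ^ L"
    using assms by (auto simp: polybd_def)
  \<comment> \<open>Large enough both for the coefficient \<open>K * L\<close> and for the exponent
    \<open>K + L\<close>.\<close>
  let ?J = "K * L + K + L"
  have "f n d * g n d \<le> ?J * (n + d + 1) ^ ?J" for n d
  proof -
    have "f n d * g n d \<le> (K * (n + d + 1) ^ K) * (L * (n + d + 1) ^ L)"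
      by (intro mult_le_mono K L)
    also have "\<dots> = (K * L) * (n + d + 1) ^ (K + L)" by (simp add: power_add mult_ac)
    also have "\<dots> \<le> ?J * (n + d + 1) ^ ?J" by (intro mult_le_mono power_increasing) auto
    finally show ?thesis .
  qed
  then show ?thesis unfolding polybd_def by blast
qed

lemma precision_le: "precision d \<le> 8 * ((d + 1) * (d + 1) * (d + 1))"
proof -
  have "2 ^ floor_log d \<le> d + 1"
    by (cases "d = 0") (auto intro: order_trans[OF floor_log_exp2_le])
  then have "2 ^ floor_log d * 2 ^ floor_log d * 2 ^ floor_log d \<le> (d + 1) * (d + 1) * (d + 1)"
    by (intro mult_le_mono)
  moreover have "precision d = 8 * (2 ^ floor_log d * 2 ^ floor_log d * 2 ^ floor_log d)"
    by (simp add: precision_def bits_of_def power_add mult.commute[of 3] power_mult power3_eq_cube)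
  ultimately show ?thesis by simp
qed

lemma rounds_le: "rounds C n d \<le> C * d * n"
proof -
  have "rounds C n d \<le> C * d * floor_log n" by (simp add: rounds_def)
  also have "\<dots> \<le> C * d * n" using floor_log_le_self by (intro mult_le_mono) auto
  finally show ?thesis .
qed

lemmas polybd_intros = polybd_const polybd_n polybd_d polybd_add polybd_mult

lemma polybd_prog_time: "polybd (prog_time a b C)"
proof -
  have lam: "polybd (\<lambda>n d. floor_log d)"
    by (rule polybd_mono[OF polybd_d]) (rule floor_log_le_self)
  have ell: "polybd (\<lambda>n d. floor_log n)"
    by (rule polybd_mono[OF polybd_n]) (rule floor_log_le_self)
  have bits: "polybd (\<lambda>n d. bits_of d)"
    unfolding bits_of_def by (intro polybd_intros lam)
  have M: "polybd (\<lambda>n d. precision d)"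
    by (rule polybd_mono[OF _ precision_le]) (intro polybd_intros)
  have q: "polybd (\<lambda>n d. rounds C n d)"
    by (rule polybd_mono[OF _ rounds_le]) (intro polybd_intros)
  have "polybd (\<lambda>n d.
     1 + (1 + (setup_time a b C n d + (n * (n * (6 * n + 12) + 12) + 3)) +
       (1 + (5 * (rounds C n d * n * bits_of d) + 3 + sample_time (rounds C n d) n (precision d) (bits_of d)))))"
    unfolding setup_time_def sample_time_def visit_time_def weigh_time_def
    by (intro polybd_intros lam ell bits M q)
  then show ?thesis by (rule polybd_mono) (simp add: prog_time_def)
qed

section \<open>Choice of the parameters\<close>

lemma floor_log_bounds:
  assumes "0 < x"
  shows "real (floor_log x) \<le> log 2 (real x)" "log 2 (real x) - 1 \<le> real (floor_log x)"
    "2 ^ floor_log x \<le> x" "x < 2 ^ Suc (floor_log x)"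
proof -
  have "real (floor_log x) = real_of_int \<lfloor>log 2 (real x)\<rfloor>"
    using assms by (simp add: floor_log_altdef)
  then show "real (floor_log x) \<le> log 2 (real x)" "log 2 (real x) - 1 \<le> real (floor_log x)"
    by linarith+
  show "2 ^ floor_log x \<le> x" using assms by (intro floor_log_exp2_le) simp
  show "x < 2 ^ Suc (floor_log x)" using floor_log_exp2_gt[of x] by simp
qed

text \<open>For \<open>n \<ge> 2\<close> and \<open>d \<ge> 4\<close> rounding a binary logarithm
  down loses at most a factor 2. The lower bound pays this once for \<open>n\<close> and another
  factor 2 for the integer division; the upper bound pays it once for \<open>d\<close>. For
  \<open>n \<le> 1\<close> everything is 0.\<close>

lemma rounds_bounds:
  assumes d: "4 \<le> d" and C: "2 \<le> C"
  shows "real C / 4 * (real d * ln (real n) / ln (real d)) \<le> real (rounds C n d)"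
    and "real (rounds C n d) \<le> 2 * real C * (real d * ln (real n) / ln (real d))"
proof -
  define lam ell where "lam = real (floor_log d)" and "ell = real (floor_log n)"
  define x where "x = real d * ell / lam"
  have "log 2 4 \<le> log 2 (real d)" using d by (intro log_mono) auto
  moreover have "log 2 (4 :: real) = 2" using log_pow_cancel[of 2 2] by simp
  ultimately have d2: "2 \<le> log 2 (real d)" by simp
  have lam: "log 2 (real d) / 2 \<le> lam" "lam \<le> log 2 (real d)" "1 \<le> lam"
    using floor_log_bounds[of d] d d2 by (simp_all add: lam_def)
  have ratio: "log 2 (real n) / log 2 (real d) = ln (real n) / ln (real d)"
    by (simp add: log_def)
  have lower: "real C * x / 2 \<le> real (rounds C n d)" and upper: "real (rounds C n d) \<le> real C * x"
    and ell: "log 2 (real n) / 2 \<le> ell" "ell \<le> log 2 (real n)"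
    if n: "2 \<le> n"
  proof -
    have "log 2 2 \<le> log 2 (real n)" using n by (intro log_mono) auto
    moreover have "1 \<le> ell"
    proof -
      have "floor_log 2 \<le> floor_log n" using n by (rule floor_log_le_iff)
      moreover have "floor_log 2 = 1" using floor_log_power[of 1] by simp
      ultimately show ?thesis by (simp add: ell_def)
    qed
    ultimately show "log 2 (real n) / 2 \<le> ell" "ell \<le> log 2 (real n)"
      using floor_log_bounds[of n] n by (simp_all add: ell_def)
    have q: "real (C * d * floor_log n) / real (floor_log d) = real C * x"
      by (simp add: x_def lam_def ell_def)
    have "lam \<le> real d" using floor_log_le_self[of d] by (simp add: lam_def)
    then have "lam * 1 \<le> real d * ell" using \<open>1 \<le> ell\<close> lam by (intro mult_mono) auto
    then have "1 \<le> x" using lam by (simp add: x_def)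
    then have "2 * 1 \<le> real C * x" using C by (intro mult_mono) auto
    moreover have "real C * x - 1 \<le> real (rounds C n d)"
      unfolding rounds_def q[symmetric] by (rule real_div_nat_ge)
    ultimately show "real C * x / 2 \<le> real (rounds C n d)" by simp
    show "real (rounds C n d) \<le> real C * x"
      unfolding rounds_def q[symmetric] by (rule of_nat_div_le_of_nat)
  qed
  show "real C / 4 * (real d * ln (real n) / ln (real d)) \<le> real (rounds C n d)"
  proof (cases "2 \<le> n")
    case True
    have "log 2 (real n) / 2 / log 2 (real d) \<le> ell / lam"
      using ell[OF True] lam True by (intro frac_le) auto
    then have "real C / 2 * (real d * (log 2 (real n) / 2 / log 2 (real d))) \<le> real C / 2 * (real d * (ell / lam))"
      by (intro mult_left_mono) auto
    also have "log 2 (real n) / 2 / log 2 (real d) = ln (real n) / ln (real d) / 2"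
      using ratio by simp
    finally show ?thesis using lower[OF True] by (simp add: x_def)
  next
    case False
    then have "n = 0 \<or> n = 1" by auto
    then show ?thesis by (auto simp: rounds_def)
  qed
  show "real (rounds C n d) \<le> 2 * real C * (real d * ln (real n) / ln (real d))"
  proof (cases "2 \<le> n")
    case True
    have "ell / lam \<le> log 2 (real n) / (log 2 (real d) / 2)"
      using ell[OF True] lam d2 by (intro frac_le) (auto simp: ell_def)
    then have "real C * (real d * (ell / lam)) \<le> real C * (real d * (log 2 (real n) / (log 2 (real d) / 2)))"
      by (intro mult_left_mono) auto
    also have "log 2 (real n) / (log 2 (real d) / 2) = 2 * (ln (real n) / ln (real d))"
      unfolding ratio[symmetric] by simp
    finally show ?thesis using upper[OF True] by (simp add: x_def mult_ac)
  next
    case False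
    then have "n = 0 \<or> n = 1" by auto
    then show ?thesis by (auto simp: rounds_def)
  qed
qed

lemma rational_between:
  fixes x y :: real
  assumes "0 < x" "x < y"
  obtains a b :: nat where "0 < a" "0 < b" "x < real a / real b" "real a / real b < y"
proof -
  obtain r where r: "r \<in> \<rat>" "x < r" "r < y" using Rats_dense_in_real[OF assms(2)] by blast
  then have "r \<in> \<rat>" "0 < r" using assms by auto
  then obtain a b :: nat where "b \<noteq> 0" "\<bar>r\<bar> = real a / real b"
    using Rats_abs_nat_div_natE by metis
  with r assms that[of a b] show ?thesis by (cases "a = 0") auto
qed

text \<open>Two losses: taking the floor of the binary logarithm costs at most 1, which is
  \<open>ln 2\<close> in natural units, and the integer division costs at most \<open>1 / M\<close>,
  hence \<open>1 / d ^ 3\<close>.\<close>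

lemma start_weight_bounds:
  fixes a b d :: nat
  defines "\<kappa> \<equiv> real a / real b / ln 2"
  assumes d: "0 < d" and b: "0 < b"
  shows "real (start_weight a b d) / real (precision d) \<le> \<kappa> * ln (real d) / real d"
    and "\<kappa> * (ln (real d) - ln 2) / real d - 1 / real d ^ 3 \<le> real (start_weight a b d) / real (precision d)"
    and "real d ^ 3 \<le> real (precision d)"
proof -
  have M: "0 < real (precision d)" by (simp add: precision_def)
  define x where "x = real a / real b * real (floor_log d) / real d"
  have q: "real (a * floor_log d * precision d) / real (b * d) = x * real (precision d)"
    by (simp add: x_def)
  have "real (start_weight a b d) \<le> x * real (precision d)"
    unfolding start_weight_def q[symmetric] by (rule of_nat_div_le_of_nat)
  then have up: "real (start_weight a b d) / real (precision d) \<le> x"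
    using M by (simp add: pos_divide_le_eq)
  have "x * real (precision d) - 1 \<le> real (start_weight a b d)"
    unfolding start_weight_def q[symmetric] by (rule real_div_nat_ge)
  then have "x \<le> (real (start_weight a b d) + 1) / real (precision d)"
    using M by (simp add: pos_le_divide_eq)
  then have lo: "x - 1 / real (precision d) \<le> real (start_weight a b d) / real (precision d)"
    by (simp add: add_divide_distrib)
  have k1: "real a / real b * log 2 (real d) / real d = \<kappa> * ln (real d) / real d"
    by (simp add: \<kappa>_def log_def)
  have k2: "real a / real b * (log 2 (real d) - 1) / real d = \<kappa> * (ln (real d) - ln 2) / real d"
    by (simp add: \<kappa>_def log_def field_simps)
  have "x \<le> real a / real b * log 2 (real d) / real d"
    unfolding x_def using floor_log_bounds(1)[OF d]
    by (intro divide_right_mono mult_left_mono) auto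
  with up k1 show "real (start_weight a b d) / real (precision d) \<le> \<kappa> * ln (real d) / real d" by simp
  have "d ^ 3 \<le> (2 ^ Suc (floor_log d)) ^ 3"
    using floor_log_bounds(4)[OF d] by (intro power_mono) auto
  also have "\<dots> = precision d"
    by (simp only: precision_def bits_of_def power_mult[symmetric]) (simp add: algebra_simps)
  finally show "real d ^ 3 \<le> real (precision d)" by (simp flip: of_nat_power)
  then have "1 / real (precision d) \<le> 1 / real d ^ 3" using d M by (intro divide_left_mono) auto
  moreover have "real a / real b * (log 2 (real d) - 1) / real d \<le> x"
    unfolding x_def using floor_log_bounds(2)[OF d]
    by (intro divide_right_mono mult_left_mono) auto
  ultimately show "\<kappa> * (ln (real d) - ln 2) / real d - 1 / real d ^ 3 \<le> real (start_weight a b d) / real (precision d)"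
    using lo k2 by linarith
qed

text \<open>What is needed of a large \<open>d\<close>: the initial weight respects the cap; it
  satisfies \<open>2 * d \<le> W0\<close>, the extra 1 paying for rounding; a weight whose
  neighbours sum to \<open>(1 - \<theta>) * ln d\<close> stays below the cap; and all losses
  together, from \<kappa>, rounding and the failure probability
  \<open>exp (- 2 * \<theta> * ln d)\<close>, stay within the factor
  \<open>1 - 32 * \<theta>\<close>.\<close>

lemma asymptotics:
  fixes \<theta> \<kappa> k :: real
  assumes \<theta>: "0 < \<theta>" "\<theta> < 1 / 64" and \<kappa>: "0 < \<kappa>" and k: "0 < k"
  shows "\<forall>\<^sub>F d :: nat in sequentially. k * (\<kappa> * ln (real d) / real d) \<le> 1"
    and "\<forall>\<^sub>F d :: nat in sequentially. 2 * real d + 1 \<le> real d ^ 3 * (\<kappa> * (ln (real d) - ln 2) / real d)"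
    and "\<forall>\<^sub>F d :: nat in sequentially. k * \<kappa> * ln (real d) * exp (- (\<theta> / 2) * ln (real d)) \<le> 1"
    and "\<forall>\<^sub>F d :: nat in sequentially. (1 - 32 * \<theta>) * ln (real d) \<le>
      ((1 - 8 * \<theta>) * (ln (real d) - ln 2) - 2 / real d) * (1 - exp (- 2 * \<theta> * ln (real d)))"
proof -
  show "\<forall>\<^sub>F d :: nat in sequentially. k * (\<kappa> * ln (real d) / real d) \<le> 1"
    using \<kappa> k by real_asymp
  show "\<forall>\<^sub>F d :: nat in sequentially. 2 * real d + 1 \<le> real d ^ 3 * (\<kappa> * (ln (real d) - ln 2) / real d)"
    using \<kappa> by real_asymp
  show "\<forall>\<^sub>F d :: nat in sequentially. k * \<kappa> * ln (real d) * exp (- (\<theta> / 2) * ln (real d)) \<le> 1"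
    using \<kappa> k \<theta> by real_asymp
  show "\<forall>\<^sub>F d :: nat in sequentially. (1 - 32 * \<theta>) * ln (real d) \<le>
      ((1 - 8 * \<theta>) * (ln (real d) - ln 2) - 2 / real d) * (1 - exp (- 2 * \<theta> * ln (real d)))"
    using \<theta> by real_asymp
qed

text \<open>The slack \<open>\<epsilon>\<close> is spent in units of \<open>\<theta> = \<epsilon> / 64\<close>: the initial probability is
  \<open>\<kappa> ln d / d\<close> with \<open>1 - 8 \<theta> < \<kappa> < 1 - 4 \<theta>\<close>, and every probability is capped at \<open>1 / k \<le> \<theta> / 4\<close>.\<close>

lemma (in greedy) expect_prb_ge_log:
  fixes \<theta> \<kappa> :: real
  assumes \<theta>: "0 < \<theta>" "\<theta> < 1 / 64" and k: "4 / \<theta> \<le> real k" and \<kappa>: "1 - 8 * \<theta> < \<kappa>" "\<kappa> < 1 - 4 * \<theta>"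
    and d: "1 \<le> d" and v: "v < n"
    and W: "real W0 / real M \<le> \<kappa> * ln (real d) / real d"
      "\<kappa> * (ln (real d) - ln 2) / real d - 1 / real d ^ 3 \<le> real W0 / real M" "real d ^ 3 \<le> real M"
    and ln2: "ln 2 \<le> ln (real d)"
    and large: "k * \<kappa> * ln (real d) * exp (- (\<theta> / 2) * ln (real d)) \<le> 1"
      "(1 - 32 * \<theta>) * ln (real d) \<le>
         ((1 - 8 * \<theta>) * (ln (real d) - ln 2) - 2 / real d) * (1 - exp (- 2 * \<theta> * ln (real d)))"
  shows "(1 - 32 * \<theta>) * (ln (real d) / real d) \<le> expect v (\<lambda>I. prb I v)"
proof -
  define L where "L = ln (real d)"
  define w where "w = real W0 / real M"
  have "0 < ln (2 :: real)" by simp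
  with ln2 have L: "0 \<le> L" unfolding L_def by linarith
  have w: "0 \<le> w" "real d * w \<le> \<kappa> * L"
    using W(1) d by (simp_all add: w_def L_def field_simps)
  have kpos: "0 < real k" using k2 by simp
  have k': "1 / real k \<le> \<theta> / 4" using k kpos \<theta> by (simp add: field_simps)
  \<comment> \<open>The threshold is \<Lambda> = \<open>(1 - \<theta>) * L\<close>. As
    \<open>2 / k \<le> \<theta> / 2\<close>, the exponent is at most
    \<open>(1 - \<theta> / 2) * L\<close>: the exponential gains a factor \<open>d\<close>, which
    cancels the \<open>1 / d\<close> of the initial weight, and
    \<open>exp (- (\<theta> / 2) * L)\<close> is left to beat
    \<open>k * \<kappa> * L\<close>.\<close>
  have cap: "real k * (real W0 * exp ((1 + 2 / k) * ((1 - \<theta>) * L))) \<le> real M"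
  proof -
    have "(1 + 2 / real k) * (1 - \<theta>) \<le> (1 + \<theta> / 2) * (1 - \<theta>)"
      using k' \<theta> by (intro mult_right_mono) auto
    also have "\<dots> \<le> 1 - \<theta> / 2" using \<theta> by (simp add: algebra_simps)
    finally have "(1 + 2 / real k) * (1 - \<theta>) * L \<le> (1 - \<theta> / 2) * L"
      using L by (intro mult_right_mono)
    then have "exp ((1 + 2 / k) * ((1 - \<theta>) * L)) \<le> exp (L + - (\<theta> / 2) * L)"
      by (simp add: algebra_simps)
    also have "\<dots> = real d * exp (- (\<theta> / 2) * L)"
      unfolding exp_add using d by (simp add: L_def)
    finally have "w * exp ((1 + 2 / k) * ((1 - \<theta>) * L)) \<le> w * (real d * exp (- (\<theta> / 2) * L))"
      using w(1) by (rule mult_left_mono)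
    also have "\<dots> = real d * w * exp (- (\<theta> / 2) * L)" by simp
    also have "\<dots> \<le> \<kappa> * L * exp (- (\<theta> / 2) * L)" using w(2) by (intro mult_right_mono) auto
    finally have "real k * (w * exp ((1 + 2 / k) * ((1 - \<theta>) * L))) \<le> real k * (\<kappa> * L * exp (- (\<theta> / 2) * L))"
      using kpos by (intro mult_left_mono) auto
    also have "\<dots> \<le> 1" using large(1) by (simp add: L_def mult.assoc)
    finally show ?thesis using M_pos by (simp add: w_def field_simps)
  qed
  \<comment> \<open>The inflated mean minus the deflated threshold. Since \<kappa> < 1 - 4 \<theta>,
    it lies at least \<open>\<theta> * L\<close> below 0; the multiplier
    \<open>\<theta> * k / 2\<close> is at least 2 by the choice of \<open>k\<close>, so the failure
    probability is at most \<open>exp (- 2 * \<theta> * L)\<close>.\<close>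
  define x where "x = (1 + \<theta>) * (real d * real W0 / real M) - (1 - 1 / k) * ((1 - \<theta>) * L)"
  have "x \<le> - \<theta> * L"
  proof -
    have "\<kappa> * L \<le> (1 - 4 * \<theta>) * L" using \<kappa> L by (intro mult_right_mono) auto
    then have "(1 + \<theta>) * (real d * w) \<le> (1 + \<theta>) * ((1 - 4 * \<theta>) * L)"
      using w(2) \<theta> by (intro mult_left_mono) auto
    moreover have "(1 - \<theta> / 4) * ((1 - \<theta>) * L) \<le> (1 - 1 / k) * ((1 - \<theta>) * L)"
      using k' \<theta> L by (intro mult_right_mono) auto
    ultimately have "x \<le> (1 + \<theta>) * ((1 - 4 * \<theta>) * L) - (1 - \<theta> / 4) * ((1 - \<theta>) * L)"
      by (simp add: x_def w_def)
    also have "\<dots> = - \<theta> * L - (3 / 4 * \<theta> + 17 / 4 * \<theta>\<^sup>2) * L"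
      by (simp add: field_simps power2_eq_square)
    also have "\<dots> \<le> - \<theta> * L" using \<theta> L by simp
    finally show ?thesis .
  qed
  moreover have "2 \<le> \<theta> * k / 2" using k \<theta> by (simp add: field_simps)
  moreover have "- \<theta> * L \<le> 0" using \<theta> L by simp
  ultimately have "\<theta> * k / 2 * x \<le> 2 * x" by (intro mult_right_mono_neg) auto
  with \<open>x \<le> - \<theta> * L\<close> have ex: "1 - exp (- 2 * \<theta> * L) \<le> 1 - exp (\<theta> * k / 2 * x)" by simp
  have ex0: "0 \<le> 1 - exp (- 2 * \<theta> * L)" using \<theta> L by simp
  have base: "((1 - 8 * \<theta>) * (L - ln 2) - 2 / real d) / real d \<le> (real W0 - real d) / real M"
  proof -
    have "real d / real M \<le> real d / real d ^ 3"
      using W(3) d M_pos by (intro divide_left_mono) auto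
    also have "\<dots> = 1 / real d ^ 2" using d by (simp add: power2_eq_square power3_eq_cube)
    finally have 1: "real d / real M \<le> 1 / real d ^ 2" .
    have 2: "1 / real d ^ 3 \<le> 1 / real d ^ 2"
      using d by (intro divide_left_mono power_increasing) auto
    have "(1 - 8 * \<theta>) * (L - ln 2) / real d \<le> \<kappa> * (L - ln 2) / real d"
      using \<kappa> ln2 by (intro divide_right_mono mult_right_mono) (auto simp: L_def)
    with 1 2 W(2) have "(1 - 8 * \<theta>) * (L - ln 2) / real d - 2 / real d ^ 2 \<le> real W0 / real M - real d / real M"
      by (simp add: L_def)
    then show ?thesis by (simp add: diff_divide_distrib power2_eq_square)
  qed
  have "(1 - 32 * \<theta>) * (L / real d) \<le>
      ((1 - 8 * \<theta>) * (L - ln 2) - 2 / real d) / real d * (1 - exp (- 2 * \<theta> * L))"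
    using divide_right_mono[OF large(2), of "real d"] by (simp add: L_def)
  also have "\<dots> \<le> (real W0 - real d) / real M * (1 - exp (- 2 * \<theta> * L))"
    using base ex0 by (intro mult_right_mono)
  also have "\<dots> \<le> (real W0 - real d) / real M * (1 - exp (\<theta> * k / 2 * x))"
    using ex W0_ge by (intro mult_left_mono) auto
  also have "\<dots> \<le> expect v (\<lambda>I. prb I v)"
    using expect_prb_ge[OF v _ _ cap, of \<theta>] \<theta> by (simp add: x_def)
  finally show ?thesis by (simp add: L_def)
qed

lemma parameters_exist:
  fixes \<epsilon> :: real
  assumes \<epsilon>: "0 < \<epsilon>" "\<epsilon> < 1"
  shows "\<exists>a b k d0 :: nat. 0 < b \<and> 2 \<le> k \<and> (\<forall>d\<ge>d0.
    4 \<le> d \<and> k * start_weight a b d \<le> precision d \<and> 0 < start_weight a b d \<and> 2 * d \<le> start_weight a b d \<and>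
    (\<forall>n (V :: 'a set) E vs od v.
      ordered_graph V E vs od (precision d) k (start_weight a b d) n d \<longrightarrow> v < n \<longrightarrow>
      (1 - \<epsilon> / 2) * (ln (real d) / real d) \<le>
        weighting.expect (vertex_adj vs E od) (precision d) k (start_weight a b d) v
          (\<lambda>I. weighting.prb (vertex_adj vs E od) (precision d) k (start_weight a b d) I v)))"
proof -
  define \<theta> where "\<theta> = \<epsilon> / 64"
  have \<theta>: "0 < \<theta>" "\<theta> < 1 / 64" using \<epsilon> by (simp_all add: \<theta>_def)
  define k where "k = nat \<lceil>4 / \<theta>\<rceil>"
  have k: "4 / \<theta> \<le> real k" by (simp add: k_def real_nat_ceiling_ge)
  have "2 \<le> 4 / \<theta>" using \<theta> by (simp add: field_simps)
  with k have k2: "2 \<le> k" by linarith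
  have ln2: "0 < ln (2 :: real)" by simp
  \<comment> \<open>The program computes with naturals, so \<open>\<kappa> * ln 2\<close> has to be
    a ratio of two of them; \<kappa> ranges over an interval to leave room for this choice.\<close>
  have "0 < (1 - 8 * \<theta>) * ln 2" "(1 - 8 * \<theta>) * ln 2 < (1 - 4 * \<theta>) * ln 2"
    using \<theta> ln2 by (auto intro!: mult_strict_right_mono)
  then obtain a b :: nat where ab: "0 < a" "0 < b" "(1 - 8 * \<theta>) * ln 2 < real a / real b"
      "real a / real b < (1 - 4 * \<theta>) * ln 2"
    by (rule rational_between)
  define \<kappa> where "\<kappa> = real a / real b / ln 2"
  have \<kappa>: "1 - 8 * \<theta> < \<kappa>" "\<kappa> < 1 - 4 * \<theta>"
    unfolding \<kappa>_def using ab(3,4) by (simp_all only: pos_less_divide_eq[OF ln2] pos_divide_less_eq[OF ln2])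
  have \<kappa>0: "0 < \<kappa>" using \<kappa> \<theta> by simp
  have "0 < real k" using k2 by simp
  from asymptotics[OF \<theta> \<kappa>0 this]
  have "\<forall>\<^sub>F d :: nat in sequentially. 4 \<le> d \<and> k * (\<kappa> * ln (real d) / real d) \<le> 1 \<and>
      2 * real d + 1 \<le> real d ^ 3 * (\<kappa> * (ln (real d) - ln 2) / real d) \<and>
      k * \<kappa> * ln (real d) * exp (- (\<theta> / 2) * ln (real d)) \<le> 1 \<and>
      (1 - 32 * \<theta>) * ln (real d) \<le>
        ((1 - 8 * \<theta>) * (ln (real d) - ln 2) - 2 / real d) * (1 - exp (- 2 * \<theta> * ln (real d)))"
    by (intro eventually_conj eventually_ge_at_top)
  then obtain d0 where d0: "\<And>d. d0 \<le> d \<Longrightarrow> 4 \<le> d \<and> k * (\<kappa> * ln (real d) / real d) \<le> 1 \<and>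
      2 * real d + 1 \<le> real d ^ 3 * (\<kappa> * (ln (real d) - ln 2) / real d) \<and>
      k * \<kappa> * ln (real d) * exp (- (\<theta> / 2) * ln (real d)) \<le> 1 \<and>
      (1 - 32 * \<theta>) * ln (real d) \<le>
        ((1 - 8 * \<theta>) * (ln (real d) - ln 2) - 2 / real d) * (1 - exp (- 2 * \<theta> * ln (real d)))"
    unfolding eventually_sequentially by blast
  have "4 \<le> d \<and> k * start_weight a b d \<le> precision d \<and> 0 < start_weight a b d \<and> 2 * d \<le> start_weight a b d \<and>
    (\<forall>n (V :: 'a set) E vs od v.
      ordered_graph V E vs od (precision d) k (start_weight a b d) n d \<longrightarrow> v < n \<longrightarrow>
      (1 - \<epsilon> / 2) * (ln (real d) / real d) \<le>
        weighting.expect (vertex_adj vs E od) (precision d) k (start_weight a b d) v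
          (\<lambda>I. weighting.prb (vertex_adj vs E od) (precision d) k (start_weight a b d) I v))" if d: "d0 \<le> d" for d
  proof -
    let ?W = "start_weight a b d" and ?M = "precision d"
    have d4: "4 \<le> d" and M: "0 < real ?M" using d0[OF d] by (simp_all add: precision_def)
    have dpos: "0 < d" using d4 by simp
    note sw = start_weight_bounds(1,2)[OF dpos ab(2), of a, folded \<kappa>_def]
      start_weight_bounds(3)[OF dpos ab(2)]
    have "real k * (real ?W / real ?M) \<le> real k * (\<kappa> * ln (real d) / real d)"
      using sw(1) by (intro mult_left_mono) auto
    also have "\<dots> \<le> 1" using d0[OF d] by blast
    finally have "real (k * ?W) \<le> real ?M" using M by (simp add: field_simps)
    then have kW: "k * ?W \<le> ?M" by (simp only: of_nat_le_iff)
    define c where "c = \<kappa> * (ln (real d) - ln 2) / real d"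
    have c: "2 * real d + 1 \<le> real d ^ 3 * c" using d0[OF d] by (simp only: c_def)
    have "0 \<le> c" using c d4 by (simp add: c_def zero_le_mult_iff) (use \<kappa>0 in auto)
    have "real d ^ 3 * c - 1 \<le> real d ^ 3 * (real ?W / real ?M)"
    proof -
      have "real d ^ 3 * (c - 1 / real d ^ 3) \<le> real d ^ 3 * (real ?W / real ?M)"
        using sw(2) by (intro mult_left_mono) (simp_all add: c_def)
      then show ?thesis using d4 by (simp add: right_diff_distrib)
    qed
    also have "\<dots> \<le> real ?M * (real ?W / real ?M)" using sw(3) by (intro mult_right_mono) auto
    also have "\<dots> = real ?W" using M by simp
    finally have "2 * real d \<le> real ?W" using c by simp
    then have W: "2 * d \<le> ?W" by linarith
    have "(1 - \<epsilon> / 2) * (ln (real d) / real d) \<le>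
        weighting.expect (vertex_adj vs E od) ?M k ?W v (\<lambda>I. weighting.prb (vertex_adj vs E od) ?M k ?W I v)"
      if g: "ordered_graph V E vs od ?M k ?W n d" and v: "v < n" for n v and V :: "'a set" and E vs od
    proof -
    interpret ordered_graph V E vs od ?M k ?W n d by (rule g)
    have "ln 2 \<le> ln (real d)" using d4 by simp
    then have "(1 - 32 * \<theta>) * (ln (real d) / real d) \<le> expect v (\<lambda>I. prb I v)"
      using \<theta> k \<kappa> dpos v sw d0[OF d] by (intro expect_prb_ge_log[of \<theta> \<kappa>]) auto
      then show ?thesis by (simp add: \<theta>_def)
    qed
    with W d4 kW show ?thesis by simp
  qed
  with ab(2) k2 show ?thesis by blast
qed

text \<open>Put \<open>s = \<epsilon> / 2\<close>: the target frequency is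
  \<open>(1 - 2 * s) * y\<close>, the guaranteed one \<open>(1 - s) * y\<close>, and
  \<open>s\<close> is also the Chernoff parameter. With
  \<open>1 - exp (- s) \<ge> s * (1 - s)\<close> the terms of first and second order cancel and
  \<open>- (s ^ 3) * y\<close> remains.\<close>

lemma chernoff_exponent:
  fixes \<epsilon> y :: real
  assumes \<epsilon>: "0 < \<epsilon>" "\<epsilon> < 1" and y: "0 \<le> y"
  shows "\<epsilon> / 2 * ((1 - \<epsilon>) * y) - (1 - \<epsilon> / 2) * y * (1 - exp (- (\<epsilon> / 2))) \<le> - (\<epsilon> ^ 3 / 8) * y"
proof -
  define s where "s = \<epsilon> / 2"
  have s: "0 < s" "s < 1 / 2" using \<epsilon> by (simp_all add: s_def)
  have "(1 + s) * exp (- s) \<le> exp s * exp (- s)"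
    by (intro mult_right_mono exp_ge_add_one_self) auto
  also have "\<dots> = 1" by (simp flip: exp_add)
  finally have "exp (- s) \<le> 1 / (1 + s)" using s by (simp add: pos_le_divide_eq mult.commute)
  also have "\<dots> \<le> 1 - s * (1 - s)"
  proof -
    have "(1 - s * (1 - s)) * (1 + s) = 1 + s ^ 3" by (simp add: algebra_simps power3_eq_cube)
    then show ?thesis using s by (simp add: pos_divide_le_eq)
  qed
  finally have "s * (1 - s) \<le> 1 - exp (- s)" by simp
  then have "(1 - s) * y * (s * (1 - s)) \<le> (1 - s) * y * (1 - exp (- s))"
    using s y by (intro mult_left_mono) auto
  moreover have "s * ((1 - 2 * s) * y) - (1 - s) * y * (s * (1 - s)) = - (s ^ 3 * y)"
    by (simp add: algebra_simps power3_eq_cube)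
  ultimately have "s * ((1 - 2 * s) * y) - (1 - s) * y * (1 - exp (- s)) \<le> - (s ^ 3 * y)" by linarith
  then show ?thesis by (simp add: s_def power_divide)
qed

theorem theorem1p3:
  fixes \<epsilon> :: real
  assumes "0 < \<epsilon>" and "\<epsilon> < 1"
  shows "\<exists>d0::nat.
    (\<forall>d\<ge>d0. \<forall>n. \<forall>(V :: 'a set) E.
       simple_graph V E \<and> card V = n \<and> degenerate d V E \<and> C4_free V E \<longrightarrow>
       fractional_chromatic_number V E \<le> (1 + \<epsilon>) * (real d / ln (real d))) \<and>
    (\<exists>(prog :: com) (K :: nat) (q :: nat \<Rightarrow> nat \<Rightarrow> nat) (c1 :: real) (c2 :: real) (\<delta> :: nat \<Rightarrow> real).
       0 < c1 \<and> 0 < c2 \<and> \<delta> \<longlonglongrightarrow> 0 \<and>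
       (\<forall>d\<ge>d0. \<forall>n.
          c1 * (real d * ln (real n) / ln (real d)) \<le> real (q n d) \<and>
          real (q n d) \<le> c2 * (real d * ln (real n) / ln (real d))) \<and>
       (\<forall>d\<ge>d0. \<forall>n. \<forall>(V :: 'a set) E vs.
          simple_graph V E \<and> card V = n \<and> degenerate d V E \<and> C4_free V E \<and>
          distinct vs \<and> set vs = V \<longrightarrow>
          (let t = K * (n + d + 1) ^ K in
             halts_within t prog (input_store vs E d) \<and>
             measure_pmf.prob (run t prog (input_store vs E d))
               {(c, s). is_coloring V E ((1 - \<epsilon>) * (ln (real d) / real d)) (q n d)
                          (output_sets vs s)} \<ge> 1 - \<delta> n)))"
proof -
  obtain a b k d0 :: nat where b: "0 < b" and k: "2 \<le> k"
    and all: "\<forall>d\<ge>d0.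
    4 \<le> d \<and> k * start_weight a b d \<le> precision d \<and> 0 < start_weight a b d \<and> 2 * d \<le> start_weight a b d \<and>
    (\<forall>n (V :: 'a set) E vs od v.
      ordered_graph V E vs od (precision d) k (start_weight a b d) n d \<longrightarrow> v < n \<longrightarrow>
      (1 - \<epsilon> / 2) * (ln (real d) / real d) \<le>
        weighting.expect (vertex_adj vs E od) (precision d) k (start_weight a b d) v
          (\<lambda>I. weighting.prb (vertex_adj vs E od) (precision d) k (start_weight a b d) I v))"
    using parameters_exist[OF assms, where 'a = 'a] by (elim exE conjE)
  have params: "4 \<le> d" "k * start_weight a b d \<le> precision d" "0 < start_weight a b d"
      "2 * d \<le> start_weight a b d" if "d0 \<le> d" for d
    using all that by simp_all
  have prb: "(1 - \<epsilon> / 2) * (ln (real d) / real d) \<le>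
        weighting.expect (vertex_adj vs E od) (precision d) k (start_weight a b d) v
          (\<lambda>I. weighting.prb (vertex_adj vs E od) (precision d) k (start_weight a b d) I v)"
    if "d0 \<le> d" "ordered_graph V E vs od (precision d) k (start_weight a b d) n d" "v < n"
    for d n v and V :: "'a set" and E vs od
    using all that by simp
  \<comment> \<open>The number of rounds satisfies
    \<open>q * y \<ge> C / 4 * ln n \<ge> 16 / \<epsilon> ^ 3 * ln n\<close>. Together with the
    coefficient \<open>\<epsilon> ^ 3 / 8\<close> of \<open>chernoff_exponent\<close>, each vertex
    fails with probability at most \<open>1 / n ^ 2\<close>.\<close>
  define C where "C = nat \<lceil>64 / \<epsilon> ^ 3\<rceil>"
  have C: "64 / \<epsilon> ^ 3 \<le> real C" by (simp add: C_def real_nat_ceiling_ge)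
  have e3: "0 < \<epsilon> ^ 3" "\<epsilon> ^ 3 \<le> 1" using assms by (simp_all add: power_le_one)
  have "2 \<le> 64 / \<epsilon> ^ 3" using e3 by (simp add: field_simps)
  with C have C2: "2 \<le> C" by linarith
  obtain K where K: "\<And>n d. prog_time a b C n d \<le> K * (n + d + 1) ^ K"
    using polybd_prog_time[of a b C] by (auto simp: polybd_def)
  have ln_pos: "0 < ln (real d)" if "d0 \<le> d" for d using params[OF that] by simp
  show ?thesis
  proof (intro exI[of _ d0] conjI allI impI)
    fix d n :: nat and V :: "'a set" and E
    assume d: "d0 \<le> d" and g: "simple_graph V E \<and> card V = n \<and> degenerate d V E \<and> C4_free V E"
    have dpos: "0 < real d" using params[OF d] by simp
    let ?\<beta> = "(1 - \<epsilon> / 2) * (ln (real d) / real d)"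
    have "fractional_chromatic_number V E \<le> 1 / ?\<beta>"
      by (rule fractional_chromatic_number_degenerate[where k = k and M = "precision d"
            and ?W0.0 = "start_weight a b d"])
         (use g k params[OF d] prb[OF d] assms ln_pos[OF d] dpos in auto)
    also have "\<dots> = 1 / (1 - \<epsilon> / 2) * (real d / ln (real d))" by simp
    also have "\<dots> \<le> (1 + \<epsilon>) * (real d / ln (real d))"
    proof (rule mult_right_mono)
      have "\<epsilon> * \<epsilon> \<le> 1 * \<epsilon>" using assms by (intro mult_right_mono) auto
      then have "1 \<le> (1 + \<epsilon>) * (1 - \<epsilon> / 2)" by (simp add: algebra_simps)
      then show "1 / (1 - \<epsilon> / 2) \<le> 1 + \<epsilon>" using assms by (simp add: pos_divide_le_eq)
    qed (use ln_pos[OF d] in auto)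
    finally show "fractional_chromatic_number V E \<le> (1 + \<epsilon>) * (real d / ln (real d))" .
  next
    show "\<exists>(prog :: com) (K :: nat) (q :: nat \<Rightarrow> nat \<Rightarrow> nat) (c1 :: real) (c2 :: real) (\<delta> :: nat \<Rightarrow> real).
       0 < c1 \<and> 0 < c2 \<and> \<delta> \<longlonglongrightarrow> 0 \<and>
       (\<forall>d\<ge>d0. \<forall>n.
          c1 * (real d * ln (real n) / ln (real d)) \<le> real (q n d) \<and>
          real (q n d) \<le> c2 * (real d * ln (real n) / ln (real d))) \<and>
       (\<forall>d\<ge>d0. \<forall>n. \<forall>(V :: 'a set) E vs.
          simple_graph V E \<and> card V = n \<and> degenerate d V E \<and> C4_free V E \<and>
          distinct vs \<and> set vs = V \<longrightarrow>
          (let t = K * (n + d + 1) ^ K in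
             halts_within t prog (input_store vs E d) \<and>
             measure_pmf.prob (run t prog (input_store vs E d))
               {(c, s). is_coloring V E ((1 - \<epsilon>) * (ln (real d) / real d)) (q n d)
                          (output_sets vs s)} \<ge> 1 - \<delta> n))"
    proof (rule exI[of _ "Prog a b C k"], rule exI[of _ K], rule exI[of _ "rounds C"],
        rule exI[of _ "real C / 4"], rule exI[of _ "2 * real C"],
        rule exI[of _ "\<lambda>n. 2 / (real n + 1)"], intro conjI allI impI)
      show "0 < real C / 4" "0 < 2 * real C" using C2 by simp_all
      show "(\<lambda>n. 2 / (real n + 1)) \<longlonglongrightarrow> 0" by real_asymp
    next
      fix d n :: nat assume "d0 \<le> d"
      then have "4 \<le> d" using params by blast
      then show "real C / 4 * (real d * ln (real n) / ln (real d)) \<le> real (rounds C n d)"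
        "real (rounds C n d) \<le> 2 * real C * (real d * ln (real n) / ln (real d))"
        by (rule rounds_bounds[OF _ C2])+
    next
      fix d n :: nat and V :: "'a set" and E vs
      assume d: "d0 \<le> d" and g: "simple_graph V E \<and> card V = n \<and> degenerate d V E \<and> C4_free V E \<and>
          distinct vs \<and> set vs = V"
      let ?t = "K * (n + d + 1) ^ K" and ?q = "rounds C n d"
      define y where "y = ln (real d) / real d"
      have dpos: "0 < real d" and y: "0 \<le> y" using params[OF d] ln_pos[OF d] by (simp_all add: y_def)
      have len: "length vs = n" using g distinct_card by fastforce
      let ?p = "real n * exp (real ?q * (\<epsilon> / 2 * ((1 - \<epsilon>) * y) - (1 - \<epsilon> / 2) * y * (1 - exp (- (\<epsilon> / 2)))))"
      have "halts_within ?t (Prog a b C k) (input_store vs E d) \<and> 1 - ?p \<le>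
          measure_pmf.prob (run ?t (Prog a b C k) (input_store vs E d))
            {(c, s). is_coloring V E ((1 - \<epsilon>) * y) ?q (output_sets vs s)}"
        by (intro conjI prob_Prog)
           (use g len b k K params[OF d] prb[OF d] assms in \<open>auto simp: y_def\<close>)
      \<comment> \<open>The union bound gives \<open>1 / n\<close>; \<open>2 / (n + 1)\<close>
        dominates it for \<open>n \<ge> 1\<close> and also covers the empty graph.\<close>
      moreover have "?p \<le> 2 / (real n + 1)"
      proof (cases "n = 0")
        case False
        then have n: "1 \<le> real n" by simp
        have "2 * ln (real n) \<le> \<epsilon> ^ 3 / 8 * (real ?q * y)"
        proof -
          have "16 / \<epsilon> ^ 3 * ln (real n) \<le> real C / 4 * ln (real n)"
            using C n by (intro mult_right_mono) auto
          also have "\<dots> = real C / 4 * (real d * ln (real n) / ln (real d)) * y"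
            using dpos ln_pos[OF d] by (simp add: y_def)
          also have "\<dots> \<le> real ?q * y"
            using rounds_bounds(1)[OF _ C2, of d n] params[OF d] y by (intro mult_right_mono) auto
          finally have "\<epsilon> ^ 3 / 8 * (16 / \<epsilon> ^ 3 * ln (real n)) \<le> \<epsilon> ^ 3 / 8 * (real ?q * y)"
            using e3 by (intro mult_left_mono) auto
          then show ?thesis using e3 by simp
        qed
        moreover have "real ?q * (\<epsilon> / 2 * ((1 - \<epsilon>) * y) - (1 - \<epsilon> / 2) * y * (1 - exp (- (\<epsilon> / 2)))) \<le>
            real ?q * (- (\<epsilon> ^ 3 / 8) * y)"
          by (intro mult_left_mono chernoff_exponent assms y) auto
        moreover have "real ?q * (- (\<epsilon> ^ 3 / 8) * y) = - (\<epsilon> ^ 3 / 8 * (real ?q * y))" by simp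
        ultimately have "real ?q * (\<epsilon> / 2 * ((1 - \<epsilon>) * y) - (1 - \<epsilon> / 2) * y * (1 - exp (- (\<epsilon> / 2)))) \<le>
            - (2 * ln (real n))" by linarith
        then have "?p \<le> real n * exp (- (2 * ln (real n)))"
          by (intro mult_left_mono iffD2[OF exp_le_cancel_iff]) auto
        also have "exp (- (2 * ln (real n))) = 1 / (real n * real n)"
          using n by (simp add: exp_minus exp_double power2_eq_square divide_inverse)
        also have "real n * (1 / (real n * real n)) = 1 / real n" using n by simp
        also have "\<dots> \<le> 2 / (real n + 1)" using n by (simp add: field_simps)
        finally show ?thesis .
      qed simp
      ultimately show "let t = ?t in
             halts_within t (Prog a b C k) (input_store vs E d) \<and>
             measure_pmf.prob (run t (Prog a b C k) (input_store vs E d))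
               {(c, s). is_coloring V E ((1 - \<epsilon>) * (ln (real d) / real d)) ?q
                          (output_sets vs s)} \<ge> 1 - 2 / (real n + 1)"
        by (simp add: Let_def y_def)
    qed
  qed
qed

end
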